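(* Suppose that $Q$ has maximum volume among all convex polytopes with nine vertices inscribed in $\mathbb{S}^2$. Then $Q$ has no trivalent vertex.
   Context: $\mathbb{S}^2$ is the unit sphere in $\mathbb{R}^3$. A polytope is inscribed in $\mathbb{S}^2$ if all of its vertices lie on $\mathbb{S}^2$. A vertex is trivalent if it has degree 3, i.e. it is incident with exactly three edges of the polytope. *)

theory Defs
  imports "HOL-Analysis.Analysis"
begin

definition vertices :: "'a::euclidean_space set \<Rightarrow> 'a set" where
  "vertices P = {v. v extreme_point_of P}"

definition vertex_degree :: "'a::euclidean_space set \<Rightarrow> 'a \<Rightarrow> nat" where
  "vertex_degree P v = card {e. e edge_of P \<and> v \<in> e}"

definition trivalent_vertex :: "'a::euclidean_space set \<Rightarrow> 'a \<Rightarrow> bool" where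
  "trivalent_vertex P v \<longleftrightarrow> v \<in> vertices P \<and> vertex_degree P v = 3"

definition inscribed_in :: "'a::euclidean_space set \<Rightarrow> 'a set \<Rightarrow> bool" where
  "inscribed_in P S \<longleftrightarrow> vertices P \<subseteq> S"

(* Polytopes of dimension less than 3 are admitted; they have volume 0. *)
definition inscribed_polytopes :: "nat \<Rightarrow> (real ^ 3) set set" where
  "inscribed_polytopes n =
     {P. polytope P \<and> card (vertices P) = n \<and> inscribed_in P (sphere 0 1)}"

end

theory Submission
  imports Defs
begin

text \<open>Let the centre of the sphere be interior to an inscribed polytope with \<open>n\<close> vertices in general
  position. The cones over the faces partition space up to a null set, and so do, at each vertex, the
  wedges spanned by the faces there; with Girard's formula this gives \<open>2n - 4\<close> faces and total solid
  angle \<open>4 pi\<close>. The cone over a face of solid angle \<open>\<sigma>\<close> has volume at most that of the equilateral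
  one, hence at most \<open>\<alpha> \<sigma> + \<beta>\<close> for each tangent line of that concave function (Fejes Toth).
  General inscribed polytopes follow by perturbation.

  If \<open>v\<close> is trivalent with neighbours \<open>a, b, c\<close>, then \<open>Q\<close> is the hull \<open>Q'\<close> of the other eight
  vertices together with a tetrahedron on the facet \<open>abc\<close> of \<open>Q'\<close>. If the centre is interior to
  \<open>Q'\<close>, maximality puts \<open>v\<close> at the pole of \<open>abc\<close> and makes \<open>abc\<close> acute; the tetrahedron and the cone over
  \<open>abc\<close> then have total volume \<open>area(abc) / 3\<close>, which is bounded in terms of the solid angle of
  \<open>abc\<close>, and the other eleven faces by the tangent line. This gives a volume below 2.03.
  Otherwise \<open>Q'\<close> lies on one side of the centre, and the bound for the hull of \<open>Q'\<close> and \<open>-Q'\<close>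
  gives a volume below 2.02. But a triangular prism with caps on its three rectangles has volume
  greater than 2.04.\<close>

text \<open>An estimate per face that is affine in its solid angle sums to a bound that depends only
  on the number of vertices, so no combinatorial types have to be enumerated. For nine vertices,
  hence fourteen faces, this bound still exceeds the volume of the capped prism; the gain has to
  come from the three faces at \<open>v\<close>. The cones over them make up the cone over
  \<open>abc\<close> together with the tetrahedron, and with \<open>v\<close> at the pole the two
  heights over \<open>abc\<close> add up to the radius. Hence area replaces volume for this one
  face. The number of faces is determined only when all faces are triangles, which is the reason for
  general position; the perturbation has to leave \<open>a\<close>, \<open>b\<close>,
  \<open>c\<close> in place, since otherwise the facet \<open>abc\<close> could be lost. Tangent
  points and example are rational up to \<open>sqrt 3\<close>, so that each final comparison is
  linear in \<open>pi\<close>, \<open>sqrt 3\<close> and one arctangent.\<close>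

section \<open>Determinants and the volume of a tetrahedron\<close>

definition det3 :: "real^3 \<Rightarrow> real^3 \<Rightarrow> real^3 \<Rightarrow> real" where
  "det3 a b c = a \<bullet> cross3 b c"

lemma det3_expand:
  "det3 a b c = a$1*(b$2*c$3 - b$3*c$2) + a$2*(b$3*c$1 - b$1*c$3) + a$3*(b$1*c$2 - b$2*c$1)"
  by (simp add: det3_def inner_vec_def sum_3 cross_components algebra_simps)

lemma inner3: "(a::real^3) \<bullet> b = a$1*b$1 + a$2*b$2 + a$3*b$3"
  by (simp add: inner_vec_def sum_3)

lemma vec3_eq: "(a::real^3) = b \<longleftrightarrow> a$1 = b$1 \<and> a$2 = b$2 \<and> a$3 = b$3"
  by (auto simp: vec_eq_iff forall_3)

text \<open>The linear map \<open>g\<close> sends the standard simplex, of volume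
  \<open>1/6\<close>, onto the translate of the tetrahedron that has \<open>v\<close> at the origin.
  The argument covers flat tetrahedra, where both sides vanish.\<close>

lemma measure_tetrahedron:
  "measure lebesgue (convex hull {v,a,b,c}) = \<bar>det3 (a - v) (b - v) (c - v)\<bar> / 6"
proof -
  define g where "g x = x$1 *\<^sub>R (a-v) + x$2 *\<^sub>R (b-v) + x$3 *\<^sub>R (c-v)" for x :: "real^3"
  define std where "std = (convex hull (insert 0 Basis) :: (real^3) set)"
  have lin: "linear g"
    by (intro linearI) (simp_all add: g_def algebra_simps)
  have compact: "compact std" unfolding std_def
    by (intro finite_imp_compact_convex_hull) auto
  have "measure lebesgue (convex hull {v,a,b,c}) = measure lebesgue ((+) (-v) ` (convex hull {v,a,b,c}))"
    by (rule measure_translation [symmetric])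
  also have "(+) (-v) ` (convex hull {v,a,b,c}) = convex hull ((+) (-v) ` {v,a,b,c})"
    by (rule convex_hull_translation [symmetric])
  also have "(+) (-v) ` {v,a,b,c} = {0, a-v, b-v, c-v}"
    by auto
  also have "{0, a-v, b-v, c-v} = g ` (insert 0 Basis)"
  proof -
    have B: "(Basis :: (real^3) set) = {axis 1 1, axis 2 1, axis 3 1}"
      by (auto simp: Basis_vec_def UNIV_3)
    have "g 0 = 0" "g (axis 1 1) = a - v" "g (axis 2 1) = b - v" "g (axis 3 1) = c - v"
      by (simp_all add: g_def axis_def)
    then show ?thesis unfolding B by simp
  qed
  also have "convex hull (g ` (insert 0 Basis)) = g ` std"
    unfolding std_def using lin by (simp add: convex_hull_linear_image)
  also have "measure lebesgue (g ` std) = \<bar>det (matrix g)\<bar> * measure lebesgue std"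
    using compact lin by (intro measure_linear_image) (auto intro: lmeasurable_compact)
  also have "measure lebesgue std = measure lborel std" using compact
    by (intro measure_completion) (auto dest: compact_imp_closed)
  also have "\<dots> = 1 / 6" unfolding std_def
    by (simp add: content_std_simplex fact_numeral)
  also have "det (matrix g) = det3 (a - v) (b - v) (c - v)"
    by (simp add: det_3 det3_expand matrix_def g_def axis_def algebra_simps)
  finally show ?thesis by simp
qed

lemma det3_perm:
  "det3 b c a = det3 a b c" "det3 c a b = det3 a b c" "det3 b a c = - det3 a b c"
  "det3 a c b = - det3 a b c" "det3 c b a = - det3 a b c"
  by (simp_all add: det3_expand algebra_simps)

lemma det3_same: "det3 a a b = 0" "det3 a b a = 0" "det3 b a a = 0"
  by (simp_all add: det3_expand algebra_simps)

lemma det3_linear: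
  "det3 (x + y) b c = det3 x b c + det3 y b c" "det3 a (x + y) c = det3 a x c + det3 a y c"
  "det3 a b (x + y) = det3 a b x + det3 a b y"
  "det3 (x - y) b c = det3 x b c - det3 y b c" "det3 a (x - y) c = det3 a x c - det3 a y c"
  "det3 a b (x - y) = det3 a b x - det3 a b y"
  "det3 (r *\<^sub>R x) b c = r * det3 x b c" "det3 a (r *\<^sub>R x) c = r * det3 a x c"
  "det3 a b (r *\<^sub>R x) = r * det3 a b x"
  "det3 (- x) b c = - det3 x b c" "det3 a (- x) c = - det3 a x c"
  "det3 a b (- x) = - det3 a b x"
  "det3 0 b c = 0" "det3 a 0 c = 0" "det3 a b 0 = 0"
  by (simp_all add: det3_expand algebra_simps)

text \<open>Cramer's rule, kept free of division. It turns membership in the cone of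
  \<open>a\<close>, \<open>b\<close>, \<open>c\<close> into signs of determinants.\<close>

lemma cramer3:
  "det3 a b c *\<^sub>R x = det3 x b c *\<^sub>R a + det3 a x c *\<^sub>R b + det3 a b x *\<^sub>R c"
  by (simp add: vec3_eq det3_expand algebra_simps)

lemma det3_eq_0_orthogonal:
  assumes "u \<noteq> 0" "u \<bullet> a = 0" "u \<bullet> b = 0" "u \<bullet> c = 0"
  shows "det3 a b c = 0"
proof (rule ccontr)
  assume "det3 a b c \<noteq> 0"
  have "det3 a b c * (u \<bullet> u) = u \<bullet> (det3 u b c *\<^sub>R a + det3 a u c *\<^sub>R b + det3 a b u *\<^sub>R c)"
    using cramer3[of a b c u] by (metis inner_scaleR_right)
  also have "\<dots> = 0" using assms by (simp add: inner_add_right)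
  finally show False using \<open>det3 a b c \<noteq> 0\<close> \<open>u \<noteq> 0\<close> by simp
qed

lemma det3_square_gram_general:
  "(det3 a b c)\<^sup>2 = (a\<bullet>a)*(b\<bullet>b)*(c\<bullet>c) + 2*(b \<bullet> c)*(c \<bullet> a)*(a \<bullet> b)
     - (a\<bullet>a)*(b \<bullet> c)\<^sup>2 - (b\<bullet>b)*(c \<bullet> a)\<^sup>2 - (c\<bullet>c)*(a \<bullet> b)\<^sup>2"
  unfolding det3_expand inner3 by algebra

lemma det3_square_gram:
  assumes "norm a = 1" "norm b = 1" "norm c = 1"
  shows "(det3 a b c)\<^sup>2 = 1 + 2*(b \<bullet> c)*(c \<bullet> a)*(a \<bullet> b) - (b \<bullet> c)\<^sup>2 - (c \<bullet> a)\<^sup>2 - (a \<bullet> b)\<^sup>2"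
  using assms det3_square_gram_general[of a b c] by (simp add: norm_eq_1)

section \<open>Solid angles\<close>

text \<open>For a cone \<open>S\<close> this is one third of its solid angle. Lebesgue measure
  inside the unit ball stands in for area on the sphere.\<close>

definition ball_vol :: "(real^3) set \<Rightarrow> real" where
  "ball_vol S = measure lebesgue (S \<inter> ball 0 1)"

text \<open>Cauchy's functional equation on an interval: additivity and nonnegativity make
  \<open>K\<close> monotone, and then \<open>K t\<close> is squeezed between the values at
  neighbouring multiples of \<open>L / n\<close>.\<close>

lemma additive_nonneg_imp_linear:
  fixes K :: "real \<Rightarrow> real"
  assumes add: "\<And>s t. 0 \<le> s \<Longrightarrow> 0 \<le> t \<Longrightarrow> s + t \<le> L \<Longrightarrow> K (s + t) = K s + K t"
    and nn: "\<And>t. 0 \<le> t \<Longrightarrow> t \<le> L \<Longrightarrow> 0 \<le> K t"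
    and L: "L > 0" and t: "0 \<le> t" "t \<le> L"
  shows "K t = K L * t / L"
proof -
  have mono: "K s \<le> K t" if "0 \<le> s" "s \<le> t" "t \<le> L" for s t
    using add[of s "t - s"] nn[of "t - s"] that by simp
  have K0: "K 0 = 0" using add[of 0 0] L by simp
  have mult: "real k * s \<le> L \<Longrightarrow> 0 \<le> s \<Longrightarrow> K (real k * s) = real k * K s" for k s
  proof (induction k)
    case (Suc k)
    have "real k * s \<le> L" using Suc.prems by (simp add: algebra_simps)
    then show ?case using Suc add[of s "real k * s"] by (simp add: algebra_simps)
  qed (simp add: K0)
  have *: "\<bar>K t - K L * t / L\<bar> \<le> K L / real n" if "n > 0" for n
  \<comment> \<open>For \<open>t = L\<close> the multiple \<open>Suc k\<close> of
    \<open>L / n\<close> used below would leave the interval on which \<open>K\<close> is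
    additive.\<close>
  proof (cases "t = L")
    case True then show ?thesis using L nn[of L] by simp
  next
    case False
    define k where "k = nat \<lfloor>real n * t / L\<rfloor>"
    have k: "real k \<le> real n * t / L" "real n * t / L < real k + 1"
      using t L by (auto simp: k_def)
    have "real n * t / L < real n" using False t L that by (simp add: field_simps)
    then have kn: "k < n" using k by linarith
    have KL: "K L = real n * K (L / real n)"
      using mult[of n "L / real n"] that L by simp
    have a: "real k * (L / real n) \<le> t" using k(1) L that by (simp add: field_simps)
    have b: "t \<le> real (Suc k) * (L / real n)" using k(2) L that by (simp add: field_simps)
    have c: "real (Suc k) * (L / real n) \<le> L"
    proof -
      have "real (Suc k) * L \<le> real n * L" using kn L by (intro mult_right_mono) auto
      then show ?thesis using that by (simp add: field_simps)
    qed
    have d: "K (real k * (L / real n)) \<le> K t" using a t L by (intro mono) auto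
    have e: "K t \<le> K (real (Suc k) * (L / real n))" using b c t by (intro mono) auto
    have kL: "real k * (L / real n) \<le> L" using a t by linarith
    have d': "real k * (K L / real n) \<le> K t"
      using d mult[OF kL] L KL that by simp
    have e': "K t \<le> real (Suc k) * (K L / real n)"
      using e mult[OF c] L KL that by simp
    have KLn: "0 \<le> K L" using nn[of L] L by simp
    have f: "real k * (K L / real n) \<le> K L * t / L"
      using mult_right_mono[OF k(1), of "K L / real n"] KLn that by (simp add: field_simps)
    have g: "K L * t / L \<le> real (Suc k) * (K L / real n)"
      using mult_right_mono[OF less_imp_le[OF k(2)], of "K L / real n"] KLn that by (simp add: field_simps)
    have "real (Suc k) * (K L / real n) = real k * (K L / real n) + K L / real n"
      by (simp add: algebra_simps add_divide_distrib)
    then show ?thesis using d' e' f g by linarith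
  qed
  have "(\<lambda>n. K L / real n) \<longlonglongrightarrow> 0" by (rule lim_const_over_n)
  then have "\<bar>K t - K L * t / L\<bar> \<le> 0"
    by (rule tendsto_lowerbound) (auto intro!: eventually_sequentiallyI[of 1] *)
  then show ?thesis by simp
qed

lemma lmeasurable_cut_ball [simp]:
  fixes n1 n2 :: "'a::euclidean_space"
  shows "{x. n1 \<bullet> x > 0 \<and> n2 \<bullet> x < 0} \<inter> ball 0 1 \<in> lmeasurable"
proof -
  have "open ({x. n1 \<bullet> x > 0} \<inter> {x. n2 \<bullet> x < 0})"
    by (intro open_Int open_halfspace_gt open_halfspace_lt)
  then have "open {x. n1 \<bullet> x > 0 \<and> n2 \<bullet> x < 0}"
    by (simp add: Collect_conj_eq)
  then show ?thesis
    by (intro lmeasurable_open) (auto intro: open_Int bounded_subset[OF bounded_ball])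
qed

text \<open>The second half-space is negative so that the opening is the angle \<open>t\<close>
  between the normals and not its supplement.\<close>

definition lune :: "real \<Rightarrow> real" where
  "lune t = ball_vol {x. axis 1 1 \<bullet> x > 0 \<and> (cos t *\<^sub>R axis 1 1 + sin t *\<^sub>R axis 2 1) \<bullet> x < 0}"

lemma orthonormal_frame_norm:
  fixes e1 e2 x :: "real^3"
  assumes "norm e1 = 1" "norm e2 = 1" "e1 \<bullet> e2 = 0"
  shows "(e1 \<bullet> x)\<^sup>2 + (e2 \<bullet> x)\<^sup>2 + (cross3 e1 e2 \<bullet> x)\<^sup>2 = x \<bullet> x"
proof -
  have "cross3 e1 e2 \<bullet> x = det3 x e1 e2" by (simp add: det3_def inner_commute)
  moreover have "e1 \<bullet> e1 = 1" "e2 \<bullet> e2 = 1" using assms by (simp_all add: dot_square_norm)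
  ultimately show ?thesis
    using det3_square_gram_general[of x e1 e2] assms(3) by (simp add: inner_commute)
qed

text \<open>Coordinates with respect to \<open>e1\<close>, \<open>e2\<close>,
  \<open>cross3 e1 e2\<close> give an isometry onto the standard frame.\<close>

lemma ball_vol_lune_frame:
  fixes e1 e2 :: "real^3"
  assumes "norm e1 = 1" "norm e2 = 1" "e1 \<bullet> e2 = 0"
  shows "ball_vol {x. e1 \<bullet> x > 0 \<and> (cos t *\<^sub>R e1 + sin t *\<^sub>R e2) \<bullet> x < 0} = lune t"
proof -
  define f :: "real^3 \<Rightarrow> real^3" where
    "f x = (e1 \<bullet> x) *\<^sub>R axis 1 1 + (e2 \<bullet> x) *\<^sub>R axis 2 1 + (cross3 e1 e2 \<bullet> x) *\<^sub>R axis 3 1" for x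
  have comp: "f x $ 1 = e1 \<bullet> x" "f x $ 2 = e2 \<bullet> x" "f x $ 3 = cross3 e1 e2 \<bullet> x" for x
    by (simp_all add: f_def axis_def)
  have lin: "linear f"
    by (intro linearI) (simp_all add: f_def inner_add_right algebra_simps)
  have nrm: "norm (f x) = norm x" for x
  proof -
    have "f x \<bullet> f x = x \<bullet> x"
      using orthonormal_frame_norm[OF assms, of x] by (simp add: inner3[of "f x"] comp power2_eq_square)
    then show ?thesis by (simp add: norm_eq_sqrt_inner)
  qed
  have orth: "orthogonal_transformation f"
    using lin nrm by (simp add: orthogonal_transformation)
  have "{x. axis 1 1 \<bullet> x > 0 \<and> (cos t *\<^sub>R axis 1 1 + sin t *\<^sub>R axis 2 1) \<bullet> x < 0} \<inter> ball 0 1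
     = f ` ({x. e1 \<bullet> x > 0 \<and> (cos t *\<^sub>R e1 + sin t *\<^sub>R e2) \<bullet> x < 0} \<inter> ball 0 1)" (is "?A = f ` ?B")
  proof
    show "f ` ?B \<subseteq> ?A"
      by (auto simp: nrm inner_add_left inner_axis' comp)
    show "?A \<subseteq> f ` ?B"
    proof
      fix y assume y: "y \<in> ?A"
      obtain x where x: "y = f x" using orthogonal_transformation_surj[OF orth] by (metis surjD)
      then have "x \<in> ?B" using y by (auto simp: nrm inner_add_left inner_axis' comp)
      then show "y \<in> f ` ?B" using x by blast
    qed
  qed
  then show ?thesis unfolding lune_def ball_vol_def
    using measure_orthogonal_image[OF orth lmeasurable_cut_ball] by metis
qed

lemma ex_orthogonal_unit:
  fixes e1 :: "real^3" assumes "norm e1 = 1"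
  shows "\<exists>e2. norm e2 = 1 \<and> e1 \<bullet> e2 = 0"
proof -
  have "e1 \<noteq> 0" using assms by auto
  then obtain w where w: "cross3 e1 w \<noteq> 0" using cross_basis_nonzero by blast
  have "norm (cross3 e1 w /\<^sub>R norm (cross3 e1 w)) = 1" using w by simp
  moreover have "e1 \<bullet> (cross3 e1 w /\<^sub>R norm (cross3 e1 w)) = 0" by (simp add: dot_cross_self)
  ultimately show ?thesis by blast
qed

lemma ball_vol_lune:
  fixes n1 n2 :: "real^3"
  assumes n: "norm n1 = 1" "norm n2 = 1" and t: "n1 \<bullet> n2 = cos t" 
  shows "ball_vol {x. n1 \<bullet> x > 0 \<and> n2 \<bullet> x < 0} = lune t"
proof -
  have nn: "n1 \<bullet> n1 = 1" "n2 \<bullet> n2 = 1" using n by (simp_all add: norm_eq_1)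
  have exp: "(n2 - r *\<^sub>R n1) \<bullet> (n2 - r *\<^sub>R n1) = n2 \<bullet> n2 - 2 * r * (n1 \<bullet> n2) + r * r * (n1 \<bullet> n1)" for r
    by (simp add: inner_diff inner_commute algebra_simps)
  have "\<exists>e2. norm e2 = 1 \<and> n1 \<bullet> e2 = 0 \<and> n2 = cos t *\<^sub>R n1 + sin t *\<^sub>R e2"
  \<comment> \<open>Parallel normals leave the direction of \<open>e2\<close> undetermined; any
    orthogonal unit vector then serves.\<close>
  proof (cases "sin t = 0")
    case True
    obtain e2 where e2: "norm e2 = 1" "n1 \<bullet> e2 = 0" using ex_orthogonal_unit[OF n(1)] by blast
    have c: "(cos t)\<^sup>2 = 1" using True sin_cos_squared_add[of t] by simp
    have "(n2 - cos t *\<^sub>R n1) \<bullet> (n2 - cos t *\<^sub>R n1) = 1 - 2*cos t*cos t + cos t*cos t"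
      unfolding exp using nn t by simp
    also have "\<dots> = 0" using c by (simp add: power2_eq_square)
    finally have "n2 = cos t *\<^sub>R n1" by simp
    then show ?thesis using e2 True by auto
  next
    case False
    define e2 where "e2 = (1 / sin t) *\<^sub>R (n2 - cos t *\<^sub>R n1)"
    have "n1 \<bullet> e2 = 0" using nn t by (simp add: e2_def inner_diff_right)
    moreover have "e2 \<bullet> e2 = (1 / sin t) * ((1 / sin t) * ((n2 - cos t *\<^sub>R n1) \<bullet> (n2 - cos t *\<^sub>R n1)))"
      by (simp only: e2_def inner_scaleR_left inner_scaleR_right)
    then have "e2 \<bullet> e2 = (1 - (cos t)\<^sup>2) / (sin t)\<^sup>2"
      unfolding exp using nn t by (simp add: power2_eq_square)
    then have "e2 \<bullet> e2 = 1" unfolding sin_squared_eq[symmetric] using False by simp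
    moreover have "n2 = cos t *\<^sub>R n1 + sin t *\<^sub>R e2" using False by (simp add: e2_def)
    ultimately show ?thesis by (auto simp: norm_eq_1)
  qed
  then show ?thesis using ball_vol_lune_frame[OF n(1)] by blast
qed

lemma negligible_orthogonal:
  fixes n :: "'a::euclidean_space"
  shows "n \<noteq> 0 \<Longrightarrow> negligible {x. n \<bullet> x = 0}"
  using negligible_hyperplane[of n 0] by blast

lemma measure_eq_off_negligible:
  assumes "S \<in> lmeasurable" "negligible N" "(S - T) \<union> (T - S) \<subseteq> N"
  shows "measure lebesgue S = measure lebesgue T"
  using measure_negligible_symdiff[OF assms(1) negligible_subset[OF assms(2,3)]] by simp

lemma measure_disjoint_Un:
  assumes "S \<in> lmeasurable" "T \<in> lmeasurable" "S \<inter> T = {}"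
  shows "measure lebesgue (S \<union> T) = measure lebesgue S + measure lebesgue T"
  using measure_Un3[OF assms(1,2)] assms(3) by simp

text \<open>The plane with normal \<open>n s\<close> cuts the lune in two. By the sine identity
  \<open>key\<close>, \<open>n s\<close> scaled by \<open>sin (s + t)\<close> is a positive
  combination of the outer normals \<open>n 0\<close> and \<open>n (s + t)\<close>, so a point of
  either part satisfies the outer conditions.\<close>

lemma lune_add:
  assumes "0 \<le> s" "0 \<le> t" "s + t \<le> pi"
  shows "lune (s + t) = lune s + lune t"
proof (cases "s = 0 \<or> t = 0")
  case True
  have "lune 0 = 0"
  proof -
    have "{x. axis 1 1 \<bullet> x > (0::real) \<and> axis 1 1 \<bullet> x < 0} = ({} :: (real^3) set)" by auto
    then show ?thesis unfolding lune_def ball_vol_def cos_zero sin_zero scaleR_one scaleR_zero_left add_0_right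
      by (simp only: Int_empty_left measure_empty)
  qed
  then show ?thesis using True by auto
next
  case False
  define n where "n u = cos u *\<^sub>R axis 1 1 + sin u *\<^sub>R (axis 2 1 :: real^3)" for u
  have inn: "n u \<bullet> n v = cos (u - v)" for u v
    by (simp add: n_def inner3 axis_def cos_diff)
  have nn: "norm (n u) = 1" for u using inn[of u u] by (simp add: norm_eq_1)
  define P where "P u v = {x. n u \<bullet> x > 0 \<and> n v \<bullet> x < 0} \<inter> ball 0 1" for u v
  have P: "measure lebesgue (P u v) = lune (v - u)" for u v
    using ball_vol_lune[OF nn nn, of u v "v - u"] inn[of u v] cos_minus[of "u - v"]
    by (simp add: P_def ball_vol_def)
  have n0: "n u \<noteq> 0" for u using nn[of u] by auto
  have key: "sin (s + t) *\<^sub>R n s = sin t *\<^sub>R n 0 + sin s *\<^sub>R n (s + t)"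
  proof -
    have e: "sin t + sin s * cos (s+t) = sin (s+t) * cos s"
    proof -
      have "sin t = sin (s + t - s)" by simp
      also have "\<dots> = sin (s+t) * cos s - cos (s+t) * sin s" by (rule sin_diff)
      finally show ?thesis by simp
    qed
    show ?thesis
      by (simp add: n_def vec3_eq axis_def) (use e in \<open>simp add: algebra_simps\<close>)
  qed
  have pos: "sin s > 0" "sin t > 0" using False assms by (auto intro!: sin_gt_zero)
  have st: "sin (s + t) \<ge> 0" using assms by (auto intro!: sin_ge_zero)
  have keyx: "sin (s + t) * (n s \<bullet> x) = sin t * (n 0 \<bullet> x) + sin s * (n (s + t) \<bullet> x)" for x
    using arg_cong[OF key, of "\<lambda>z. z \<bullet> x"] by (simp add: inner_add_left)
  have sub1: "P 0 s \<subseteq> P 0 (s + t)"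
  proof
    fix x assume x: "x \<in> P 0 s"
    then have "sin (s + t) * (n s \<bullet> x) \<le> 0" "sin t * (n 0 \<bullet> x) > 0"
      using st pos by (auto simp: P_def mult_nonneg_nonpos)
    then have "sin s * (n (s + t) \<bullet> x) < 0" using keyx[of x] by linarith
    then show "x \<in> P 0 (s + t)" using x pos by (auto simp: P_def mult_less_0_iff)
  qed
  have sub2: "P s (s + t) \<subseteq> P 0 (s + t)"
  proof
    fix x assume x: "x \<in> P s (s + t)"
    then have "sin (s + t) * (n s \<bullet> x) \<ge> 0" "sin s * (n (s + t) \<bullet> x) < 0"
      using st pos by (auto simp: P_def mult_pos_neg)
    then have "sin t * (n 0 \<bullet> x) > 0" using keyx[of x] by linarith
    then show "x \<in> P 0 (s + t)" using x pos by (auto simp: P_def zero_less_mult_iff)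
  qed
  have meas: "P u v \<in> lmeasurable" for u v unfolding P_def by simp
  have "(P 0 (s + t) - (P 0 s \<union> P s (s + t))) \<union> (P 0 s \<union> P s (s + t) - P 0 (s + t)) \<subseteq> {x. n s \<bullet> x = 0}"
    using sub1 sub2 by (auto simp: P_def)
  then have "measure lebesgue (P 0 (s + t)) = measure lebesgue (P 0 s \<union> P s (s + t))"
    using measure_eq_off_negligible[OF meas negligible_orthogonal[OF n0]] by blast
  also have "\<dots> = measure lebesgue (P 0 s) + measure lebesgue (P s (s + t))"
    by (rule measure_disjoint_Un) (use meas in \<open>auto simp: P_def\<close>)
  finally show ?thesis using P[of 0 "s+t"] P[of 0 s] P[of s "s+t"] by simp
qed

lemma ball3_volume: "measure lebesgue (ball (0::real^3) 1) = 4 / 3 * pi"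
  using content_ball[of 1 "0::real^3"] by (simp add: eval_unit_ball_vol)

lemma ball_vol_halfspace:
  assumes "n \<noteq> 0" shows "ball_vol {x. n \<bullet> x > 0} = 2 / 3 * pi"
proof -
  let ?P = "{x. n \<bullet> x > 0} \<inter> ball 0 1" and ?N = "{x. n \<bullet> x < 0} \<inter> ball (0::real^3) 1"
  have meas: "?P \<in> lmeasurable" "?N \<in> lmeasurable"
    by (auto intro!: lmeasurable_open open_Int open_halfspace_gt open_halfspace_lt intro: bounded_subset[OF bounded_ball])
  have "?N = uminus ` ?P"
  proof (intro set_eqI iffI)
    fix x assume "x \<in> ?N"
    then have "- x \<in> ?P" by simp
    then show "x \<in> uminus ` ?P" by (metis image_eqI minus_minus)
  qed auto
  also have "measure lebesgue (uminus ` ?P) = measure lebesgue ?P"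
    by (rule measure_orthogonal_image[OF _ meas(1)]) (simp add: orthogonal_transformation linear_uminus)
  finally have eq: "measure lebesgue ?N = measure lebesgue ?P" .
  have "measure lebesgue (ball (0::real^3) 1) = measure lebesgue (?P \<union> ?N)"
    by (rule measure_eq_off_negligible[OF lmeasurable_ball negligible_orthogonal[OF assms]]) auto
  also have "\<dots> = measure lebesgue ?P + measure lebesgue ?N"
    by (rule measure_disjoint_Un) (use meas in auto)
  finally show ?thesis using eq ball3_volume unfolding ball_vol_def by simp
qed

text \<open>Additivity makes \<open>lune\<close> linear on \<open>[0, pi]\<close>, and the opening
  \<open>pi\<close> gives half the ball.\<close>

lemma lune_eq: assumes "0 \<le> t" "t \<le> pi" shows "lune t = 2 / 3 * t"
proof -
  have "lune t = lune pi * t / pi"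
  proof (rule additive_nonneg_imp_linear)
    show "0 \<le> lune t" for t unfolding lune_def ball_vol_def by (rule measure_nonneg)
  qed (use assms lune_add in auto)
  moreover have "lune pi = 2 / 3 * pi"
  proof -
    have "{x. axis 1 1 \<bullet> x > 0 \<and> (cos pi *\<^sub>R axis 1 1 + sin pi *\<^sub>R axis 2 1) \<bullet> x < 0} = {x. axis 1 1 \<bullet> x > (0::real)}"
      by (simp add: inner_axis')
    then show ?thesis using ball_vol_halfspace[of "axis 1 1"] unfolding lune_def by simp
  qed
  ultimately show ?thesis by simp
qed

lemma ball_vol_two_halfspaces:
  fixes n1 n2 :: "real^3"
  assumes n: "n1 \<noteq> 0" "n2 \<noteq> 0" and t: "n1 \<bullet> n2 = norm n1 * norm n2 * cos t" "0 \<le> t" "t \<le> pi"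
  shows "ball_vol {x. n1 \<bullet> x > 0 \<and> n2 \<bullet> x < 0} = 2 / 3 * t"
proof -
  have "{x. n1 \<bullet> x > 0 \<and> n2 \<bullet> x < 0} = {x. (n1 /\<^sub>R norm n1) \<bullet> x > 0 \<and> (n2 /\<^sub>R norm n2) \<bullet> x < 0}"
    using n by (auto simp: zero_less_mult_iff mult_less_0_iff)
  moreover have "ball_vol {x. (n1 /\<^sub>R norm n1) \<bullet> x > 0 \<and> (n2 /\<^sub>R norm n2) \<bullet> x < 0} = lune t"
    by (rule ball_vol_lune) (use n t in \<open>auto simp: field_simps\<close>)
  ultimately show ?thesis using lune_eq t by simp
qed

text \<open>The argument of the complex number \<open>N + i D\<close> for \<open>D > 0\<close>. The
  arc cotangent form takes values in \<open>(0, pi)\<close> for either sign of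
  \<open>N\<close>.\<close>

definition carg :: "real \<Rightarrow> real \<Rightarrow> real" where
  "carg N D = pi / 2 - arctan (N / D)"

lemma carg_bounds: "0 < carg N D" "carg N D < pi"
  using arctan_bounded[of "N / D"] by (auto simp: carg_def)

lemma carg_cis:
  assumes "D > 0"
  shows "Complex N D = of_real (sqrt (N\<^sup>2 + D\<^sup>2)) * cis (carg N D)"
    and "N = sqrt (N\<^sup>2 + D\<^sup>2) * cos (carg N D)"
proof -
  have s: "sqrt (1 + (N / D)\<^sup>2) = sqrt (N\<^sup>2 + D\<^sup>2) / D"
  proof -
    have "1 + (N / D)\<^sup>2 = (N\<^sup>2 + D\<^sup>2) / D\<^sup>2" using assms by (simp add: field_simps)
    then show ?thesis using assms by (simp add: real_sqrt_divide)
  qed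
  have p: "sqrt (N\<^sup>2 + D\<^sup>2) > 0" using assms by (simp add: add_nonneg_pos)
  show c: "N = sqrt (N\<^sup>2 + D\<^sup>2) * cos (carg N D)"
    using p assms by (simp add: carg_def cos_diff sin_arctan s)
  have d: "D = sqrt (N\<^sup>2 + D\<^sup>2) * sin (carg N D)"
    using p assms by (simp add: carg_def sin_diff cos_arctan s)
  show "Complex N D = of_real (sqrt (N\<^sup>2 + D\<^sup>2)) * cis (carg N D)"
    using c d by (simp add: complex_eq_iff)
qed

lemma open_signs:
  fixes n1 n2 n3 :: "'a::euclidean_space"
  shows "open {x. n1 \<bullet> x > 0 \<and> n2 \<bullet> x > 0 \<and> n3 \<bullet> x > 0}"
    "open {x. n1 \<bullet> x > 0 \<and> n2 \<bullet> x > 0}"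
  by (auto simp: Collect_conj_eq intro!: open_Int open_halfspace_gt)

lemma ball_vol_split:
  assumes "open S" "n \<noteq> 0"
  shows "ball_vol S = ball_vol (S \<inter> {x. n \<bullet> x > 0}) + ball_vol (S \<inter> {x. (-n) \<bullet> x > 0})"
proof -
  let ?P = "S \<inter> {x. n \<bullet> x > 0} \<inter> ball 0 1" and ?N = "S \<inter> {x. (-n) \<bullet> x > 0} \<inter> ball 0 1"
  have op: "open ?P" "open ?N"
    using assms by (intro open_Int open_halfspace_gt open_ball; simp)+
  have meas: "?P \<in> lmeasurable" "?N \<in> lmeasurable"
    by (intro lmeasurable_open op bounded_subset[OF bounded_ball]; auto)+
  have "S \<inter> ball 0 1 \<in> lmeasurable"
    by (intro lmeasurable_open open_Int assms bounded_subset[OF bounded_ball]) auto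
  then have "measure lebesgue (S \<inter> ball 0 1) = measure lebesgue (?P \<union> ?N)"
    by (rule measure_eq_off_negligible[OF _ negligible_orthogonal[OF assms(2)]]) auto
  also have "\<dots> = measure lebesgue ?P + measure lebesgue ?N"
    by (rule measure_disjoint_Un) (use meas in auto)
  finally show ?thesis unfolding ball_vol_def .
qed

lemma ball_vol_uminus:
  assumes "open S" shows "ball_vol (uminus ` S) = ball_vol S"
proof -
  have m: "S \<inter> ball 0 1 \<in> lmeasurable"
    by (intro lmeasurable_open open_Int assms bounded_subset[OF bounded_ball]) auto
  have "uminus ` S \<inter> ball 0 1 = uminus ` (S \<inter> ball 0 1)" by auto
  then show ?thesis unfolding ball_vol_def
    using measure_orthogonal_image[OF _ m, of uminus] 
    by (simp add: orthogonal_transformation linear_uminus)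
qed

text \<open>Girard's argument in terms of normals. Each pairwise wedge is the triple cone plus its
  neighbour across the third plane. The neighbour across \<open>n1\<close> is antipodal to the cone
  with signs \<open>+ - -\<close>; after this exchange the triple cone and the three neighbours fill
  the half-space of \<open>n1\<close>.\<close>

lemma three_halfspaces:
  fixes n1 n2 n3 :: "real^3"
  assumes "n1 \<noteq> 0" "n2 \<noteq> 0" "n3 \<noteq> 0"
  shows "ball_vol {x. n2 \<bullet> x > 0 \<and> n3 \<bullet> x > 0} + ball_vol {x. n3 \<bullet> x > 0 \<and> n1 \<bullet> x > 0}
     + ball_vol {x. n1 \<bullet> x > 0 \<and> n2 \<bullet> x > 0}
     = 2 * ball_vol {x. n1 \<bullet> x > 0 \<and> n2 \<bullet> x > 0 \<and> n3 \<bullet> x > 0} + 2 / 3 * pi"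
proof -
  define T where "T u v w = {x. u \<bullet> x > 0 \<and> v \<bullet> x > 0 \<and> w \<bullet> x > 0}" for u v w :: "real^3"
  have eq: "{x. n2 \<bullet> x > 0 \<and> n3 \<bullet> x > 0} \<inter> {x. n1 \<bullet> x > 0} = T n1 n2 n3"
     "{x. n2 \<bullet> x > 0 \<and> n3 \<bullet> x > 0} \<inter> {x. (-n1) \<bullet> x > 0} = T (-n1) n2 n3"
     "{x. n3 \<bullet> x > 0 \<and> n1 \<bullet> x > 0} \<inter> {x. n2 \<bullet> x > 0} = T n1 n2 n3"
     "{x. n3 \<bullet> x > 0 \<and> n1 \<bullet> x > 0} \<inter> {x. (-n2) \<bullet> x > 0} = T n1 (-n2) n3"
     "{x. n1 \<bullet> x > 0 \<and> n2 \<bullet> x > 0} \<inter> {x. n3 \<bullet> x > 0} = T n1 n2 n3"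
     "{x. n1 \<bullet> x > 0 \<and> n2 \<bullet> x > 0} \<inter> {x. (-n3) \<bullet> x > 0} = T n1 n2 (-n3)"
     "{x. n1 \<bullet> x > 0} \<inter> {x. n2 \<bullet> x > 0} = {x. n1 \<bullet> x > 0 \<and> n2 \<bullet> x > 0}"
     "{x. n1 \<bullet> x > 0} \<inter> {x. (-n2) \<bullet> x > 0} = {x. n1 \<bullet> x > 0 \<and> (-n2) \<bullet> x > 0}"
     "{x. n1 \<bullet> x > 0 \<and> (-n2) \<bullet> x > 0} \<inter> {x. n3 \<bullet> x > 0} = T n1 (-n2) n3"
     "{x. n1 \<bullet> x > 0 \<and> (-n2) \<bullet> x > 0} \<inter> {x. (-n3) \<bullet> x > 0} = T n1 (-n2) (-n3)"
    by (auto simp: T_def)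
  have 1: "ball_vol {x. n2 \<bullet> x > 0 \<and> n3 \<bullet> x > 0} = ball_vol (T n1 n2 n3) + ball_vol (T (-n1) n2 n3)"
    using ball_vol_split[OF open_signs(2) assms(1), of n2 n3] unfolding eq .
  have 2: "ball_vol {x. n3 \<bullet> x > 0 \<and> n1 \<bullet> x > 0} = ball_vol (T n1 n2 n3) + ball_vol (T n1 (-n2) n3)"
    using ball_vol_split[OF open_signs(2) assms(2), of n3 n1] unfolding eq .
  have 3: "ball_vol {x. n1 \<bullet> x > 0 \<and> n2 \<bullet> x > 0} = ball_vol (T n1 n2 n3) + ball_vol (T n1 n2 (-n3))"
    using ball_vol_split[OF open_signs(2) assms(3), of n1 n2] unfolding eq .
  have 4: "ball_vol {x. n1 \<bullet> x > 0 \<and> (-n2) \<bullet> x > 0} = ball_vol (T n1 (-n2) n3) + ball_vol (T n1 (-n2) (-n3))"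
    using ball_vol_split[OF open_signs(2) assms(3), of n1 "-n2"] unfolding eq .
  have 5: "2 / 3 * pi = ball_vol {x. n1 \<bullet> x > 0 \<and> n2 \<bullet> x > 0} + ball_vol {x. n1 \<bullet> x > 0 \<and> (-n2) \<bullet> x > 0}"
    using ball_vol_split[OF open_halfspace_gt assms(2), of 0 n1] ball_vol_halfspace[OF assms(1)] unfolding eq by simp
  have 6: "ball_vol (T n1 (-n2) (-n3)) = ball_vol (T (-n1) n2 n3)"
  proof -
    have e: "uminus ` T (-n1) n2 n3 = T n1 (-n2) (-n3)"
    proof (intro set_eqI iffI)
      fix x assume "x \<in> T n1 (-n2) (-n3)"
      then have "- x \<in> T (-n1) n2 n3" by (simp add: T_def)
      then show "x \<in> uminus ` T (-n1) n2 n3" by (metis image_eqI minus_minus)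
    qed (auto simp: T_def)
    have "open (T (-n1) n2 n3)" unfolding T_def by (rule open_signs(1))
    from ball_vol_uminus[OF this] show ?thesis unfolding e .
  qed
  have 7: "{x. n1 \<bullet> x > 0 \<and> n2 \<bullet> x > 0 \<and> n3 \<bullet> x > 0} = T n1 n2 n3"
    by (simp add: T_def)
  show ?thesis unfolding 7 using 1 2 3 4 5 6 by linarith
qed

lemma norm_cross3_unit:
  assumes "norm a = 1" "norm b = 1"
  shows "norm (cross3 a b) = sqrt (1 - (a \<bullet> b)\<^sup>2)"
  using norm_cross[of a b] assms by (intro real_sqrt_unique[symmetric]) auto

text \<open>The spherical law of cosines. The first argument \<open>N\<close> of \<open>carg\<close>
  is the inner product of the normals of the two planes through \<open>a\<close>, one of them
  reversed to fit the lune. By the Gram determinant, \<open>N^2 + D^2\<close> is the square of the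
  product of their lengths, so the angle at \<open>a\<close> has cotangent
  \<open>N / D\<close>.\<close>

lemma ball_vol_wedge:
  assumes n: "norm a = 1" "norm b = 1" "norm c = 1" and D: "det3 a b c > 0"
  shows "ball_vol {x. det3 a x c > 0 \<and> det3 a b x > 0}
      = 2 / 3 * carg (b \<bullet> c - (c \<bullet> a) * (a \<bullet> b)) (det3 a b c)"
proof -
  let ?N = "b \<bullet> c - (c \<bullet> a) * (a \<bullet> b)"
  have q: "det3 a x c = cross3 c a \<bullet> x" and r: "det3 a b x = cross3 a b \<bullet> x" for x
    by (simp_all add: det3_expand inner3 cross_components algebra_simps)
  have nz: "cross3 c a \<noteq> 0" "cross3 a b \<noteq> 0"
    using D q[of b] r[of c] by auto
  have "{x. det3 a x c > 0 \<and> det3 a b x > 0} = {x. cross3 c a \<bullet> x > 0 \<and> (- cross3 a b) \<bullet> x < 0}"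
    by (simp add: q r)
  moreover have "ball_vol {x. cross3 c a \<bullet> x > 0 \<and> (- cross3 a b) \<bullet> x < 0} = 2 / 3 * carg ?N (det3 a b c)"
  proof (rule ball_vol_two_halfspaces)
    have g: "?N\<^sup>2 + (det3 a b c)\<^sup>2 = (1 - (c \<bullet> a)\<^sup>2) * (1 - (a \<bullet> b)\<^sup>2)"
      unfolding det3_square_gram[OF n] by algebra
    have "cross3 c a \<bullet> - cross3 a b = ?N"
      using n by (simp add: dot_cross inner_commute dot_square_norm)
    also have "?N = sqrt (?N\<^sup>2 + (det3 a b c)\<^sup>2) * cos (carg ?N (det3 a b c))"
      by (rule carg_cis(2)[OF D])
    also have "sqrt (?N\<^sup>2 + (det3 a b c)\<^sup>2) = norm (cross3 c a) * norm (- cross3 a b)"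
      unfolding g norm_minus_cancel norm_cross3_unit[OF n(3,1)] norm_cross3_unit[OF n(1,2)] by (rule real_sqrt_mult)
    finally show "cross3 c a \<bullet> - cross3 a b = norm (cross3 c a) * norm (- cross3 a b) * cos (carg ?N (det3 a b c))" .
  qed (use nz carg_bounds in \<open>auto intro: less_imp_le\<close>)
  ultimately show ?thesis by simp
qed

lemma girard:
  assumes D: "det3 a b c > 0"
  shows "ball_vol {x. det3 a x c > 0 \<and> det3 a b x > 0} + ball_vol {x. det3 a b x > 0 \<and> det3 x b c > 0}
     + ball_vol {x. det3 x b c > 0 \<and> det3 a x c > 0}
     = 2 * ball_vol {x. det3 x b c > 0 \<and> det3 a x c > 0 \<and> det3 a b x > 0} + 2 / 3 * pi"
proof -
  have p: "det3 x b c = cross3 b c \<bullet> x" and q: "det3 a x c = cross3 c a \<bullet> x" and r: "det3 a b x = cross3 a b \<bullet> x" for x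
    by (simp_all add: det3_expand inner3 cross_components algebra_simps)
  have nz: "cross3 b c \<noteq> 0" "cross3 c a \<noteq> 0" "cross3 a b \<noteq> 0"
    using D p[of a] q[of b] r[of c] by auto
  show ?thesis unfolding p q r by (rule three_halfspaces[OF nz])
qed

text \<open>The half-angle formula \<open>tan (\<Omega> / 2) = D / (1 + x + y + z)\<close> for the
  solid angle, with the quadrant handled by \<open>carg\<close>. Girard gives \<Omega> as
  \<open>A + B + C - pi\<close>, and the three angles are arguments of complex numbers whose product
  is a negative multiple of the square of \<open>1 + x + y + z + i D\<close>.\<close>

lemma solid_angle:
  assumes n: "norm a = 1" "norm b = 1" "norm c = 1" and D: "det3 a b c > 0"
  shows "3 * ball_vol {x. det3 x b c > 0 \<and> det3 a x c > 0 \<and> det3 a b x > 0}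
      = 2 * carg (1 + b \<bullet> c + c \<bullet> a + a \<bullet> b) (det3 a b c)" (is "3 * ball_vol ?C = _")
proof -
  define D where "D = det3 a b c"
  define x y z where "x = b \<bullet> c" and "y = c \<bullet> a" and "z = a \<bullet> b"
  have D0: "D > 0" using D by (simp add: D_def)
  have D2: "D\<^sup>2 = 1 + 2*x*y*z - x\<^sup>2 - y\<^sup>2 - z\<^sup>2"
    unfolding D_def x_def y_def z_def by (rule det3_square_gram[OF n])
  define A where "A = carg (x - y*z) D"
  define B where "B = carg (y - z*x) D"
  define C where "C = carg (z - x*y) D"
  define S where "S = carg (1 + x + y + z) D"
  have wa: "ball_vol {x. det3 a x c > 0 \<and> det3 a b x > 0} = 2 / 3 * A"
    unfolding A_def x_def y_def z_def D_def by (rule ball_vol_wedge[OF n D])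
  have rot: "det3 b c a = det3 a b c" "det3 c a b = det3 a b c" "det3 b x a = det3 a b x" "det3 b c x = det3 x b c"
     "det3 c x b = det3 x b c" "det3 c a x = det3 a x c" for x
    by (simp_all add: det3_expand algebra_simps)
  have wb: "ball_vol {x. det3 a b x > 0 \<and> det3 x b c > 0} = 2 / 3 * B"
    using ball_vol_wedge[OF n(2,3,1)] D
    unfolding B_def x_def y_def z_def D_def unfolding rot(1,3,4) by simp
  have wc: "ball_vol {x. det3 x b c > 0 \<and> det3 a x c > 0} = 2 / 3 * C"
    using ball_vol_wedge[OF n(3,1,2)] D
    unfolding C_def x_def y_def z_def D_def unfolding rot(2,5,6) by simp
  have sum: "3 * ball_vol ?C = A + B + C - pi"
    using girard[OF D] unfolding wa wb wc by simp
  have ge: "3 * ball_vol ?C \<ge> 0" by (simp add: ball_vol_def)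
  have le: "3 * ball_vol ?C \<le> 2 * pi"
  proof -
    have r: "det3 a b x = cross3 a b \<bullet> x" for x
      by (simp add: det3_expand inner3 cross_components algebra_simps)
    have nz: "cross3 a b \<noteq> 0" using D r[of c] by auto
    have "ball_vol ?C \<le> ball_vol {x. cross3 a b \<bullet> x > 0}" unfolding ball_vol_def
    proof (rule measure_mono_fmeasurable)
      have "open ?C" by (auto simp: Collect_conj_eq det3_expand intro!: open_Int open_Collect_less continuous_intros)
      then show "?C \<inter> ball 0 1 \<in> sets lebesgue" by simp
    qed (auto simp: r intro!: lmeasurable_open open_Int open_halfspace_gt intro: bounded_subset[OF bounded_ball])
    then show ?thesis using ball_vol_halfspace[OF nz] by simp
  qed
  define ra where "ra = sqrt ((x - y*z)\<^sup>2 + D\<^sup>2)"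
  define rb where "rb = sqrt ((y - z*x)\<^sup>2 + D\<^sup>2)"
  define rc where "rc = sqrt ((z - x*y)\<^sup>2 + D\<^sup>2)"
  define rs where "rs = sqrt ((1 + x + y + z)\<^sup>2 + D\<^sup>2)"
  have pos: "ra > 0" "rb > 0" "rc > 0" "rs > 0"
    using D0 by (simp_all add: ra_def rb_def rc_def rs_def add_nonneg_pos)
  \<comment> \<open>The real factor in the product identity below; being positive, it leaves the
    arguments unchanged.\<close>
  define k where "k = (1 - x)*(1 - y)*(1 - z) / 2"
  have xyz: "x < 1" "y < 1" "z < 1"
  proof -
    have g: "(x - y*z)\<^sup>2 + D\<^sup>2 = (1 - y\<^sup>2) * (1 - z\<^sup>2)" "(y - z*x)\<^sup>2 + D\<^sup>2 = (1 - z\<^sup>2) * (1 - x\<^sup>2)"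
      unfolding D2 by algebra+
    have p1: "(x - y*z)\<^sup>2 + D\<^sup>2 > 0" "(y - z*x)\<^sup>2 + D\<^sup>2 > 0" using D0 by (simp_all add: add_nonneg_pos)
    have "\<bar>x\<bar> \<le> 1" "\<bar>y\<bar> \<le> 1" "\<bar>z\<bar> \<le> 1"
      using Cauchy_Schwarz_ineq2[of b c] Cauchy_Schwarz_ineq2[of c a] Cauchy_Schwarz_ineq2[of a b] n
      by (simp_all add: x_def y_def z_def)
    moreover have "x \<noteq> 1" "y \<noteq> 1" "z \<noteq> 1" using p1 unfolding g by auto
    ultimately show "x < 1" "y < 1" "z < 1" by auto
  qed
  then have k: "k > 0" by (simp add: k_def)
  have "Complex (x - y*z) D * Complex (y - z*x) D * Complex (z - x*y) D
      = - (of_real k * (Complex (1+x+y+z) D)\<^sup>2)"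
  proof -
    have c1: "(x - y*z)*(y - z*x)*(z - x*y) - D\<^sup>2 * ((x - y*z) + (y - z*x) + (z - x*y)) = - (k * ((1+x+y+z)\<^sup>2 - D\<^sup>2))"
      unfolding D2 k_def by (simp add: field_simps power2_eq_square)
    have c2: "(x - y*z)*(y - z*x) + (y - z*x)*(z - x*y) + (z - x*y)*(x - y*z) - D\<^sup>2 = - (k * (2 * (1+x+y+z)))"
      unfolding D2 k_def by (simp add: field_simps power2_eq_square)
    have c2': "D * ((x - y*z)*(y - z*x) + (y - z*x)*(z - x*y) + (z - x*y)*(x - y*z) - D\<^sup>2) = - (k * (2 * (1+x+y+z) * D))"
      unfolding c2 by simp
    show ?thesis
      using c1 c2' by (simp add: complex_eq_iff power2_eq_square algebra_simps)
  qed
  then have "of_real (ra * rb * rc) * (cis A * cis B * cis C) = - (of_real (k * rs\<^sup>2) * (cis S)\<^sup>2)"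
    unfolding carg_cis(1)[OF D0] ra_def[symmetric] rb_def[symmetric] rc_def[symmetric] rs_def[symmetric]
      A_def[symmetric] B_def[symmetric] C_def[symmetric] S_def[symmetric]
    by (simp add: power_mult_distrib algebra_simps)
  then have e: "of_real (ra * rb * rc) * cis (A + B + C) = of_real (k * rs\<^sup>2) * (cis (2*S + pi))"
  proof -
    assume *: "of_real (ra * rb * rc) * (cis A * cis B * cis C) = - (of_real (k * rs\<^sup>2) * (cis S)\<^sup>2)"
    have "cis A * cis B * cis C = cis (A + B + C)" by (simp add: cis_mult)
    moreover have "(cis S)\<^sup>2 = cis (2 * S)" by (simp add: power2_eq_square cis_mult)
    moreover have "cis (2*S + pi) = - cis (2 * S)" by (simp add: complex_eq_iff)
    ultimately show ?thesis using * by simp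
  qed
  have "norm (of_real (ra * rb * rc) * cis (A + B + C)) = norm (complex_of_real (k * rs\<^sup>2) * (cis (2*S + pi)))"
    using e by simp
  then have "ra * rb * rc = k * rs\<^sup>2"
    unfolding norm_mult norm_of_real norm_cis using pos k by simp
  then have "cis (A + B + C) = cis (2*S + pi)" using e pos k by simp
  then have "cos (A + B + C - (2*S + pi)) = 1"
  proof -
    assume "cis (A + B + C) = cis (2*S + pi)"
    then have "cos (A+B+C) = cos (2*S+pi)" "sin (A+B+C) = sin (2*S+pi)" by (simp_all add: complex_eq_iff)
    then show ?thesis using sin_cos_squared_add3[of "2*S+pi"] by (simp only: cos_diff)
  qed
  then obtain m :: int where m: "A + B + C - (2*S + pi) = of_int m * 2 * pi"
    using cos_one_2pi_int by blast
  have S: "0 < S" "S < pi" unfolding S_def by (rule carg_bounds)+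
  \<comment> \<open>Both \<open>A + B + C - pi\<close> and \<open>2 * S\<close> lie between 0 and
    \<open>2 * pi\<close>, the latter strictly, so they cannot differ by a nonzero multiple of
    \<open>2 * pi\<close>.\<close>
  have "\<bar>A + B + C - (2*S + pi)\<bar> < 2 * pi"
    using sum ge le S by linarith
  then have "\<bar>of_int m\<bar> * (2 * pi) < 1 * (2 * pi)" unfolding m by (simp add: abs_mult)
  then have "\<bar>of_int m :: real\<bar> < 1" using mult_less_cancel_right_pos[of "2*pi"] by simp
  then have "m = 0" by linarith
  then have "A + B + C - pi = 2 * S" using m by simp
  then show ?thesis using sum unfolding S_def x_def y_def z_def D_def by simp
qed

section \<open>Polytopes in general position\<close>

definition pcone :: "(real^3) set \<Rightarrow> (real^3) set" where
  "pcone F = {x. \<exists>c. (\<forall>w\<in>F. c w > 0) \<and> x = (\<Sum>w\<in>F. c w *\<^sub>R w)}"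

text \<open>The coefficient of \<open>v\<close> is unrestricted, so for a triangle this is the
  region between the two planes through the origin, \<open>v\<close> and one more vertex: the angle
  of the spherical triangle at \<open>v\<close>.\<close>

definition wedge :: "real^3 \<Rightarrow> (real^3) set \<Rightarrow> (real^3) set" where
  "wedge v F = {x. \<exists>c. (\<forall>w\<in>F-{v}. c w > 0) \<and> x = (\<Sum>w\<in>F. c w *\<^sub>R w)}"

text \<open>The first clause makes the vertices of each face a basis, the second makes every face a
  triangle.\<close>

definition generic :: "(real^3) set \<Rightarrow> bool" where
  "generic W \<longleftrightarrow>
     (\<forall>a\<in>W. \<forall>b\<in>W. \<forall>c\<in>W. a \<noteq> b \<and> b \<noteq> c \<and> a \<noteq> c \<longrightarrow> det3 a b c \<noteq> 0) \<and>
     (\<forall>a\<in>W. \<forall>b\<in>W. \<forall>c\<in>W. \<forall>d\<in>W. distinct [a,b,c,d] \<longrightarrow> det3 (b - a) (c - a) (d - a) \<noteq> 0)"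

text \<open>Facets given by the vertices \<open>u\<close> of the polar body. The level can be
  normalised to 1 because the origin will be interior; in general position the triangles are all the
  facets.\<close>

definition gfaces :: "(real^3) set \<Rightarrow> (real^3) set set" where
  "gfaces W = {F. F \<subseteq> W \<and> card F = 3 \<and> (\<exists>u. (\<forall>w\<in>F. u \<bullet> w = 1) \<and> (\<forall>w\<in>W-F. u \<bullet> w < 1))}"

definition off_planes :: "(real^3) set \<Rightarrow> real^3 \<Rightarrow> bool" where
  "off_planes W x \<longleftrightarrow> (\<forall>p\<in>W. \<forall>q\<in>W. p \<noteq> q \<longrightarrow> det3 x p q \<noteq> 0)"

text \<open>The ray through \<open>x\<close> leaves the hull at a point \<open>p\<close>, which has
  a supporting plane \<open>u = 1\<close>. In a convex combination for \<open>p\<close>,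
  complementary slackness kills the weights of all points strictly below that plane.\<close>

lemma ray_face:
  fixes W :: "(real^3) set"
  assumes fin: "finite W" and int: "0 \<in> interior (convex hull W)" and x: "x \<noteq> 0"
  shows "\<exists>u c. (\<forall>w\<in>W. u \<bullet> w \<le> 1) \<and> (\<forall>w\<in>W. c w \<ge> 0) \<and> (\<forall>w\<in>W. u \<bullet> w < 1 \<longrightarrow> c w = 0)
    \<and> x = (\<Sum>w\<in>W. c w *\<^sub>R w)"
proof -
  let ?C = "convex hull W"
  have comp: "compact ?C" by (rule finite_imp_compact_convex_hull[OF fin])
  obtain d where d: "d > 0" "0 + d *\<^sub>R x \<in> frontier ?C"
    using ray_to_frontier[OF compact_imp_bounded[OF comp] int x] by metis
  define p where "p = d *\<^sub>R x"
  have pf: "p \<in> frontier ?C" using d by (simp add: p_def)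
  have pC: "p \<in> ?C" using pf comp by (metis compact_imp_closed frontier_subset_closed subsetD)
  have "p \<notin> interior ?C" using pf by (simp add: frontier_def)
  then obtain a b where a: "a \<noteq> 0" and ab: "a \<bullet> p \<le> b" "\<And>y. y \<in> interior ?C \<Longrightarrow> a \<bullet> y \<ge> b"
    using separating_hyperplane_sets[of "{p}" "interior ?C"] int convex_interior[OF convex_convex_hull, of W]
    by auto
  have ab2: "a \<bullet> y \<ge> b" if "y \<in> ?C" for y
  proof -
    have "y \<in> closure (interior ?C)"
      using that convex_closure_interior[of ?C] int closure_subset by blast
    moreover have "closure (interior ?C) \<subseteq> {y. a \<bullet> y \<ge> b}"
      by (rule closure_minimal) (use ab(2) in \<open>auto simp: closed_halfspace_ge\<close>)
    ultimately show ?thesis by auto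
  qed
  have ap: "a \<bullet> p = b" using ab(1) ab2[OF pC] by simp
  \<comment> \<open>A small ball around the origin lies on the side
    \<open>a \<bullet> y \<ge> b\<close>, so the plane misses the origin and can be rescaled to
    level 1.\<close>
  have b0: "b < 0"
  proof -
    obtain e where e: "e > 0" "ball 0 e \<subseteq> ?C" using int mem_interior by blast
    have "- (e / (2 * norm a)) *\<^sub>R a \<in> ball 0 e" using e a by simp
    then have "a \<bullet> (- (e / (2 * norm a)) *\<^sub>R a) \<ge> b" using e ab2 by blast
    moreover have "a \<bullet> (- (e / (2 * norm a)) *\<^sub>R a) = - (e / 2) * norm a"
      using a by (simp add: dot_square_norm power2_eq_square)
    moreover have "- (e / 2) * norm a < 0" using e a by (simp add: mult_neg_pos)
    ultimately show ?thesis by linarith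
  qed
  define u where "u = (1 / b) *\<^sub>R a"
  have up: "u \<bullet> p = 1" using ap b0 by (simp add: u_def)
  have uw: "u \<bullet> w \<le> 1" if "w \<in> W" for w
    using ab2[of w] hull_subset[of W convex] that b0 by (auto simp: u_def field_simps)
  obtain c where c: "\<forall>w\<in>W. 0 \<le> c w" "sum c W = 1" "(\<Sum>w\<in>W. c w *\<^sub>R w) = p"
    using pC unfolding convex_hull_finite[OF fin] by auto
  have "(\<Sum>w\<in>W. c w * (1 - u \<bullet> w)) = 0"
    using c up by (simp add: right_diff_distrib sum_subtractf inner_sum_right flip: c(3))
  then have z: "\<forall>w\<in>W. c w * (1 - u \<bullet> w) = 0"
    by (subst (asm) sum_nonneg_eq_0_iff) (use fin c uw in auto)
  have "(\<Sum>w\<in>W. (c w / d) *\<^sub>R w) = (1 / d) *\<^sub>R (\<Sum>w\<in>W. c w *\<^sub>R w)"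
    by (simp add: scaleR_sum_right)
  also have "\<dots> = x" using c(3) d(1) by (simp add: p_def)
  finally have "x = (\<Sum>w\<in>W. (c w / d) *\<^sub>R w)" by simp
  moreover have "\<forall>w\<in>W. u \<bullet> w < 1 \<longrightarrow> c w / d = 0" using z by auto
  ultimately show ?thesis using uw c(1) d(1)
    by (intro exI[of _ u] exI[of _ "\<lambda>w. c w / d"]) auto
qed

text \<open>In the data from \<open>ray_face\<close>, the support \<open>G\<close> has at least
  three points because \<open>x\<close> is off the planes, and the contact set \<open>F\<close> has
  at most three because no four points are coplanar. As \<open>G \<subseteq> F\<close>, the two
  agree.\<close>

lemma exists_face:
  assumes fin: "finite W" and int: "0 \<in> interior (convex hull W)" and g: "generic W"
    and n: "card W \<ge> 3" and x: "off_planes W x"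
  shows "\<exists>F\<in>gfaces W. x \<in> pcone F"
proof -
  have two: "\<exists>p q. p \<in> W \<and> q \<in> W \<and> p \<noteq> q \<and> G \<subseteq> {p,q}" if G: "G \<subseteq> W" "card G \<le> 2" for G
  proof -
    obtain H where H: "G \<subseteq> H" "H \<subseteq> W" "card H = 2"
      using exists_subset_between[of G 2 W] fin n G by auto
    then show ?thesis by (metis card_2_iff insert_subset)
  qed
  have x0: "x \<noteq> 0"
    using two[of "{}"] x by (auto simp: off_planes_def det3_linear)
  obtain u c where uc: "\<forall>w\<in>W. u \<bullet> w \<le> 1" "\<forall>w\<in>W. c w \<ge> 0" "\<forall>w\<in>W. u \<bullet> w < 1 \<longrightarrow> c w = 0"
    and xs: "x = (\<Sum>w\<in>W. c w *\<^sub>R w)"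
    using ray_face[OF fin int x0] by blast
  then have u: "u \<bullet> w \<le> 1" and c: "c w \<ge> 0" "u \<bullet> w < 1 \<Longrightarrow> c w = 0" if "w \<in> W" for w
    using that by auto
  define F where "F = {w\<in>W. u \<bullet> w = 1}"
  define G where "G = {w\<in>W. c w > 0}"
  have GF: "G \<subseteq> F" using u c(2) unfolding F_def G_def by fastforce
  have FW: "F \<subseteq> W" by (auto simp: F_def)
  have finF: "finite F" using FW fin finite_subset by blast
  have G3: "card G \<ge> 3"
  proof (rule ccontr)
    assume "\<not> card G \<ge> 3"
    then obtain p q where pq: "p \<in> W" "q \<in> W" "p \<noteq> q" "G \<subseteq> {p,q}" using two[of G] by (auto simp: G_def)
    have "det3 x p q = (\<Sum>w\<in>W. c w * det3 w p q)"
      unfolding xs det3_def by (simp add: inner_sum_left)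
    also have "\<dots> = 0"
    proof (rule sum.neutral, rule ballI)
      fix w assume "w \<in> W"
      then show "c w * det3 w p q = 0"
        using pq(4) c(1)[of w] by (cases "w = p \<or> w = q") (auto simp: det3_same G_def less_le)
    qed
    finally show False using x pq by (auto simp: off_planes_def)
  qed
  have F3: "card F \<le> 3"
  proof (rule ccontr)
    assume "\<not> card F \<le> 3"
    then obtain H where "H \<subseteq> F" "card H = 4" using obtain_subset_with_card_n[of 4 F] by auto
    moreover have "finite H" using \<open>H \<subseteq> F\<close> finF finite_subset by blast
    then obtain xs where "set xs = H" "distinct xs" using finite_distinct_list by blast
    ultimately have "length xs = Suc (Suc (Suc (Suc 0)))" "set xs \<subseteq> F" "distinct xs"
      using distinct_card[of xs] by auto
    then obtain a b c d where "xs = [a,b,c,d]" "set xs \<subseteq> F" "distinct xs"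
      unfolding length_Suc_conv by auto
    then have d: "distinct [a,b,c,d]" "a \<in> F" "b \<in> F" "c \<in> F" "d \<in> F" by auto
    have "u \<noteq> 0" using d by (auto simp: F_def)
    then have "det3 (b - a) (c - a) (d - a) = 0"
      by (rule det3_eq_0_orthogonal) (use d in \<open>auto simp: F_def inner_diff_right\<close>)
    then show False using g d FW unfolding generic_def by blast
  qed
  have "G = F" using GF F3 G3 finF by (metis card_seteq order_trans)
  have card: "card F = 3" using G3 F3 \<open>G = F\<close> by simp
  have "F \<in> gfaces W" unfolding gfaces_def
    using FW card u by (auto simp: F_def less_le intro!: exI[of _ u])
  moreover have "x \<in> pcone F"
  proof -
    have "x = (\<Sum>w\<in>F. c w *\<^sub>R w)"
      unfolding xs by (rule sum.mono_neutral_right)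
        (use fin FW c(1) \<open>G = F\<close> in \<open>auto simp: G_def less_le\<close>)
    then show ?thesis using \<open>G = F\<close> unfolding pcone_def G_def by blast
  qed
  ultimately show ?thesis by blast
qed

text \<open>The functional of \<open>F'\<close> is at most 1 on \<open>W\<close>; evaluated at
  \<open>x\<close> in both representations it shows that the coefficient sum of \<open>F'\<close> is
  at most that of \<open>F\<close>. Since the coefficients on \<open>F'\<close> are positive, the
  functional of \<open>F\<close> must then equal 1 on all of \<open>F'\<close>.\<close>

lemma face_subset:
  assumes fin: "finite W" and F: "F \<in> gfaces W" "F' \<in> gfaces W" and x: "x \<in> pcone F" "x \<in> pcone F'"
  shows "F' \<subseteq> F"
proof -
  obtain u where u: "\<And>w. w \<in> F \<Longrightarrow> u \<bullet> w = 1" "\<And>w. w \<in> W - F \<Longrightarrow> u \<bullet> w < 1" and FW: "F \<subseteq> W"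
    using F(1) unfolding gfaces_def by auto
  obtain u' where u': "\<And>w. w \<in> F' \<Longrightarrow> u' \<bullet> w = 1" "\<And>w. w \<in> W - F' \<Longrightarrow> u' \<bullet> w < 1" and FW': "F' \<subseteq> W"
    using F(2) unfolding gfaces_def by auto
  have le: "u \<bullet> w \<le> 1" "u' \<bullet> w \<le> 1" if "w \<in> W" for w
    using u u' that by (metis DiffI less_imp_le order_refl)+
  obtain c where c: "\<And>w. w \<in> F \<Longrightarrow> c w > 0" "x = (\<Sum>w\<in>F. c w *\<^sub>R w)" using x(1) unfolding pcone_def by auto
  obtain c' where c': "\<And>w. w \<in> F' \<Longrightarrow> c' w > 0" "x = (\<Sum>w\<in>F'. c' w *\<^sub>R w)" using x(2) unfolding pcone_def by auto
  have finF: "finite F" "finite F'" using FW FW' fin finite_subset by blast+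
  have a: "u \<bullet> x = sum c F" unfolding c(2) using u by (simp add: inner_sum_right)
  have b: "u' \<bullet> x = sum c' F'" unfolding c'(2) using u' by (simp add: inner_sum_right)
  have a': "u' \<bullet> x \<le> sum c F" unfolding c(2) inner_sum_right inner_scaleR_right
  proof (rule sum_mono)
    fix w assume "w \<in> F"
    then show "c w * (u' \<bullet> w) \<le> c w" using c(1) le(2) FW mult_left_le[of "u' \<bullet> w" "c w"] by (simp add: less_imp_le subset_iff)
  qed
  have b': "u \<bullet> x = (\<Sum>w\<in>F'. c' w * (u \<bullet> w))" unfolding c'(2) by (simp add: inner_sum_right)
  have "(\<Sum>w\<in>F'. c' w * (1 - u \<bullet> w)) \<le> 0"
    using a a' b b' by (simp add: right_diff_distrib sum_subtractf)
  moreover have nn: "c' w * (1 - u \<bullet> w) \<ge> 0" if "w \<in> F'" for w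
    using less_imp_le[OF c'(1)[OF that]] le(1) FW' that by (auto intro!: mult_nonneg_nonneg)
  ultimately have "(\<Sum>w\<in>F'. c' w * (1 - u \<bullet> w)) = 0"
    by (meson order_antisym sum_nonneg)
  then have "\<forall>w\<in>F'. c' w * (1 - u \<bullet> w) = 0"
    by (subst (asm) sum_nonneg_eq_0_iff) (use finF nn in auto)
  then have "\<forall>w\<in>F'. u \<bullet> w = 1" using c'(1) by fastforce
  then show ?thesis using u(2) FW' by fastforce
qed

text \<open>Follow \<open>x + k v\<close> for natural \<open>k\<close>. Finitely many faces catch
  infinitely many of these points, so the cone over one face \<open>F\<close> contains them for
  arbitrarily large \<open>k\<close>, which forces \<open>v\<close> into \<open>F\<close>.
  Subtracting \<open>k\<close> from the coefficient of \<open>v\<close> returns to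
  \<open>x\<close>.\<close>

lemma wedge_exists:
  assumes fin: "finite W" and int: "0 \<in> interior (convex hull W)" and g: "generic W"
    and n: "card W \<ge> 3" and x: "off_planes W x" and v: "v \<in> W" and sph: "W \<subseteq> sphere 0 1"
  shows "\<exists>F\<in>gfaces W. v \<in> F \<and> x \<in> wedge v F"
proof -
  define T where "T = {k::nat. off_planes W (x + real k *\<^sub>R v)}"
  have "finite (- T)"
  proof -
    have "- T \<subseteq> (\<Union>(p,q)\<in>{(p,q). p \<in> W \<and> q \<in> W \<and> p \<noteq> q}. {k. det3 x p q + real k * det3 v p q = 0})"
      by (auto simp: T_def off_planes_def det3_linear)
    moreover have "finite {k::nat. det3 x p q + real k * det3 v p q = 0}"
      if "p \<in> W" "q \<in> W" "p \<noteq> q" for p q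
    proof -
      \<comment> \<open>An affine function of \<open>k\<close> that is nonzero at
        \<open>k = 0\<close> has at most one root.\<close>
      have "{k::nat. det3 x p q + real k * det3 v p q = 0} \<subseteq> {nat \<lfloor>- det3 x p q / det3 v p q\<rfloor>}"
      proof clarsimp
        fix k :: nat assume k: "det3 x p q + real k * det3 v p q = 0"
        have "det3 x p q \<noteq> 0" using x that by (auto simp: off_planes_def)
        then have "det3 v p q \<noteq> 0" using k by auto
        then have "- det3 x p q / det3 v p q = real k" using k by (simp add: field_simps)
        then have "real k = - (det3 x p q / det3 v p q)" by simp
        then show "k = nat \<lfloor>- (det3 x p q / det3 v p q)\<rfloor>" by (metis floor_of_nat nat_int)
      qed
      then show ?thesis using finite_subset by blast
    qed
    moreover have "finite {(p,q). p \<in> W \<and> q \<in> W \<and> p \<noteq> q}"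
      by (rule finite_subset[of _ "W \<times> W"]) (use fin in auto)
    ultimately show ?thesis by (elim finite_subset) (auto intro!: finite_UN_I)
  qed
  then have infT: "infinite T" by (metis finite_Un Compl_partition infinite_UNIV_nat)
  have "\<forall>k\<in>T. \<exists>F. F \<in> gfaces W \<and> x + real k *\<^sub>R v \<in> pcone F"
    using exists_face[OF fin int g n] unfolding T_def by blast
  then obtain f where f: "\<And>k. k \<in> T \<Longrightarrow> f k \<in> gfaces W" "\<And>k. k \<in> T \<Longrightarrow> x + real k *\<^sub>R v \<in> pcone (f k)"
    by metis
  have "finite (gfaces W)" by (rule finite_subset[of _ "Pow W"]) (use fin in \<open>auto simp: gfaces_def\<close>)
  then have "finite (f ` T)" using f(1) by (meson finite_subset image_subsetI)
  from pigeonhole_infinite[OF infT this] obtain k0 where k0: "k0 \<in> T" and inf: "infinite {k\<in>T. f k = f k0}"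
    by auto
  define F where "F = f k0"
  have FG: "F \<in> gfaces W" using f(1) k0 by (simp add: F_def)
  obtain u where u: "\<And>w. w \<in> F \<Longrightarrow> u \<bullet> w = 1" "\<And>w. w \<in> W - F \<Longrightarrow> u \<bullet> w < 1" and FW: "F \<subseteq> W"
    using FG unfolding gfaces_def by auto
  \<comment> \<open>For points of the unit sphere the coefficient sum is at least the norm, roughly
    \<open>k\<close>, while the functional \<open>u\<close> evaluates it to about
    \<open>k (u \<bullet> v)\<close>; if \<open>u \<bullet> v < 1\<close>, this limits
    \<open>k\<close>.\<close>
  have bound: "real k * (1 - u \<bullet> v) \<le> norm x + \<bar>u \<bullet> x\<bar>" if k: "k \<in> T" "f k = F" for k
  proof -
    obtain c where c: "\<And>w. w \<in> F \<Longrightarrow> c w > 0" "x + real k *\<^sub>R v = (\<Sum>w\<in>F. c w *\<^sub>R w)"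
      using f(2)[OF k(1)] k(2) unfolding pcone_def by auto
    have "u \<bullet> (x + real k *\<^sub>R v) = sum c F" unfolding c(2) using u by (simp add: inner_sum_right)
    moreover have "norm (x + real k *\<^sub>R v) \<le> sum c F"
      unfolding c(2) by (rule order_trans[OF norm_sum]) (use c(1) FW sph in \<open>force intro!: sum_mono\<close>)
    moreover have "norm (real k *\<^sub>R v) \<le> norm (x + real k *\<^sub>R v) + norm x"
      by (metis add_diff_cancel_left' norm_triangle_ineq4)
    moreover have "norm v = 1" using v sph by auto
    ultimately show ?thesis by (simp add: inner_add_right algebra_simps)
  qed
  have vF: "v \<in> F"
  proof (rule ccontr)
    assume "v \<notin> F"
    then have p: "1 - u \<bullet> v > 0" using u(2) v by auto
    have "{k\<in>T. f k = f k0} \<subseteq> {k. k \<le> nat \<lfloor>(norm x + \<bar>u \<bullet> x\<bar>) / (1 - u \<bullet> v)\<rfloor>}"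
    proof clarsimp
      fix k assume "k \<in> T" "f k = f k0"
      then have "real k \<le> (norm x + \<bar>u \<bullet> x\<bar>) / (1 - u \<bullet> v)" using bound[of k] p by (simp add: F_def field_simps)
      then show "k \<le> nat \<lfloor>(norm x + \<bar>u \<bullet> x\<bar>) / (1 - u \<bullet> v)\<rfloor>" by linarith
    qed
    then show False using inf finite_subset by blast
  qed
  obtain c where c: "\<And>w. w \<in> F \<Longrightarrow> c w > 0" "x + real k0 *\<^sub>R v = (\<Sum>w\<in>F. c w *\<^sub>R w)"
    using f(2)[OF k0] unfolding pcone_def F_def by auto
  have finF: "finite F" using FW fin finite_subset by blast
  have "x = (\<Sum>w\<in>F. (c(v := c v - real k0)) w *\<^sub>R w)"
  proof -
    have "(\<Sum>w\<in>F. (c(v := c v - real k0)) w *\<^sub>R w) = (c v - real k0) *\<^sub>R v + (\<Sum>w\<in>F-{v}. c w *\<^sub>R w)"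
      using finF vF by (subst sum.remove[of _ v]) auto
    also have "\<dots> = (\<Sum>w\<in>F. c w *\<^sub>R w) - real k0 *\<^sub>R v"
      using finF vF by (subst (2) sum.remove[of _ v]) (auto simp: algebra_simps)
    finally show ?thesis using c(2) by (metis add_diff_cancel_right')
  qed
  then have "x \<in> wedge v F" using c(1) unfolding wedge_def
    by (intro CollectI exI[of _ "c(v := c v - real k0)"]) auto
  then show ?thesis using FG vF by blast
qed

lemma wedge_shift:
  assumes "finite F" "v \<in> F" "x \<in> wedge v F"
  obtains t0 where "\<And>t. t \<ge> t0 \<Longrightarrow> x + t *\<^sub>R v \<in> pcone F"
proof -
  obtain c where c: "\<And>w. w \<in> F - {v} \<Longrightarrow> c w > 0" "x = (\<Sum>w\<in>F. c w *\<^sub>R w)"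
    using assms(3) unfolding wedge_def by auto
  show thesis
  proof (rule that[of "1 - c v"])
    fix t assume t: "t \<ge> 1 - c v"
    have "(\<Sum>w\<in>F. (c(v := c v + t)) w *\<^sub>R w) = (c v + t) *\<^sub>R v + (\<Sum>w\<in>F-{v}. c w *\<^sub>R w)"
      using assms by (subst sum.remove[of _ v]) auto
    also have "\<dots> = (\<Sum>w\<in>F. c w *\<^sub>R w) + t *\<^sub>R v"
      using assms by (subst (2) sum.remove[of _ v]) (auto simp: algebra_simps)
    finally have "x + t *\<^sub>R v = (\<Sum>w\<in>F. (c(v := c v + t)) w *\<^sub>R w)" using c(2) by simp
    then show "x + t *\<^sub>R v \<in> pcone F" unfolding pcone_def
      using c(1) t by (intro CollectI exI[of _ "c(v := c v + t)"]) auto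
  qed
qed

text \<open>Moving far along \<open>v\<close> pushes a point of both wedges into both face cones,
  which meet only if the faces agree.\<close>

lemma wedge_unique:
  assumes fin: "finite W" and F: "F \<in> gfaces W" "F' \<in> gfaces W" and v: "v \<in> F" "v \<in> F'"
    and x: "x \<in> wedge v F" "x \<in> wedge v F'"
  shows "F = F'"
proof -
  have finF: "finite F" "finite F'" using F fin unfolding gfaces_def by (auto intro: finite_subset)
  obtain s where s: "\<And>t. t \<ge> s \<Longrightarrow> x + t *\<^sub>R v \<in> pcone F" using wedge_shift[OF finF(1) v(1) x(1)] by blast
  obtain s' where s': "\<And>t. t \<ge> s' \<Longrightarrow> x + t *\<^sub>R v \<in> pcone F'" using wedge_shift[OF finF(2) v(2) x(2)] by blast
  have "x + max s s' *\<^sub>R v \<in> pcone F" "x + max s s' *\<^sub>R v \<in> pcone F'" using s s' by auto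
  then show ?thesis using face_subset[OF fin F] face_subset[OF fin F(2,1)] by blast
qed

lemma finite_gfaces: "finite W \<Longrightarrow> finite (gfaces W)"
  by (rule finite_subset[of _ "Pow W"]) (auto simp: gfaces_def)

lemma sum3:
  assumes "a \<noteq> b" "b \<noteq> c" "a \<noteq> c"
  shows "(\<Sum>w\<in>{a,b,c}. f w) = f a + (f b + (f c :: 'b::comm_monoid_add))"
  using assms by simp

lemma pcone_wedge_eq:
  assumes D: "det3 a b c > 0"
  shows "pcone {a,b,c} = {x. det3 x b c > 0 \<and> det3 a x c > 0 \<and> det3 a b x > 0}"
    and "wedge a {a,b,c} = {x. det3 a x c > 0 \<and> det3 a b x > 0}"
proof -
  have ne: "a \<noteq> b" "b \<noteq> c" "a \<noteq> c" using D by (auto simp: det3_same)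
  note s3 = sum3[OF ne]
  have dif: "{a,b,c} - {a} = {b,c}" using ne by auto
  define k where "k x = (\<lambda>w. if w = a then det3 x b c / det3 a b c else if w = b then det3 a x c / det3 a b c
       else det3 a b x / det3 a b c)" for x
  have k: "k x a = det3 x b c / det3 a b c" "k x b = det3 a x c / det3 a b c" "k x c = det3 a b x / det3 a b c" for x
    using ne by (auto simp: k_def)
  have rep: "x = (\<Sum>w\<in>{a,b,c}. k x w *\<^sub>R w)" for x
  proof -
    have "(\<Sum>w\<in>{a,b,c}. k x w *\<^sub>R w) = (1 / det3 a b c) *\<^sub>R (det3 a b c *\<^sub>R x)"
      unfolding s3 k cramer3[of a b c x] by (simp add: algebra_simps)
    then show ?thesis using D by simp
  qed
  have dets: "det3 (\<Sum>w\<in>{a,b,c}. u w *\<^sub>R w) b c = u a * det3 a b c"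
     "det3 a (\<Sum>w\<in>{a,b,c}. u w *\<^sub>R w) c = u b * det3 a b c"
     "det3 a b (\<Sum>w\<in>{a,b,c}. u w *\<^sub>R w) = u c * det3 a b c" for u
    unfolding s3 by (simp_all add: det3_linear det3_same)
  have pos: "u * det3 a b c > 0 \<longleftrightarrow> u > 0" "u / det3 a b c > 0 \<longleftrightarrow> u > 0" for u
    using D by (simp_all add: zero_less_mult_iff zero_less_divide_iff)
  show "pcone {a,b,c} = {x. det3 x b c > 0 \<and> det3 a x c > 0 \<and> det3 a b x > 0}" (is "_ = ?R")
  proof (intro set_eqI iffI)
    fix x assume "x \<in> pcone {a,b,c}"
    then obtain u where u: "\<forall>w\<in>{a,b,c}. u w > 0" "x = (\<Sum>w\<in>{a,b,c}. u w *\<^sub>R w)" unfolding pcone_def by blast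
    show "x \<in> ?R" unfolding u(2) mem_Collect_eq dets pos using u(1) by simp
  next
    fix x assume "x \<in> ?R"
    then have "\<forall>w\<in>{a,b,c}. k x w > 0" by (simp add: k pos)
    then show "x \<in> pcone {a,b,c}" unfolding pcone_def using rep[of x] by blast
  qed
  show "wedge a {a,b,c} = {x. det3 a x c > 0 \<and> det3 a b x > 0}" (is "_ = ?R")
  proof (intro set_eqI iffI)
    fix x assume "x \<in> wedge a {a,b,c}"
    then obtain u where u: "\<forall>w\<in>{b,c}. u w > 0" "x = (\<Sum>w\<in>{a,b,c}. u w *\<^sub>R w)" unfolding wedge_def dif by blast
    show "x \<in> ?R" unfolding u(2) mem_Collect_eq dets pos using u(1) by simp
  next
    fix x assume "x \<in> ?R"
    then have "\<forall>w\<in>{b,c}. k x w > 0" by (simp add: k pos)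
    then show "x \<in> wedge a {a,b,c}" unfolding wedge_def dif using rep[of x] by blast
  qed
qed

lemma wedge_eq:
  assumes D: "det3 a b c > 0"
  shows "wedge b {a,b,c} = {x. det3 a b x > 0 \<and> det3 x b c > 0}"
    and "wedge c {a,b,c} = {x. det3 x b c > 0 \<and> det3 a x c > 0}"
proof -
  have r: "det3 b x a = det3 a b x" "det3 b c x = det3 x b c" "det3 c x b = det3 x b c" "det3 c a x = det3 a x c" for x
    by (simp_all add: det3_expand algebra_simps)
  have s: "{a,b,c} = {b,c,a}" "{a,b,c} = {c,a,b}" by auto
  have "det3 b c a > 0" "det3 c a b > 0" using D r(1)[of c] r(4)[of b] by simp_all
  then show "wedge b {a,b,c} = {x. det3 a b x > 0 \<and> det3 x b c > 0}"
    "wedge c {a,b,c} = {x. det3 x b c > 0 \<and> det3 a x c > 0}"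
    using pcone_wedge_eq(2)[of b c a] pcone_wedge_eq(2)[of c a b] unfolding r s[symmetric] by blast+
qed

lemma gface_oriented:
  assumes g: "generic W" and F: "F \<in> gfaces W"
  obtains a b c where "F = {a,b,c}" "a \<noteq> b" "b \<noteq> c" "a \<noteq> c" "det3 a b c > 0"
proof -
  have "card F = 3" "F \<subseteq> W" using F by (auto simp: gfaces_def)
  then obtain a b c where abc: "F = {a,b,c}" "a \<noteq> b" "b \<noteq> c" "a \<noteq> c"
    by (metis card_3_iff)
  have "det3 a b c \<noteq> 0" using g abc \<open>F \<subseteq> W\<close> unfolding generic_def by blast
  then consider "det3 a b c > 0" | "det3 b a c > 0" using det3_perm(3)[of b a c] by linarith
  then show thesis
  proof cases
    case 1 then show ?thesis using that[of a b c] abc by blast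
  next
    case 2 then show ?thesis using that[of b a c] abc by (metis insert_commute)
  qed
qed

lemma open_det3:
  "open {x. det3 x b c > 0}" "open {x. det3 a x c > 0}" "open {x. det3 a b x > 0}"
  by (auto simp: det3_expand intro!: open_Collect_less continuous_intros)

lemma open_pcone_wedge:
  assumes "generic W" "F \<in> gfaces W"
  shows "open (pcone F)" "v \<in> F \<Longrightarrow> open (wedge v F)"
proof -
  obtain a b c where F: "F = {a,b,c}" and D: "det3 a b c > 0" using gface_oriented[OF assms] by metis
  show "open (pcone F)" unfolding F pcone_wedge_eq[OF D]
    by (auto simp: Collect_conj_eq intro!: open_Int open_det3)
  show "open (wedge v F)" if "v \<in> F"
    using that unfolding F by (auto simp: pcone_wedge_eq[OF D] wedge_eq[OF D] Collect_conj_eq intro!: open_Int open_det3)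
qed

lemma gface_girard:
  assumes "generic W" "F \<in> gfaces W"
  shows "(\<Sum>v\<in>F. ball_vol (wedge v F)) = 2 * ball_vol (pcone F) + 2 / 3 * pi"
proof -
  obtain a b c where F: "F = {a,b,c}" and ne: "a \<noteq> b" "b \<noteq> c" "a \<noteq> c" and D: "det3 a b c > 0"
    using gface_oriented[OF assms] by metis
  show ?thesis unfolding F sum3[OF ne] pcone_wedge_eq[OF D] wedge_eq[OF D] using girard[OF D] by simp
qed

lemma negligible_not_off_planes:
  assumes fin: "finite W" and g: "generic W" and n: "card W \<ge> 3"
  shows "negligible {x. \<not> off_planes W x}"
proof -
  have "{x. \<not> off_planes W x} \<subseteq> (\<Union>(p,q)\<in>{(p,q). p \<in> W \<and> q \<in> W \<and> p \<noteq> q}. {x. cross3 p q \<bullet> x = 0})"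
    by (auto simp: off_planes_def det3_def inner_commute)
  moreover have "negligible {x. cross3 p q \<bullet> x = 0}" if pq: "p \<in> W" "q \<in> W" "p \<noteq> q" for p q
  proof (rule negligible_orthogonal)
    have "card {p,q} < card W" using pq n by simp
    then obtain r where "r \<in> W" "r \<notin> {p,q}" by (metis card_mono finite.emptyI finite_insert leD subsetI)
    then have "det3 r p q \<noteq> 0" using g pq unfolding generic_def by auto
    then show "cross3 p q \<noteq> 0" by (auto simp: det3_def)
  qed
  moreover have "finite {(p,q). p \<in> W \<and> q \<in> W \<and> p \<noteq> q}"
    by (rule finite_subset[of _ "W \<times> W"]) (use fin in auto)
  ultimately show ?thesis by (elim negligible_subset[rotated]) (auto intro!: negligible_Union)
qed

lemma ball_vol_partition:
  assumes fin: "finite I" and op: "\<And>i. i \<in> I \<Longrightarrow> open (S i)" and N: "negligible N"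
    and ex: "\<And>x. x \<notin> N \<Longrightarrow> \<exists>i\<in>I. x \<in> S i" and un: "\<And>i j x. i \<in> I \<Longrightarrow> j \<in> I \<Longrightarrow> x \<in> S i \<Longrightarrow> x \<in> S j \<Longrightarrow> i = j"
  shows "(\<Sum>i\<in>I. ball_vol (S i)) = 4 / 3 * pi"
proof -
  have "(\<Sum>i\<in>I. ball_vol (S i)) = measure lebesgue (\<Union>i\<in>I. S i \<inter> ball 0 1)"
    unfolding ball_vol_def
  proof (rule measure_negligible_finite_Union_image[symmetric])
    show "S i \<inter> ball 0 1 \<in> lmeasurable" if "i \<in> I" for i
      by (intro lmeasurable_open open_Int op that bounded_subset[OF bounded_ball]) auto
    have "S i \<inter> ball 0 1 \<inter> (S j \<inter> ball 0 1) = {}" if "i \<in> I" "j \<in> I" "i \<noteq> j" for i j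
      using un that by blast
    then show "pairwise (\<lambda>i j. negligible (S i \<inter> ball 0 1 \<inter> (S j \<inter> ball 0 1))) I"
      unfolding pairwise_def by simp
  qed fact
  also have "\<dots> = measure lebesgue (ball (0::real^3) 1)"
    by (rule measure_eq_off_negligible[OF lmeasurable_ball N, symmetric]) (use ex in auto)
  finally show ?thesis using ball3_volume by simp
qed

locale generic_polytope =
  fixes W :: "(real^3) set"
  assumes fin: "finite W" and int: "0 \<in> interior (convex hull W)" and g: "generic W"
    and n: "card W \<ge> 3" and sph: "W \<subseteq> sphere 0 1"
begin

lemma sum_solid: "(\<Sum>F\<in>gfaces W. ball_vol (pcone F)) = 4 / 3 * pi"
proof (rule ball_vol_partition)
  show "negligible {x. \<not> off_planes W x}" by (rule negligible_not_off_planes[OF fin g n])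
  show "\<exists>F\<in>gfaces W. x \<in> pcone F" if "x \<notin> {x. \<not> off_planes W x}" for x
    using exists_face[OF fin int g n] that by blast
  show "F = F'" if "F \<in> gfaces W" "F' \<in> gfaces W" "x \<in> pcone F" "x \<in> pcone F'" for F F' x
    using face_subset[OF fin that] face_subset[OF fin that(2,1,4,3)] by blast
qed (use finite_gfaces[OF fin] open_pcone_wedge[OF g] in auto)

lemma sum_wedge:
  assumes "v \<in> W"
  shows "(\<Sum>F\<in>{F\<in>gfaces W. v \<in> F}. ball_vol (wedge v F)) = 4 / 3 * pi"
proof (rule ball_vol_partition)
  show "negligible {x. \<not> off_planes W x}" by (rule negligible_not_off_planes[OF fin g n])
  show "\<exists>F\<in>{F\<in>gfaces W. v \<in> F}. x \<in> wedge v F" if "x \<notin> {x. \<not> off_planes W x}" for x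
    using wedge_exists[OF fin int g n _ assms sph] that by blast
  show "F = F'" if "F \<in> {F\<in>gfaces W. v \<in> F}" "F' \<in> {F\<in>gfaces W. v \<in> F}" "x \<in> wedge v F" "x \<in> wedge v F'" for F F' x
    using wedge_unique[OF fin] that by blast
qed (use finite_gfaces[OF fin] open_pcone_wedge[OF g] in auto)

text \<open>Double counting of the wedges takes the place of Euler's formula: summed by vertices
  they fill the ball once per vertex; summed by faces they give, by Girard, twice the whole ball
  plus half a ball per face.\<close>

lemma card_gfaces: "real (card (gfaces W)) = 2 * real (card W) - 4"
proof -
  have "real (card W) * (4 / 3 * pi) = (\<Sum>v\<in>W. \<Sum>F\<in>{F\<in>gfaces W. v \<in> F}. ball_vol (wedge v F))"
    using sum.cong[OF refl sum_wedge, of W] by simp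
  also have "\<dots> = (\<Sum>F\<in>gfaces W. \<Sum>v\<in>{v\<in>W. v \<in> F}. ball_vol (wedge v F))"
    by (rule sum.swap_restrict[OF fin finite_gfaces[OF fin]])
  also have "\<dots> = (\<Sum>F\<in>gfaces W. 2 * ball_vol (pcone F) + 2 / 3 * pi)"
  proof (rule sum.cong)
    fix F assume F: "F \<in> gfaces W"
    then have "{v\<in>W. v \<in> F} = F" by (auto simp: gfaces_def)
    then show "(\<Sum>v\<in>{v\<in>W. v \<in> F}. ball_vol (wedge v F)) = 2 * ball_vol (pcone F) + 2 / 3 * pi"
      using gface_girard[OF g F] by simp
  qed simp
  also have "\<dots> = 2 * (4 / 3 * pi) + real (card (gfaces W)) * (2 / 3 * pi)"
    by (simp add: sum.distrib sum_solid flip: sum_distrib_left)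
  finally have "(real (card W) * 2) * (2 / 3 * pi) = (4 + real (card (gfaces W))) * (2 / 3 * pi)"
    by (simp add: algebra_simps)
  then show ?thesis unfolding mult_cancel_right by simp
qed

text \<open>The cones over the faces cover the hull up to a null set. A point of the hull in the
  cone over \<open>F\<close> has coefficient sum \<open>u \<bullet> x \<le> 1\<close>, and the
  remaining weight goes to the origin.\<close>

lemma volume_le: "measure lebesgue (convex hull W) \<le> (\<Sum>F\<in>gfaces W. measure lebesgue (convex hull (insert 0 F)))"
proof -
  let ?N = "{x. \<not> off_planes W x}"
  have N: "negligible ?N" by (rule negligible_not_off_planes[OF fin g n])
  have finF: "finite F" if "F \<in> gfaces W" for F using that fin by (auto simp: gfaces_def intro: finite_subset)
  have m: "convex hull (insert 0 F) \<in> lmeasurable" if "F \<in> gfaces W" for F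
    by (intro lmeasurable_compact finite_imp_compact_convex_hull) (use finF that in auto)
  have mU: "(\<Union>F\<in>gfaces W. convex hull (insert 0 F)) \<in> lmeasurable"
    by (intro fmeasurable.finite_UN finite_gfaces fin m)
  have sub: "convex hull W \<subseteq> (\<Union>F\<in>gfaces W. convex hull (insert 0 F)) \<union> ?N"
  proof
    fix x assume x: "x \<in> convex hull W"
    show "x \<in> (\<Union>F\<in>gfaces W. convex hull (insert 0 F)) \<union> ?N"
    proof (cases "off_planes W x")
      case True
      then obtain F where F: "F \<in> gfaces W" "x \<in> pcone F" using exists_face[OF fin int g n] by blast
      obtain u where u: "\<And>w. w \<in> F \<Longrightarrow> u \<bullet> w = 1" "\<And>w. w \<in> W - F \<Longrightarrow> u \<bullet> w < 1" and FW: "F \<subseteq> W"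
        using F(1) unfolding gfaces_def by auto
      have "W \<subseteq> {y. u \<bullet> y \<le> 1}" using u by (metis (mono_tags) DiffI less_imp_le mem_Collect_eq order_refl subsetI)
      then have "convex hull W \<subseteq> {y. u \<bullet> y \<le> 1}" by (rule hull_minimal) (rule convex_halfspace_le)
      then have ux: "u \<bullet> x \<le> 1" using x by auto
      obtain c where c: "\<And>w. w \<in> F \<Longrightarrow> c w > 0" "x = (\<Sum>w\<in>F. c w *\<^sub>R w)" using F(2) unfolding pcone_def by auto
      have sc: "sum c F \<le> 1" using ux unfolding c(2) using u by (simp add: inner_sum_right)
      \<comment> \<open>Since no point of \<open>F\<close> is the origin, a new weight at the origin
        leaves the other weights unchanged.\<close>
      have nz: "0 \<notin> F" using FW sph by auto
      have cong1: "(\<Sum>w\<in>F. (if w = 0 then r else c w) *\<^sub>R w) = (\<Sum>w\<in>F. c w *\<^sub>R w)"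
        and cong2: "(\<Sum>w\<in>F. if w = 0 then r else c w) = sum c F" for r
        using nz by (auto intro!: sum.cong)
      have "x = (\<Sum>w\<in>insert 0 F. (c(0 := 1 - sum c F)) w *\<^sub>R w)"
        using finF[OF F(1)] nz c(2) by (simp add: sum.insert cong1)
      moreover have "sum (c(0 := 1 - sum c F)) (insert 0 F) = 1"
        using finF[OF F(1)] nz by (simp add: sum.insert cong2)
      moreover have "\<forall>w\<in>insert 0 F. (c(0 := 1 - sum c F)) w \<ge> 0" using c(1) sc by (auto intro: less_imp_le)
      ultimately have "\<exists>k. (\<forall>w\<in>insert 0 F. 0 \<le> k w) \<and> sum k (insert 0 F) = 1 \<and> (\<Sum>w\<in>insert 0 F. k w *\<^sub>R w) = x"
        by (intro exI[of _ "c(0 := 1 - sum c F)"] conjI) (assumption | erule sym)+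
      then have "x \<in> convex hull (insert 0 F)"
        unfolding convex_hull_finite[OF finite.insertI[OF finF[OF F(1)]]] by blast
      then show ?thesis using F(1) by blast
    qed simp
  qed
  have "measure lebesgue (convex hull W) \<le> measure lebesgue ((\<Union>F\<in>gfaces W. convex hull (insert 0 F)) \<union> ?N)"
    by (rule measure_mono_fmeasurable[OF sub])
      (use mU negligible_imp_measurable[OF N] finite_imp_compact_convex_hull[OF fin] in \<open>auto simp: fmeasurableD lmeasurable_compact\<close>)
  also have "\<dots> = measure lebesgue (\<Union>F\<in>gfaces W. convex hull (insert 0 F))"
    by (rule measure_eq_off_negligible[OF mU N, symmetric]) auto
  also have "\<dots> \<le> (\<Sum>F\<in>gfaces W. measure lebesgue (convex hull (insert 0 F)))"
    by (rule measure_UNION_le) (use finite_gfaces[OF fin] m in \<open>auto simp: fmeasurableD\<close>)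
  finally show ?thesis .
qed

end

section \<open>Volume against solid angle\<close>

text \<open>Equilateral triangles whose side has cosine \<open>t\<close> are parametrised by
  \<open>s\<close> with \<open>s^2 = 1 + 2 t\<close>. The cone has volume
  \<open>s (3 - s^2) / 12\<close> and solid angle \<open>2 (pi - 3 arctan s)\<close>;
  \<open>slope\<close> is the quotient of the derivatives of these two functions of
  \<open>s\<close>.\<close>

definition slope :: "real \<Rightarrow> real" where "slope s = (s ^ 4 - 1) / 24"

text \<open>The intercept of the tangent line at parameter \<open>s\<close> to the graph of volume
  against solid angle.\<close>

definition offset :: "real \<Rightarrow> real" where
  "offset s = s * (3 - s\<^sup>2) / 12 - 2 * slope s * (pi - 3 * arctan s)"

lemma carg_antimono: "D > 0 \<Longrightarrow> N \<le> N' \<Longrightarrow> carg N' D \<le> carg N D"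
  by (simp add: carg_def arctan_le_iff divide_right_mono)

lemma arctan_sqrt3: "arctan (sqrt 3) = pi / 3"
proof (rule arctan_unique)
  show "- (pi / 2) < pi / 3" "pi / 3 < pi / 2" using pi_gt_zero by linarith+
qed (rule tan_60)

text \<open>The arguments of \<open>carg\<close> are \<open>N\<close> and \<open>D\<close> of an
  equilateral triangle. By the triple angle formulas \<open>N / D\<close> is minus the cotangent of
  \<open>3 arctan s\<close>, and the range of \<open>s\<close> keeps the angle on the principal
  branch.\<close>

lemma carg_equilateral:
  assumes s: "1 \<le> s" "s < sqrt 3"
  shows "carg ((3 * s\<^sup>2 - 1) / 2) (s * (3 - s\<^sup>2) / 2) = pi - 3 * arctan s"
proof -
  define t where "t = arctan s"
  define c where "c = cos t"
  have tan: "tan t = s" by (simp add: t_def tan_arctan)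
  have c0: "c \<noteq> 0" by (simp add: c_def t_def)
  have sn: "sin t = s * c" using tan c0 by (simp add: tan_def c_def field_simps)
  have one: "c\<^sup>2 * (1 + s\<^sup>2) = 1"
    using sin_cos_squared_add[of t] sn by (simp add: c_def power_mult_distrib algebra_simps)
  have s2: "s\<^sup>2 < 3" using power_strict_mono[of s "sqrt 3" 2] s by simp
  have t1: "pi / 4 \<le> t" unfolding t_def using arctan_le_iff[of 1 s] s by (simp add: arctan_one)
  have t2: "t < pi / 3"
    unfolding t_def using arctan_less_iff[of s "sqrt 3"] s by (simp add: arctan_sqrt3)
  have three: "3 * t = t + (t + t)" by simp
  have c3: "cos (3 * t) = c ^ 3 * (1 - 3 * s\<^sup>2)"
    unfolding three cos_add sin_add sn c_def[symmetric] by algebra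
  have s3: "sin (3 * t) = c ^ 3 * (s * (3 - s\<^sup>2))"
    unfolding three cos_add sin_add sn c_def[symmetric] by algebra
  have E: "s * (3 - s\<^sup>2) > 0" using s s2 by auto
  have "arctan (((3 * s\<^sup>2 - 1) / 2) / (s * (3 - s\<^sup>2) / 2)) = 3 * t - pi / 2"
  proof (rule arctan_unique)
    show "- (pi / 2) < 3 * t - pi / 2" "3 * t - pi / 2 < pi / 2" using t1 t2 pi_gt_zero by linarith+
    show "tan (3 * t - pi / 2) = (3 * s\<^sup>2 - 1) / 2 / (s * (3 - s\<^sup>2) / 2)"
    proof -
      have r: "- (c ^ 3 * P) / (c ^ 3 * Q) = (- P) / 2 / (Q / 2)" if "Q \<noteq> 0" for P Q
        using c0 that by (simp add: field_simps)
      have "tan (3 * t - pi / 2) = - (c ^ 3 * (1 - 3 * s\<^sup>2)) / (c ^ 3 * (s * (3 - s\<^sup>2)))"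
        by (simp add: tan_def sin_diff cos_diff c3 s3)
      also have "\<dots> = (- (1 - 3 * s\<^sup>2)) / 2 / (s * (3 - s\<^sup>2) / 2)" by (rule r) (use E in auto)
      finally show ?thesis by simp
    qed
  qed
  then show ?thesis by (simp add: carg_def t_def)
qed

text \<open>As a function of \<open>s\<close> the left side has derivative
  \<open>(s0^4 - s^4) / (4 (1 + s^2))\<close>, which passes from positive to negative at
  \<open>s0\<close>. This is the tangent line inequality, obtained without second
  derivatives.\<close>

lemma offset_max:
  assumes s0: "1 \<le> s0" and s: "1 \<le> s"
  shows "s * (3 - s\<^sup>2) / 12 - 2 * slope s0 * (pi - 3 * arctan s) \<le> offset s0"
proof -
  define f where "f s = s * (3 - s\<^sup>2) / 12 - 2 * slope s0 * (pi - 3 * arctan s)" for s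
  define f' where "f' s = (s0 ^ 4 - s ^ 4) / (4 * (1 + s\<^sup>2))" for s :: real
  have der: "(f has_real_derivative f' s) (at s)" for s
  proof -
    have p: "1 + s\<^sup>2 \<noteq> 0" using sum_power2_eq_zero_iff[of 1 s] by auto
    have e: "(3 - 3 * s\<^sup>2) / 12 + 6 * slope s0 / (1 + s\<^sup>2) = f' s"
      unfolding f'_def slope_def using p by (simp add: divide_simps) algebra
    have "(f has_real_derivative ((3 - 3 * s\<^sup>2) / 12 + 6 * slope s0 / (1 + s\<^sup>2))) (at s)"
      unfolding f_def using p by (auto intro!: derivative_eq_intros simp: field_simps power2_eq_square)
    then show ?thesis using e by simp
  qed
  have "f s \<le> f s0"
  proof (cases "s \<le> s0")
    case True
    show ?thesis
    proof (rule DERIV_nonneg_imp_nondecreasing[OF True])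
      fix x assume "s \<le> x" "x \<le> s0"
      then have "x ^ 4 \<le> s0 ^ 4" using s by (intro power_mono) auto
      then show "\<exists>y. (f has_real_derivative y) (at x) \<and> 0 \<le> y"
        using der[of x] by (intro exI[of _ "f' x"]) (auto simp: f'_def intro!: divide_nonneg_nonneg add_nonneg_nonneg)
    qed
  next
    case False
    then have "s0 \<le> s" by simp
    then show ?thesis
    proof (rule DERIV_nonpos_imp_nonincreasing)
      fix x assume "s0 \<le> x" "x \<le> s"
      then have "s0 ^ 4 \<le> x ^ 4" using s0 by (intro power_mono) auto
      then show "\<exists>y. (f has_real_derivative y) (at x) \<and> y \<le> 0"
        using der[of x] by (intro exI[of _ "f' x"]) (auto simp: f'_def intro!: divide_nonpos_nonneg add_nonneg_nonneg)
    qed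
  qed
  then show ?thesis by (simp add: f_def offset_def)
qed

text \<open>The tangent line lies above the degenerate triangle \<open>s = sqrt 3\<close>, whose
  volume and solid angle are 0.\<close>

lemma offset_nonneg: assumes "1 \<le> s0" shows "offset s0 \<ge> 0"
  using offset_max[OF assms, of "sqrt 3"] by (simp add: arctan_sqrt3)

text \<open>In the deviations \<open>u\<close>, \<open>v\<close>, \<open>w\<close> from the mean
  \<open>t\<close> the right side minus the left is
  \<open>(1 + t) (u^2 + v^2 + w^2) - 2 u v w\<close>. Two of three reals have a nonnegative product;
  if these are \<open>v\<close> and \<open>w\<close>, then \<open>v w \<le> u^2 / 4\<close>, and
  \<open>u \<le> 1 - t\<close> bounds the cubic term by the quadratic one.\<close>

lemma gram_le_equilateral:
  fixes x y z :: real
  assumes b: "\<bar>x\<bar> \<le> 1" "\<bar>y\<bar> \<le> 1" "\<bar>z\<bar> \<le> 1" and t: "3 * t = x + y + z" and t2: "- 1 / 2 \<le> t"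
  shows "1 + 2*x*y*z - x\<^sup>2 - y\<^sup>2 - z\<^sup>2 \<le> (1 + 2*t) * (1 - t)\<^sup>2"
proof -
  have key: "(1 + t) * (u\<^sup>2 + v\<^sup>2 + w\<^sup>2) - 2 * u * v * w \<ge> 0"
    if uvw: "u + v + w = 0" "v * w \<ge> 0" "t + u \<le> 1" for u v w
  proof -
    have u: "u = - (v + w)" using uvw by simp
    have vw: "v * w \<le> u\<^sup>2 / 4"
      unfolding u using zero_le_power2[of "v - w"] by (simp add: algebra_simps power2_eq_square)
    have S: "u\<^sup>2 + v\<^sup>2 + w\<^sup>2 \<ge> 3 / 2 * u\<^sup>2"
      unfolding u using zero_le_power2[of "v - w"] by (simp add: power2_eq_square algebra_simps)
    have a: "(1 + t) * (u\<^sup>2 + v\<^sup>2 + w\<^sup>2) \<ge> (1 + t) * (3 / 2 * u\<^sup>2)"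
      by (rule mult_left_mono[OF S]) (use t2 in simp)
    have b: "2 * u * v * w \<le> (1 - t) / 2 * u\<^sup>2"
    proof (cases "u \<ge> 0")
      case True
      have "2 * u * (v * w) \<le> 2 * (1 - t) * (u\<^sup>2 / 4)"
        by (rule mult_mono) (use True uvw vw in auto)
      then show ?thesis by (simp add: algebra_simps)
    next
      case False
      then have "2 * u * (v * w) \<le> 0" using uvw mult_nonpos_nonneg[of "2 * u" "v * w"] by simp
      moreover have "(1 - t) / 2 * u\<^sup>2 \<ge> 0"
      proof -
        have "t \<le> 1" using t b by linarith
        then show ?thesis by simp
      qed
      ultimately show ?thesis by (simp add: algebra_simps)
    qed
    have "((1 + t) * (3 / 2) - (1 - t) / 2) * u\<^sup>2 \<ge> 0" using t2 by (intro mult_nonneg_nonneg) auto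
    then show ?thesis using a b by (simp add: algebra_simps)
  qed
  define u v w where "u = x - t" and "v = y - t" and "w = z - t"
  have uvw: "u + v + w = 0" using t by (simp add: u_def v_def w_def)
  have "(1 + t) * (u\<^sup>2 + v\<^sup>2 + w\<^sup>2) - 2 * u * v * w \<ge> 0"
  proof -
    consider "v * w \<ge> 0" | "w * u \<ge> 0" | "u * v \<ge> 0"
      by (cases "u \<ge> 0"; cases "v \<ge> 0"; cases "w \<ge> 0") (auto simp: mult_nonneg_nonneg mult_nonpos_nonpos)
    then show ?thesis
    proof cases
      case 1 then show ?thesis using key[of u v w] uvw b by (simp add: u_def)
    next
      case 2 
      have "(1 + t) * (v\<^sup>2 + w\<^sup>2 + u\<^sup>2) - 2 * v * w * u \<ge> 0"
        by (rule key) (use 2 uvw b in \<open>auto simp: v_def\<close>)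
      then show ?thesis by (simp add: algebra_simps)
    next
      case 3
      have "(1 + t) * (w\<^sup>2 + u\<^sup>2 + v\<^sup>2) - 2 * w * u * v \<ge> 0"
        by (rule key) (use 3 uvw b in \<open>auto simp: w_def\<close>)
      then show ?thesis by (simp add: algebra_simps)
    qed
  qed
  moreover have "(1 + 2*t) * (1 - t)\<^sup>2 - (1 + 2*x*y*z - x\<^sup>2 - y\<^sup>2 - z\<^sup>2)
      = (1 + t) * (u\<^sup>2 + v\<^sup>2 + w\<^sup>2) - 2 * u * v * w"
  proof -
    have h: "x = t + u" "y = t + v" "z = t - u - v" "w = - u - v" using uvw by (auto simp: u_def v_def w_def)
    show ?thesis unfolding h by algebra
  qed
  ultimately show ?thesis by linarith
qed

lemma unit_triple_inner:
  fixes a b c :: "real^3"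
  assumes n: "norm a = 1" "norm b = 1" "norm c = 1"
  shows "(norm (a + b + c))\<^sup>2 = 3 + 2 * (b \<bullet> c + c \<bullet> a + a \<bullet> b)" "b \<bullet> c + c \<bullet> a + a \<bullet> b \<ge> - 3 / 2"
    "\<bar>b \<bullet> c\<bar> \<le> 1" "\<bar>c \<bullet> a\<bar> \<le> 1" "\<bar>a \<bullet> b\<bar> \<le> 1"
proof -
  have "a \<bullet> a = 1" "b \<bullet> b = 1" "c \<bullet> c = 1" using n by (simp_all add: norm_eq_1)
  then show 1: "(norm (a + b + c))\<^sup>2 = 3 + 2 * (b \<bullet> c + c \<bullet> a + a \<bullet> b)"
    unfolding power2_norm_eq_inner by (simp add: inner_add inner_commute)
  show "b \<bullet> c + c \<bullet> a + a \<bullet> b \<ge> - 3 / 2" 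
  proof -
    have "0 \<le> 3 + 2 * (b \<bullet> c + c \<bullet> a + a \<bullet> b)" unfolding 1[symmetric] by simp
    then show ?thesis by simp
  qed
  show "\<bar>b \<bullet> c\<bar> \<le> 1" "\<bar>c \<bullet> a\<bar> \<le> 1" "\<bar>a \<bullet> b\<bar> \<le> 1"
    using Cauchy_Schwarz_ineq2[of b c] Cauchy_Schwarz_ineq2[of c a] Cauchy_Schwarz_ineq2[of a b] n by simp_all
qed

lemma det3_square_le:
  assumes n: "norm a = 1" "norm b = 1" "norm c = 1" and t: "3 * t = b \<bullet> c + c \<bullet> a + a \<bullet> b"
  shows "(det3 a b c)\<^sup>2 \<le> (1 + 2*t) * (1 - t)\<^sup>2"
  unfolding det3_square_gram[OF n]
  by (rule gram_le_equilateral) (use unit_triple_inner[OF n] t in auto)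

text \<open>For a fixed volume the solid angle is least for the equilateral triangle, where
  it equals \<open>2 (pi - 3 arctan s)\<close> with \<open>s\<^sup>2 = 1 + 2 t\<close>, \<open>t\<close> being the cosine of the side.\<close>
lemma face_bound:
  assumes n: "norm a = 1" "norm b = 1" "norm c = 1" and D: "det3 a b c > 0" and s0: "1 \<le> s0"
  shows "det3 a b c / 6 \<le> slope s0 * (2 * carg (1 + b \<bullet> c + c \<bullet> a + a \<bullet> b) (det3 a b c)) + offset s0"
proof -
  define D where "D = det3 a b c"
  define t where "t = (b \<bullet> c + c \<bullet> a + a \<bullet> b) / 3"
  define E where "E s = s * (3 - s\<^sup>2) / 2" for s :: real
  have D0: "D > 0" using D by (simp add: D_def)
  have le: "D\<^sup>2 \<le> (1 + 2*t) * (1 - t)\<^sup>2" unfolding D_def by (rule det3_square_le[OF n]) (simp add: t_def)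
  have t1: "t < 1"
  proof -
    have "t \<le> 1" using unit_triple_inner(3-5)[OF n] by (simp add: t_def)
    moreover have "t \<noteq> 1" using le D0 by auto
    ultimately show ?thesis by simp
  qed
  define s where "s = sqrt (1 + 2 * t)"
  have t0: "1 + 2 * t \<ge> 0" using unit_triple_inner(2)[OF n] by (simp add: t_def field_simps)
  have s2: "s\<^sup>2 = 1 + 2 * t" using t0 by (simp add: s_def)
  have s_nn: "s \<ge> 0" by (simp add: s_def t0)
  have s3: "s < sqrt 3" using t1 by (simp add: s_def)
  have Es: "E s = s * (1 - t)" unfolding E_def s2 by (simp add: field_simps)
  have "D \<le> E s"
  proof (rule power2_le_imp_le)
    show "D\<^sup>2 \<le> (E s)\<^sup>2" using le unfolding Es power_mult_distrib s2 .
    show "E s \<ge> 0" unfolding Es using s_nn t1 by simp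
  qed
  have cont: "continuous_on X E" for X unfolding E_def by (auto intro!: continuous_intros)
  \<comment> \<open>An equilateral triangle with the same \<open>D\<close> and parameter at least
    \<open>s\<close>; it exists since \<open>E\<close> reaches 0 at \<open>sqrt 3\<close>. The
    tangent line inequality asks for \<open>s1 \<ge> 1\<close>, so for \<open>s < 1\<close>, where
    the mean cosine is negative, the search starts at 1, the maximum of \<open>E\<close>.\<close>
  have "\<exists>s1. 1 \<le> s1 \<and> s \<le> s1 \<and> s1 \<le> sqrt 3 \<and> E s1 = D"
  proof (cases "1 \<le> s")
    case True
    have "\<exists>x\<ge>s. x \<le> sqrt 3 \<and> E x = D"
      by (rule IVT2'[of E "sqrt 3" D s]) (use \<open>D \<le> E s\<close> s3 D0 cont in \<open>auto simp: E_def\<close>)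
    then obtain x where "x \<ge> s" "x \<le> sqrt 3" "E x = D" by blast
    then show ?thesis using True by (intro exI[of _ x]) auto
  next
    case False
    have "E s \<le> E 1"
    proof -
      have "(s - 1)\<^sup>2 * (s + 2) \<ge> 0" using s_nn by simp
      then show ?thesis by (simp add: E_def power2_eq_square algebra_simps)
    qed
    then have "\<exists>x\<ge>1. x \<le> sqrt 3 \<and> E x = D"
      by (intro IVT2'[of E "sqrt 3" D 1]) (use \<open>D \<le> E s\<close> s3 D0 cont in \<open>auto simp: E_def\<close>)
    then obtain x where "x \<ge> 1" "x \<le> sqrt 3" "E x = D" by blast
    then show ?thesis using False by (intro exI[of _ x]) auto
  qed
  then obtain s1 where s1: "1 \<le> s1" "s \<le> s1" "s1 \<le> sqrt 3" "E s1 = D" by blast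
  have "s1 \<noteq> sqrt 3" using s1(4) D0 by (auto simp: E_def)
  then have s1': "s1 < sqrt 3" using s1 by simp
  have "s\<^sup>2 \<le> s1\<^sup>2" using s1 s_nn by (intro power_mono) auto
  \<comment> \<open>A larger parameter means a larger mean cosine, hence a larger \<open>N\<close>
    and a smaller angle at equal \<open>D\<close>.\<close>
  then have "carg ((3 * s1\<^sup>2 - 1) / 2) D \<le> carg (1 + 3 * t) D"
    by (intro carg_antimono[OF D0]) (simp add: s2)
  then have "pi - 3 * arctan s1 \<le> carg (1 + 3 * t) D"
    using carg_equilateral[OF s1(1) s1'] s1(4) by (simp add: E_def)
  then have "slope s0 * (2 * (pi - 3 * arctan s1)) \<le> slope s0 * (2 * carg (1 + 3 * t) D)"
    using s0 by (intro mult_left_mono) (auto simp: slope_def)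
  moreover have "D / 6 - 2 * slope s0 * (pi - 3 * arctan s1) \<le> offset s0"
    using offset_max[OF s0 s1(1)] s1(4) by (simp add: E_def)
  moreover have "1 + 3 * t = 1 + b \<bullet> c + c \<bullet> a + a \<bullet> b" by (simp add: t_def)
  ultimately show ?thesis unfolding D_def by (simp add: algebra_simps)
qed

section \<open>Arctangent estimates and the triangle below the trivalent vertex\<close>

lemma arctan_ge_cubic: assumes "0 \<le> x" shows "x - x ^ 3 / 3 \<le> arctan x"
proof -
  have "arctan 0 - 0 + 0 ^ 3 / 3 \<le> arctan x - x + x ^ 3 / 3"
  proof (rule DERIV_nonneg_imp_nondecreasing[OF assms])
    fix u :: real
    have val: "1 / (1 + u\<^sup>2) - 1 + u\<^sup>2 = u ^ 4 / (1 + u\<^sup>2)"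
    proof -
      have "1 + u\<^sup>2 \<noteq> 0" using zero_le_power2[of u] by linarith
      then have "1 / (1 + u\<^sup>2) - 1 + u\<^sup>2 = (1 - (1 + u\<^sup>2) + u\<^sup>2 * (1 + u\<^sup>2)) / (1 + u\<^sup>2)"
        by (simp add: field_simps)
      also have "1 - (1 + u\<^sup>2) + u\<^sup>2 * (1 + u\<^sup>2) = u ^ 4" by algebra
      finally show ?thesis .
    qed
    have der: "((\<lambda>x. arctan x - x + x ^ 3 / 3) has_real_derivative (1 / (1 + u\<^sup>2) - 1 + u\<^sup>2)) (at u)"
      unfolding inverse_eq_divide[symmetric] by (auto intro!: derivative_eq_intros)
    have "u ^ 4 / (1 + u\<^sup>2) \<ge> 0" by (intro divide_nonneg_nonneg add_nonneg_nonneg) auto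
    then show "\<exists>y. ((\<lambda>x. arctan x - x + x ^ 3 / 3) has_real_derivative y) (at u) \<and> 0 \<le> y"
      using der unfolding val by blast
  qed
  then show ?thesis by simp
qed

text \<open>The right side minus the left has derivative
  \<open>sqrt 3 * u^4 / (1 + u^2 + u^4)\<close>, so the two agree to fourth order at 0 and little is
  lost for small \<open>g\<close>.\<close>

lemma arctan_cap_le:
  assumes g: "0 \<le> g" "g < 1"
  shows "arctan (sqrt 3 * g / (1 - g\<^sup>2)) \<le> sqrt 3 * g"
proof -
  let ?f = "\<lambda>x. sqrt 3 * x - arctan (sqrt 3 * x / (1 - x\<^sup>2))"
  have "?f 0 \<le> ?f g"
  proof (rule DERIV_nonneg_imp_nondecreasing[OF g(1)])
    fix u assume u: "0 \<le> u" "u \<le> g"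
    have u1: "1 - u\<^sup>2 > 0" using u g power_strict_mono[of u 1 2] by simp
    have p: "1 + u\<^sup>2 + u ^ 4 > 0" by (intro add_pos_nonneg) auto
    define d where "d = (sqrt 3 * (1 - u\<^sup>2) + sqrt 3 * u * (2 * u)) / (1 - u\<^sup>2)\<^sup>2"
    have q: "((\<lambda>x. sqrt 3 * x / (1 - x\<^sup>2)) has_real_derivative d) (at u)"
      unfolding d_def using u1 by (auto intro!: derivative_eq_intros simp: power2_eq_square)
    have der: "(?f has_real_derivative (sqrt 3 - inverse (1 + (sqrt 3 * u / (1 - u\<^sup>2))\<^sup>2) * d)) (at u)"
      using u1 by (auto intro!: derivative_eq_intros simp: d_def power2_eq_square)
    have val: "sqrt 3 - inverse (1 + (sqrt 3 * u / (1 - u\<^sup>2))\<^sup>2) * d = sqrt 3 * (u ^ 4 / (1 + u\<^sup>2 + u ^ 4))"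
    proof -
      have a: "1 + (sqrt 3 * u / (1 - u\<^sup>2))\<^sup>2 = (1 + u\<^sup>2 + u ^ 4) / (1 - u\<^sup>2)\<^sup>2"
        using u1 by (simp add: power_divide power_mult_distrib divide_simps) algebra
      have b: "d = sqrt 3 * (1 + u\<^sup>2) / (1 - u\<^sup>2)\<^sup>2" unfolding d_def by (simp add: algebra_simps power2_eq_square)
      have "inverse (1 + (sqrt 3 * u / (1 - u\<^sup>2))\<^sup>2) * d = sqrt 3 * (1 + u\<^sup>2) / (1 + u\<^sup>2 + u ^ 4)"
        unfolding a b using u1 p by simp
      then show ?thesis using p by (simp add: field_simps)
    qed
    have "sqrt 3 * (u ^ 4 / (1 + u\<^sup>2 + u ^ 4)) \<ge> 0" using p by simp
    then show "\<exists>y. (?f has_real_derivative y) (at u) \<and> 0 \<le> y" using der unfolding val by blast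
  qed
  then show ?thesis by simp
qed

text \<open>Its norm is twice the area of the triangle, and the plane of the triangle is its level
  set at height \<open>det3 a b c\<close>.\<close>

definition tnormal :: "real^3 \<Rightarrow> real^3 \<Rightarrow> real^3 \<Rightarrow> real^3" where
  "tnormal a b c = cross3 (b - a) (c - a)"

lemma tnormal_inner:
  "tnormal a b c \<bullet> a = det3 a b c" "tnormal a b c \<bullet> b = det3 a b c" "tnormal a b c \<bullet> c = det3 a b c"
  "det3 (a - v) (b - v) (c - v) = det3 a b c - tnormal a b c \<bullet> v"
  by (simp_all add: tnormal_def inner3 det3_expand cross_components algebra_simps)

text \<open>Weitzenboeck's inequality for a triangle with squared sides \<open>2 p\<close>,
  \<open>2 q\<close>, \<open>2 r\<close>: the area is at most that of the equilateral triangle with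
  the same sum of squared sides.\<close>

lemma tnormal_norm_le:
  assumes n: "norm a = 1" "norm b = 1" "norm c = 1" and t: "3 * t = b \<bullet> c + c \<bullet> a + a \<bullet> b"
  shows "norm (tnormal a b c) \<le> sqrt 3 * (1 - t)"
proof -
  define p q r where "p = 1 - b \<bullet> c" and "q = 1 - c \<bullet> a" and "r = 1 - a \<bullet> b"
  have nn: "a \<bullet> a = 1" "b \<bullet> b = 1" "c \<bullet> c = 1" using n by (simp_all add: norm_eq_1)
  have "(b - a) \<bullet> (c - a) = q + r - p" "(b - a) \<bullet> (b - a) = 2 * r" "(c - a) \<bullet> (c - a) = 2 * q"
    using nn by (simp_all add: p_def q_def r_def inner_diff inner_commute algebra_simps)
  then have "(norm (tnormal a b c))\<^sup>2 = (2 * r) * (2 * q) - (q + r - p)\<^sup>2"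
    unfolding tnormal_def norm_cross by (simp add: power2_norm_eq_inner)
  also have "\<dots> \<le> (p + q + r)\<^sup>2 / 3"
    using zero_le_power2[of "p - q"] zero_le_power2[of "q - r"] zero_le_power2[of "r - p"]
    by (simp add: power2_eq_square algebra_simps)
  also have "p + q + r = 3 * (1 - t)" using t by (simp add: p_def q_def r_def)
  also have "(3 * (1 - t))\<^sup>2 / 3 = (sqrt 3 * (1 - t))\<^sup>2" 
  proof -
    have "(3 * (1 - t))\<^sup>2 = 9 * (1 - t)\<^sup>2" by (simp only: power_mult_distrib) simp
    then show ?thesis by (simp add: power_mult_distrib)
  qed
  finally show ?thesis
  proof (rule power2_le_imp_le)
    have "t \<le> 1" using unit_triple_inner(3-5)[OF n] t by linarith
    then show "0 \<le> sqrt 3 * (1 - t)" by simp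
  qed
qed

text \<open>The constant is the volume of the regular tetrahedron. Here \<open>r\<close> is the
  distance of the centroid of \<open>abc\<close> from the centre. Determinant and normal are bounded
  by their equilateral values, and \<open>(1 - r^2) (1 + r)\<close> is largest at
  \<open>r = 1/3\<close>.\<close>

lemma tetrahedron_volume_le:
  fixes a b c v :: "real^3"
  assumes n: "norm a = 1" "norm b = 1" "norm c = 1" "norm v = 1"
  shows "measure lebesgue (convex hull {v,a,b,c}) \<le> 8 * sqrt 3 / 27"
proof -
  define t where "t = (b \<bullet> c + c \<bullet> a + a \<bullet> b) / 3"
  have t: "3 * t = b \<bullet> c + c \<bullet> a + a \<bullet> b" by (simp add: t_def)
  have t0: "1 + 2 * t \<ge> 0" using unit_triple_inner(2)[OF n(1-3)] t by simp
  have t1: "t \<le> 1" using unit_triple_inner(3-5)[OF n(1-3)] t by linarith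
  define r where "r = sqrt ((1 + 2 * t) / 3)"
  have r: "r \<ge> 0" "r\<^sup>2 = (1 + 2 * t) / 3" using t0 by (simp_all add: r_def)
  have "\<bar>det3 a b c\<bar> \<le> sqrt 3 * r * (1 - t)"
  proof (rule power2_le_imp_le)
    have "(sqrt 3 * r * (1 - t))\<^sup>2 = (1 + 2 * t) * (1 - t)\<^sup>2" using r by (simp add: power_mult_distrib)
    then show "\<bar>det3 a b c\<bar>\<^sup>2 \<le> (sqrt 3 * r * (1 - t))\<^sup>2" using det3_square_le[OF n(1-3) t] by simp
  qed (use r t1 in simp)
  moreover have "\<bar>tnormal a b c \<bullet> v\<bar> \<le> sqrt 3 * (1 - t)"
    using Cauchy_Schwarz_ineq2[of "tnormal a b c" v] tnormal_norm_le[OF n(1-3) t] n(4) by simp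
  ultimately have "\<bar>det3 (a - v) (b - v) (c - v)\<bar> \<le> sqrt 3 * ((1 - t) * (1 + r))"
    unfolding tnormal_inner by (simp add: algebra_simps)
  also have "\<dots> \<le> sqrt 3 * (16 / 9)"
  proof (rule mult_left_mono)
    have t': "1 - t = 3 / 2 * (1 - r\<^sup>2)" using r by (simp add: field_simps)
    have "(r - 1/3)\<^sup>2 * (r + 5/3) \<ge> 0" using r by simp
    then show "(1 - t) * (1 + r) \<le> 16 / 9" unfolding t' by (simp add: power2_eq_square algebra_simps)
  qed simp
  finally show ?thesis unfolding measure_tetrahedron by simp
qed

text \<open>The maximum over \<open>g\<close> of
  \<open>sqrt 3 * (2/9) (1 - g^2) - \<alpha> (pi - 2 sqrt 3 g)\<close>, attained at
  \<open>g = 9 \<alpha> / 2\<close>. The first term is a third of the area, the bracket a lower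
  bound for the solid angle.\<close>

definition cap_const :: "real \<Rightarrow> real" where
  "cap_const \<alpha> = sqrt 3 * (2 / 9 + 9 / 2 * \<alpha>\<^sup>2) - \<alpha> * pi"

text \<open>The left side is a third of the area. Two upper bounds for \<open>N\<close> are
  combined: \<open>4 g^2\<close> from the area, and \<open>4 h^2\<close> from acuteness, with
  \<open>h\<close> the distance of the plane \<open>abc\<close> from the centre. Their geometric
  mean \<open>4 g h\<close> cancels \<open>h\<close> in \<open>N / D\<close> and leaves a function
  of the area alone.\<close>

lemma cap_bound:
  assumes n: "norm a = 1" "norm b = 1" "norm c = 1" and D: "det3 a b c > 0" and \<alpha>: "\<alpha> \<ge> 11 / 200"
    and acute: "(norm (a + b + c))\<^sup>2 \<le> 1 + 8 * (det3 a b c / norm (tnormal a b c))\<^sup>2"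
  shows "norm (tnormal a b c) / 6 \<le> \<alpha> * (2 * carg (1 + b \<bullet> c + c \<bullet> a + a \<bullet> b) (det3 a b c)) + cap_const \<alpha>"
proof -
  define D where "D = det3 a b c"
  define m where "m = norm (tnormal a b c)"
  define t where "t = (b \<bullet> c + c \<bullet> a + a \<bullet> b) / 3"
  define N where "N = 1 + 3 * t"
  have t: "3 * t = b \<bullet> c + c \<bullet> a + a \<bullet> b" by (simp add: t_def)
  have N: "1 + b \<bullet> c + c \<bullet> a + a \<bullet> b = N" by (simp add: N_def t)
  have D0: "D > 0" using D by (simp add: D_def)
  have m0: "m > 0" unfolding m_def using D tnormal_inner(1)[of a b c] by auto
  have mt: "m \<le> sqrt 3 * (1 - t)" unfolding m_def by (rule tnormal_norm_le[OF n t])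
  have s3: "sqrt 3 * sqrt 3 = (3::real)" by simp
  have "sqrt 3 * m \<le> sqrt 3 * (sqrt 3 * (1 - t))" by (rule mult_left_mono[OF mt]) simp
  then have mN: "N \<le> 4 - sqrt 3 * m" unfolding N_def mult.assoc[symmetric] s3 by simp
  define h where "h = D / m"
  have h0: "h > 0" using D0 m0 by (simp add: h_def)
  have hN: "N \<le> 4 * h\<^sup>2"
    using acute unit_triple_inner(1)[OF n] unfolding h_def D_def m_def N_def using t by simp
  define K where "K = carg N D"
  have a0: "\<alpha> > 0" using \<alpha> by simp
  have cc: "cap_const \<alpha> = sqrt 3 * (2 / 9) + sqrt 3 * (9 / 2 * \<alpha>\<^sup>2) - \<alpha> * pi"
    by (simp add: cap_const_def distrib_left)
  have main: "m / 6 \<le> \<alpha> * (2 * K) + cap_const \<alpha>"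
  \<comment> \<open>Equality is the area of a face of the regular tetrahedron. Beyond it
    \<open>N \<le> 0\<close>, and the cubic arctangent bound takes the place of the estimate through
    \<open>g\<close>.\<close>
  proof (cases "sqrt 3 * m < 4")
    case True
    have m6: "m / 6 = sqrt 3 * (sqrt 3 * m) / 18" by simp
    show ?thesis
    proof (cases "N \<le> 0")
      case N0: True
      have "arctan (N / D) \<le> 0" using N0 D0 by (simp add: divide_nonpos_pos)
      then have "K \<ge> pi / 2" by (simp add: K_def carg_def)
      then have "\<alpha> * (2 * K) \<ge> \<alpha> * pi" using a0 by simp
      moreover have "m / 6 \<le> sqrt 3 * 4 / 18" unfolding m6 using True by (intro divide_right_mono mult_left_mono) auto
      moreover have "sqrt 3 * (9 / 2 * \<alpha>\<^sup>2) \<ge> 0" by simp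
      ultimately show ?thesis unfolding cc by linarith
    next
      case False
      define g where "g = sqrt (4 - sqrt 3 * m) / 2"
      have g2: "4 * g\<^sup>2 = 4 - sqrt 3 * m" using True by (simp add: g_def power_divide)
      have g: "0 \<le> g" "g < 1"
      proof -
        show "0 \<le> g" using True by (simp add: g_def)
        have "sqrt 3 * m > 0" using m0 by simp
        then have "g\<^sup>2 < 1" using g2 by linarith
        then show "g < 1" using \<open>0 \<le> g\<close> by (simp add: power2_less_1_iff)
      qed
      have g1: "1 - g\<^sup>2 > 0" using g power_strict_mono[of g 1 2] by simp
      define k where "k = sqrt N"
      have k: "k > 0" "k\<^sup>2 = N" using False by (simp_all add: k_def)
      have kh: "k \<le> 2 * h" by (rule power2_le_imp_le) (use k hN h0 in \<open>auto simp: power_mult_distrib\<close>)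
      have kg: "k \<le> 2 * g" by (rule power2_le_imp_le) (use k mN g2 g in \<open>auto simp: power_mult_distrib\<close>)
      have Dm: "D = m * h" using m0 by (simp add: h_def)
      have "N / D \<le> sqrt 3 * g / (1 - g\<^sup>2)"
      proof -
        have "k * k \<le> (2 * h) * (2 * g)" by (rule mult_mono) (use kh kg k h0 in auto)
        then have "N / D \<le> (2 * h) * (2 * g) / (m * h)"
          unfolding Dm using k m0 h0 by (intro divide_right_mono) (auto simp: power2_eq_square)
        also have "\<dots> = 4 * g / m" using h0 by simp
        also have "m = 4 * (1 - g\<^sup>2) / sqrt 3"
          using g2 by (simp add: field_simps)
        also have "4 * g / (4 * (1 - g\<^sup>2) / sqrt 3) = sqrt 3 * g / (1 - g\<^sup>2)" using g1 by (simp add: field_simps)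
        finally show ?thesis .
      qed
      then have "arctan (N / D) \<le> arctan (sqrt 3 * g / (1 - g\<^sup>2))" by (simp only: arctan_le_iff)
      then have "arctan (N / D) \<le> sqrt 3 * g" using arctan_cap_le[OF g] by linarith
      then have "K \<ge> pi / 2 - sqrt 3 * g" by (simp add: K_def carg_def)
      then have f1: "\<alpha> * (2 * K) \<ge> \<alpha> * (2 * (pi / 2 - sqrt 3 * g))" using a0 by simp
      have f2: "\<alpha> * (2 * (pi / 2 - sqrt 3 * g)) = \<alpha> * pi - 2 * (\<alpha> * g * sqrt 3)"
        by (simp add: algebra_simps)
      have "m / 6 = sqrt 3 * (4 - 4 * g\<^sup>2) / 18" unfolding m6 using g2 by simp
      then have f3: "m / 6 = sqrt 3 * (2 / 9) - sqrt 3 * g\<^sup>2 * (2 / 9)"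
        by (simp add: algebra_simps)
      \<comment> \<open>Completing the square in \<open>g\<close>, with the maximiser
        \<open>g = 9 \<alpha> / 2\<close>.\<close>
      have f4: "sqrt 3 * ((2 * g - 9 * \<alpha>)\<^sup>2 / 18)
          = sqrt 3 * g\<^sup>2 * (2 / 9) - 2 * (\<alpha> * g * sqrt 3) + sqrt 3 * (9 / 2 * \<alpha>\<^sup>2)"
        by (simp add: power2_eq_square field_simps)
      have f5: "sqrt 3 * ((2 * g - 9 * \<alpha>)\<^sup>2 / 18) \<ge> 0" by simp
      have lin: "M \<le> L + (S + Z - P)"
        if "E \<le> L" "E = P - 2 * Y" "M = S - X * (2 / 9)" "Q = X * (2 / 9) - 2 * Y + Z" "0 \<le> Q"
        for L M S Z P E X Y Q :: real using that by linarith
      show ?thesis unfolding cc by (rule lin[OF f1 f2 f3 f4 f5])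
    qed
  next
    case False
    define \<nu> where "\<nu> = - N"
    have nu: "\<nu> \<ge> 0" "\<nu> \<le> 1 / 2" using mN False unit_triple_inner(2)[OF n] t by (auto simp: \<nu>_def N_def)
    have "D\<^sup>2 \<le> (1 + 2*t) * (1 - t)\<^sup>2" unfolding D_def by (rule det3_square_le[OF n t])
    also have "\<dots> \<le> 1"
    proof -
      have "t \<le> 1" using unit_triple_inner(3-5)[OF n] t by linarith
      then have "t\<^sup>2 * (3 - 2 * t) \<ge> 0" by simp
      then show ?thesis by (simp add: power2_eq_square algebra_simps)
    qed
    finally have "D \<le> 1" using abs_square_le_1[of D] D0 by simp
    then have "\<nu> \<le> \<nu> / D" using nu D0 mult_left_le[of D \<nu>] by (simp add: le_divide_eq)
    then have "arctan \<nu> \<le> arctan (\<nu> / D)" by (simp only: arctan_le_iff)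
    then have "arctan (\<nu> / D) \<ge> \<nu> - \<nu> ^ 3 / 3"
      using arctan_ge_cubic[OF nu(1)] by linarith
    moreover have "\<nu> ^ 3 \<le> \<nu> * (1 / 4)"
    proof -
      have "\<nu>\<^sup>2 \<le> (1 / 2)\<^sup>2" using nu by (intro power_mono) auto
      then have "\<nu> * \<nu>\<^sup>2 \<le> \<nu> * (1 / 4)" using nu by (intro mult_left_mono) (auto simp: power2_eq_square)
      then show ?thesis by (simp add: power3_eq_cube power2_eq_square)
    qed
    moreover have "K = pi / 2 + arctan (\<nu> / D)"
      by (simp add: K_def carg_def \<nu>_def arctan_minus)
    \<comment> \<open>For \<open>\<nu> \<le> 1/2\<close> the cubic bound is at least
      \<open>(1 - 1/12) \<nu>\<close>.\<close>
    ultimately have "K \<ge> pi / 2 + 11 / 12 * \<nu>" by linarith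
    then have f1: "\<alpha> * (2 * K) \<ge> \<alpha> * (2 * (pi / 2 + 11 / 12 * \<nu>))" using a0 by simp
    have f2: "\<alpha> * (2 * (pi / 2 + 11 / 12 * \<nu>)) = \<alpha> * pi + 11 / 6 * \<alpha> * \<nu>"
      by (simp add: algebra_simps)
    have "1 - t = (4 + \<nu>) / 3" by (simp add: \<nu>_def N_def)
    then have "m \<le> sqrt 3 * ((4 + \<nu>) / 3)" using mt by (simp only:)
    moreover have "M / 6 \<le> w * (2 / 9) + w / 18 * v" if "M \<le> w * ((4 + v) / 3)" for M w v :: real
      using that by (simp add: field_simps)
    ultimately have f3: "m / 6 \<le> sqrt 3 * (2 / 9) + sqrt 3 / 18 * \<nu>" by blast
    \<comment> \<open>This calls for \<open>\<alpha> \<ge> 11/200\<close>: with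
      \<open>sqrt 3 \<le> 9/5\<close> it amounts to \<open>1/10 \<le> 121/1200\<close>.\<close>
    have f4: "sqrt 3 / 18 * \<nu> \<le> 11 / 6 * \<alpha> * \<nu>"
    proof (rule mult_right_mono)
      have "sqrt 3 \<le> 9 / 5" by (rule real_le_lsqrt) (auto simp: power2_eq_square)
      then show "sqrt 3 / 18 \<le> 11 / 6 * \<alpha>" using \<alpha> by simp
    qed (use nu in simp)
    have f5: "sqrt 3 * (9 / 2 * \<alpha>\<^sup>2) \<ge> 0" by simp
    have lin: "M \<le> L + (S + Z - P)"
      if "E \<le> L" "E = P + X" "M \<le> S + Y" "Y \<le> X" "0 \<le> Z"
      for L M S Z P E X Y :: real using that by linarith
    show ?thesis unfolding cc by (rule lin[OF f1 f2 f3 f4 f5])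
  qed
  then show ?thesis unfolding N D_def[symmetric] m_def[symmetric] K_def[symmetric] .
qed

section \<open>Numerical comparison with the example\<close>

text \<open>The addition formula at 1. The parameters \<open>5/4\<close> and \<open>3/2\<close> are
  \<open>(1 + x) / (1 - x)\<close> for \<open>x = 1/9\<close> and \<open>x = 1/5\<close>.\<close>

lemma arctan_add_le: assumes "0 < x" and that: "x < 1" shows "arctan ((1 + x) / (1 - x)) \<le> pi / 4 + x"
proof -
  have "arctan 1 + arctan x = arctan ((1 + x) / (1 - 1 * x))"
    using that assms by (intro arctan_add) auto
  then have "arctan ((1 + x) / (1 - x)) = pi / 4 + arctan x" by (simp add: arctan_one)
  moreover have "arctan x \<le> x" using assms by (simp add: arctan_le_self)
  ultimately show ?thesis by simp
qed

lemma arctan_5_4: "arctan (5 / 4) \<le> pi / 4 + 1 / 9"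
  using arctan_add_le[of "1/9"] by simp

lemma arctan_3_2: "arctan (3 / 2) \<le> pi / 4 + 1 / 5"
  using arctan_add_le[of "1/5"] by simp

text \<open>The prism with circumradius \<open>21/29\<close> and half height \<open>20/29\<close>,
  plus three caps with apex on the sphere. The triple 20, 21, 29 makes all data rational up to
  \<open>sqrt 3\<close>, at nearly the best proportions.\<close>

definition example_volume :: real where "example_volume = sqrt 3 * (420 / 841) * (137 / 58)"

lemma sqrt3_bounds: "17320 / 10000 \<le> sqrt 3" "sqrt 3 \<le> 17321 / 10000"
  by (rule real_le_rsqrt, simp add: power2_eq_square) (rule real_le_lsqrt, auto simp: power2_eq_square)

lemma pi_bounds: "314 / 100 \<le> pi" "pi \<le> 315 / 100"
  using pi_approx by simp_all

lemma example_volume_ge: "example_volume \<ge> 2043 / 1000"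
proof -
  have "sqrt 3 * (117963 / 100000) \<le> sqrt 3 * (420 / 841 * (137 / 58))"
    by (rule mult_left_mono) auto
  then show ?thesis using sqrt3_bounds unfolding example_volume_def by linarith
qed

text \<open>The parameter \<open>5/4\<close> stands for a solid angle of about 0.91, near the share
  of each of the eleven faces other than \<open>abc\<close>. The margin is only about 0.016.\<close>

lemma bound_inside_lt_example:
  "4 * pi * slope (5/4) + 11 * offset (5/4) + cap_const (slope (5/4)) < example_volume"
proof -
  have s: "slope (5/4) = 123 / 2048" by (simp add: slope_def power4_eq_xxxx)
  have o: "offset (5/4) = 115 / 768 - 123 / 1024 * (pi - 3 * arctan (5/4))"
    unfolding offset_def s by (simp add: power2_eq_square)
  have "sqrt 3 * (2 / 9 + 9 / 2 * (123 / 2048)\<^sup>2) \<le> sqrt 3 * (2385 / 10000)"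
    by (rule mult_left_mono) (auto simp: power2_eq_square)
  then have "cap_const (slope (5/4)) \<le> sqrt 3 * (2385 / 10000) - 123 / 2048 * pi"
    unfolding cap_const_def s by linarith
  moreover have "4 * p * (123 / 2048) + 11 * (115 / 768 - 123 / 1024 * (p - 3 * A)) + C < b"
    if "C \<le> w * (2385 / 10000) - 123 / 2048 * p" "A \<le> p / 4 + 1 / 9" "w \<le> 17321 / 10000"
      "314 / 100 \<le> p" "2043 / 1000 \<le> b" for p A w C b :: real
    using that by (simp add: field_simps)
  ultimately show ?thesis unfolding o
    using arctan_5_4 sqrt3_bounds pi_bounds example_volume_ge unfolding s by blast
qed

text \<open>Half the bound for 16 vertices, hence 28 faces, plus a regular tetrahedron. The mean
  solid angle \<open>4 pi / 28\<close> is about 0.45; the parameter \<open>3/2\<close> stands for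
  about 0.39.\<close>

lemma bound_outside_lt_example:
  "(4 * pi * slope (3/2) + 28 * offset (3/2)) / 2 + 8 * sqrt 3 / 27 < example_volume"
proof -
  have s: "slope (3/2) = 65 / 384" by (simp add: slope_def power4_eq_xxxx)
  have o: "offset (3/2) = 3 / 32 - 65 / 192 * (pi - 3 * arctan (3/2))"
    unfolding offset_def s by (simp add: power2_eq_square)
  have "(4 * p * (65 / 384) + 28 * (3 / 32 - 65 / 192 * (p - 3 * A))) / 2 + 8 * w / 27 < b"
    if "A \<le> p / 4 + 1 / 5" "w \<le> 17321 / 10000" "314 / 100 \<le> p" "2043 / 1000 \<le> b" for p A w b :: real
    using that by (simp add: field_simps)
  then show ?thesis unfolding s o
    using arctan_3_2 sqrt3_bounds pi_bounds example_volume_ge by blast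
qed

section \<open>Volume bounds in general position\<close>

context generic_polytope
begin

lemma face_volume_le:
  assumes F: "F \<in> gfaces W" and s: "1 \<le> s"
  shows "measure lebesgue (convex hull (insert 0 F)) \<le> slope s * (3 * ball_vol (pcone F)) + offset s"
proof -
  obtain a b c where abc: "F = {a,b,c}" and D: "det3 a b c > 0" using gface_oriented[OF g F] by metis
  have n: "norm a = 1" "norm b = 1" "norm c = 1" using F sph unfolding abc gfaces_def by auto
  have "measure lebesgue (convex hull (insert 0 F)) = det3 a b c / 6"
    unfolding abc measure_tetrahedron using D by simp
  also have "\<dots> \<le> slope s * (2 * carg (1 + b \<bullet> c + c \<bullet> a + a \<bullet> b) (det3 a b c)) + offset s"
    by (rule face_bound[OF n D s])
  also have "2 * carg (1 + b \<bullet> c + c \<bullet> a + a \<bullet> b) (det3 a b c) = 3 * ball_vol (pcone F)"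
    unfolding abc pcone_wedge_eq[OF D] using solid_angle[OF n D] by simp
  finally show ?thesis .
qed

lemma volume_bound:
  assumes s: "1 \<le> s"
  shows "measure lebesgue (convex hull W) \<le> 4 * pi * slope s + (2 * real (card W) - 4) * offset s"
proof -
  have "(\<Sum>F\<in>gfaces W. measure lebesgue (convex hull (insert 0 F)))
      \<le> (\<Sum>F\<in>gfaces W. slope s * (3 * ball_vol (pcone F)) + offset s)"
    by (rule sum_mono) (rule face_volume_le[OF _ s])
  also have "\<dots> = slope s * (3 * (\<Sum>F\<in>gfaces W. ball_vol (pcone F))) + real (card (gfaces W)) * offset s"
    by (simp add: sum.distrib sum_distrib_left)
  also have "\<dots> = 4 * pi * slope s + (2 * real (card W) - 4) * offset s"
    unfolding sum_solid card_gfaces by simp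
  finally show ?thesis using volume_le by linarith
qed

text \<open>One face is left out of the estimate and keeps its own volume and solid angle, to be
  traded later against the tetrahedron erected on it.\<close>

lemma volume_bound_face:
  assumes s: "1 \<le> s" and F0: "{a,b,c} \<in> gfaces W" and D: "det3 a b c > 0"
  shows "measure lebesgue (convex hull W) \<le> 4 * pi * slope s + (2 * real (card W) - 5) * offset s
    + det3 a b c / 6 - slope s * (2 * carg (1 + b \<bullet> c + c \<bullet> a + a \<bullet> b) (det3 a b c))"
proof -
  let ?F = "{a,b,c}"
  let ?v = "\<lambda>F. measure lebesgue (convex hull (insert 0 F))"
  have n: "norm a = 1" "norm b = 1" "norm c = 1" using F0 sph unfolding gfaces_def by auto
  have fg: "finite (gfaces W)" by (rule finite_gfaces[OF fin])
  have c: "real (card (gfaces W - {?F})) = 2 * real (card W) - 5"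
  proof -
    have "card (gfaces W) = Suc (card (gfaces W - {?F}))"
      using card_Suc_Diff1[OF fg F0] by simp
    then show ?thesis using card_gfaces by simp
  qed
  have sa: "3 * ball_vol (pcone ?F) = 2 * carg (1 + b \<bullet> c + c \<bullet> a + a \<bullet> b) (det3 a b c)"
    unfolding pcone_wedge_eq[OF D] by (rule solid_angle[OF n D])
  have v0: "?v ?F = det3 a b c / 6" unfolding measure_tetrahedron using D by simp
  have "(\<Sum>F\<in>gfaces W - {?F}. ?v F) \<le> (\<Sum>F\<in>gfaces W - {?F}. slope s * (3 * ball_vol (pcone F)) + offset s)"
    by (rule sum_mono) (rule face_volume_le[OF _ s], simp)
  also have "\<dots> = slope s * (3 * (\<Sum>F\<in>gfaces W - {?F}. ball_vol (pcone F))) + (2 * real (card W) - 5) * offset s"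
    unfolding c[symmetric] by (simp add: sum.distrib sum_distrib_left)
  also have "(\<Sum>F\<in>gfaces W - {?F}. ball_vol (pcone F)) = 4 / 3 * pi - ball_vol (pcone ?F)"
    using sum_solid sum.remove[OF fg F0, of "\<lambda>F. ball_vol (pcone F)"] by simp
  also have "slope s * (3 * (4 / 3 * pi - ball_vol (pcone ?F))) = 4 * pi * slope s - slope s * (3 * ball_vol (pcone ?F))"
    by (simp add: algebra_simps)
  finally have "(\<Sum>F\<in>gfaces W. ?v F) \<le> 4 * pi * slope s - slope s * (3 * ball_vol (pcone ?F))
      + (2 * real (card W) - 5) * offset s + det3 a b c / 6"
    using sum.remove[OF fg F0, of ?v] v0 by simp
  then show ?thesis using volume_le unfolding sa by linarith
qed

end

section \<open>Perturbation into general position\<close>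

text \<open>Run along a curve through \<open>w\<close>, the inverse stereographic image of
  \<open>(s, s^3)\<close>. On it a plane equation becomes a polynomial equation in \<open>s\<close>;
  because of the cube the curve lies in no plane, so only finitely many \<open>s\<close> are
  forbidden.\<close>

lemma sphere_avoid_planes:
  fixes w :: "real^3"
  assumes w: "norm w = 1" and d: "\<delta> > 0" and P: "finite P" "\<And>u k. (u, k) \<in> P \<Longrightarrow> u \<noteq> 0"
  shows "\<exists>x. norm x = 1 \<and> dist x w < \<delta> \<and> (\<forall>(u, k)\<in>P. u \<bullet> x \<noteq> k)"
proof -
  obtain e1 where e1: "norm e1 = 1" "w \<bullet> e1 = 0" using ex_orthogonal_unit[OF w] by blast
  define e2 where "e2 = cross3 w e1"
  have ww: "w \<bullet> w = 1" "e1 \<bullet> e1 = 1" using w e1 by (simp_all add: norm_eq_1)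
  have ew: "e1 \<bullet> w = 0" using e1(2) by (simp add: inner_commute)
  have e2: "e2 \<bullet> e2 = 1" "w \<bullet> e2 = 0" "e1 \<bullet> e2 = 0"
    unfolding e2_def by (simp_all add: dot_cross dot_cross_self ww e1 ew)
  define q where "q s = 1 + s\<^sup>2 + s ^ 6" for s :: real
  have q: "q s > 0" for s unfolding q_def by (intro add_pos_nonneg) auto
  define \<gamma> where "\<gamma> s = (1 / q s) *\<^sub>R ((2 * s) *\<^sub>R e1 + (2 * s ^ 3) *\<^sub>R e2 + (1 - s\<^sup>2 - s ^ 6) *\<^sub>R w)" for s
  have nrm: "norm (\<gamma> s) = 1" for s
  proof -
    have "((2 * s) *\<^sub>R e1 + (2 * s ^ 3) *\<^sub>R e2 + (1 - s\<^sup>2 - s ^ 6) *\<^sub>R w) \<bullet> ((2 * s) *\<^sub>R e1 + (2 * s ^ 3) *\<^sub>R e2 + (1 - s\<^sup>2 - s ^ 6) *\<^sub>R w)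
       = (2 * s)\<^sup>2 + (2 * s ^ 3)\<^sup>2 + (1 - s\<^sup>2 - s ^ 6)\<^sup>2"
      using ww e1 e2 by (simp add: inner_add inner_commute power2_eq_square)
    also have "\<dots> = (q s)\<^sup>2" unfolding q_def by algebra
    finally have "\<gamma> s \<bullet> \<gamma> s = 1" unfolding \<gamma>_def inner_scaleR_left inner_scaleR_right
      using q[of s] by (simp add: power2_eq_square)
    then show ?thesis by (simp add: norm_eq_1)
  qed
  have "finite {s. u \<bullet> \<gamma> s = k}" if uk: "(u, k) \<in> P" for u k
  proof -
    define A B C where "A = u \<bullet> e1" and "B = u \<bullet> e2" and "C = u \<bullet> w"
    \<comment> \<open>If \<open>p\<close> vanished, the coefficients of 1 and \<open>s^2\<close>
      would give \<open>C = k\<close> and \<open>C = - k\<close>, those of \<open>s\<close> and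
      \<open>s^3\<close> would give \<open>A = B = 0\<close>.\<close>
    define p where "p = [: C - k, 2 * A, - (C + k), 2 * B, 0, 0, - (C + k) :]"
    have "p \<noteq> 0"
    proof
      assume "p = 0"
      then have z: "A = 0" "B = 0" "C = 0" by (auto simp: p_def)
      have "(w \<bullet> u)\<^sup>2 + (e1 \<bullet> u)\<^sup>2 + (cross3 w e1 \<bullet> u)\<^sup>2 = u \<bullet> u"
        by (rule orthonormal_frame_norm[OF w e1])
      then have "u = 0" using z unfolding A_def B_def C_def e2_def[symmetric] by (simp add: inner_commute)
      then show False using P(2)[OF uk] by simp
    qed
    then have "finite {s. poly p s = 0}" by (rule poly_roots_finite)
    moreover have "{s. u \<bullet> \<gamma> s = k} \<subseteq> {s. poly p s = 0}"
    proof clarify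
      fix s assume "k = u \<bullet> \<gamma> s"
      then have "k * q s = 2 * s * A + 2 * s ^ 3 * B + (1 - s\<^sup>2 - s ^ 6) * C"
        using q[of s] unfolding \<gamma>_def A_def B_def C_def by (simp add: inner_add_right)
      moreover have "poly p s = (2 * s * A + 2 * s ^ 3 * B + (1 - s\<^sup>2 - s ^ 6) * C) - k * q s"
        unfolding p_def q_def by simp algebra
      ultimately show "poly p s = 0" by simp
    qed
    ultimately show ?thesis by (rule finite_subset[rotated])
  qed
  then have finb: "finite (\<Union>(u,k)\<in>P. {s. u \<bullet> \<gamma> s = k})" using P(1) by (intro finite_UN_I) auto
  have "continuous (at 0) \<gamma>" unfolding \<gamma>_def using q unfolding q_def
    by (intro continuous_intros) (auto simp: less_imp_neq[symmetric])
  moreover have "\<gamma> 0 = w" by (simp add: \<gamma>_def q_def)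
  ultimately obtain e where e: "e > 0" "\<And>s. dist s 0 < e \<Longrightarrow> dist (\<gamma> s) w < \<delta>"
    using d unfolding continuous_at_eps_delta by metis
  have "infinite {0<..<e}" using e(1) by simp
  then obtain s where s: "s \<in> {0<..<e}" "s \<notin> (\<Union>(u,k)\<in>P. {s. u \<bullet> \<gamma> s = k})"
    using finb by (meson finite_subset subsetI)
  then show ?thesis using nrm e(2)[of s] by (intro exI[of _ "\<gamma> s"]) auto
qed

text \<open>For two points \<open>generic\<close> says nothing; the clause on cross products, which
  also excludes antipodal pairs, carries the induction through such small sets.\<close>

definition spread :: "(real^3) set \<Rightarrow> bool" where
  "spread G \<longleftrightarrow> generic G \<and> (\<forall>p\<in>G. \<forall>q\<in>G. p \<noteq> q \<longrightarrow> cross3 p q \<noteq> 0) \<and> G \<subseteq> sphere 0 1"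

lemma det3_diff_perm:
  "det3 (x - a) (c - a) (d - a) = - det3 (a - x) (c - x) (d - x)"
  "det3 (b - a) (x - a) (d - a) = - det3 (b - x) (a - x) (d - x)"
  "det3 (b - a) (c - a) (x - a) = - det3 (b - x) (c - x) (a - x)"
  by (simp_all add: det3_expand algebra_simps)

text \<open>The forbidden planes are those through the origin and two points, those through three
  points, and for each \<open>p\<close> one plane, with normal \<open>v p\<close>, that contains the
  line of \<open>p\<close>. Off the latter, \<open>x\<close> is not parallel to
  \<open>p\<close>.\<close>

lemma spread_extend:
  assumes fin: "finite G" and G: "spread G" and w: "norm w = 1" and d: "\<delta> > 0"
  shows "\<exists>x. norm x = 1 \<and> dist x w < \<delta> \<and> x \<notin> G \<and> spread (insert x G)"
proof -
  have gen: "generic G" and cr: "\<And>p q. p \<in> G \<Longrightarrow> q \<in> G \<Longrightarrow> p \<noteq> q \<Longrightarrow> cross3 p q \<noteq> 0" and sph: "G \<subseteq> sphere 0 1"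
    using G unfolding spread_def by auto
  have "\<forall>p\<in>G. \<exists>v. v \<noteq> 0 \<and> p \<bullet> v = 0"
  proof
    fix p assume "p \<in> G"
    then have "norm p = 1" using sph by auto
    then show "\<exists>v. v \<noteq> 0 \<and> p \<bullet> v = 0" using ex_orthogonal_unit[of p] by (metis norm_zero zero_neq_one)
  qed
  then obtain v where v: "\<And>p. p \<in> G \<Longrightarrow> v p \<noteq> 0" "\<And>p. p \<in> G \<Longrightarrow> p \<bullet> v p = 0" by metis
  define P where "P = (\<lambda>p. (v p, 0)) ` G \<union> (\<lambda>(p,q). (cross3 p q, 0)) ` {(p,q). p \<in> G \<and> q \<in> G \<and> p \<noteq> q}
     \<union> (\<lambda>(p,q,r). (tnormal p q r, det3 p q r)) ` {(p,q,r). p \<in> G \<and> q \<in> G \<and> r \<in> G \<and> p \<noteq> q \<and> q \<noteq> r \<and> p \<noteq> r}"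
  have f2: "finite {(p,q). p \<in> G \<and> q \<in> G \<and> p \<noteq> q}"
    by (rule finite_subset[of _ "G \<times> G"]) (use fin in auto)
  have f3: "finite {(p,q,r). p \<in> G \<and> q \<in> G \<and> r \<in> G \<and> p \<noteq> q \<and> q \<noteq> r \<and> p \<noteq> r}"
    by (rule finite_subset[of _ "G \<times> G \<times> G"]) (use fin in auto)
  have "finite P" unfolding P_def using fin f2 f3 by simp
  moreover have "u \<noteq> 0" if "(u, k) \<in> P" for u k
  proof -
    have "tnormal p q r \<noteq> 0" if "p \<in> G" "q \<in> G" "r \<in> G" "p \<noteq> q" "q \<noteq> r" "p \<noteq> r" for p q r
    proof -
      have "det3 p q r \<noteq> 0" using gen that unfolding generic_def by blast
      then show ?thesis using tnormal_inner(1)[of p q r] by auto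
    qed
    then show ?thesis using that v(1) cr unfolding P_def by auto
  qed
  ultimately obtain x where x: "norm x = 1" "dist x w < \<delta>" and av: "\<And>u k. (u, k) \<in> P \<Longrightarrow> u \<bullet> x \<noteq> k"
    using sphere_avoid_planes[OF w d, of P] by blast
  have a1: "v p \<bullet> x \<noteq> 0" if "p \<in> G" for p
    by (rule av) (use that in \<open>auto simp: P_def\<close>)
  have a2: "det3 x p q \<noteq> 0" if "p \<in> G" "q \<in> G" "p \<noteq> q" for p q
  proof -
    have "cross3 p q \<bullet> x \<noteq> 0" by (rule av) (use that in \<open>force simp: P_def\<close>)
    then show ?thesis by (simp add: det3_def inner_commute)
  qed
  have a3: "det3 (p - x) (q - x) (r - x) \<noteq> 0" if "p \<in> G" "q \<in> G" "r \<in> G" "p \<noteq> q" "q \<noteq> r" "p \<noteq> r" for p q r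
  proof -
    have "tnormal p q r \<bullet> x \<noteq> det3 p q r" by (rule av) (use that in \<open>force simp: P_def\<close>)
    then show ?thesis unfolding tnormal_inner(4) by simp
  qed
  have xG: "x \<notin> G" using a1 v(2) by (auto simp: inner_commute)
  have cx: "cross3 x p \<noteq> 0" if "p \<in> G" for p
  proof
    assume "cross3 x p = 0"
    then have "(x \<bullet> p) *\<^sub>R p = (p \<bullet> p) *\<^sub>R x" using Lagrange[of p x p] by (simp add: inner_commute)
    moreover have "p \<bullet> p = 1" using that sph by (auto simp: norm_eq_1)
    ultimately have "v p \<bullet> x = (x \<bullet> p) * (v p \<bullet> p)" by (metis inner_scaleR_right scaleR_one)
    then show False using a1[OF that] v(2)[OF that] by (simp add: inner_commute)
  qed
  have "generic (insert x G)"
    unfolding generic_def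
  proof (intro conjI ballI impI)
    fix a b c assume "a \<in> insert x G" "b \<in> insert x G" "c \<in> insert x G" and ne: "a \<noteq> b \<and> b \<noteq> c \<and> a \<noteq> c"
    then consider "a \<in> G" "b \<in> G" "c \<in> G" | "a = x" "b \<in> G" "c \<in> G" | "b = x" "a \<in> G" "c \<in> G" | "c = x" "a \<in> G" "b \<in> G"
      by blast
    then show "det3 a b c \<noteq> 0"
    proof cases
      case 1 then show ?thesis using gen ne unfolding generic_def by blast
    next
      case 2 then show ?thesis using a2 ne by blast
    next
      case 3 then show ?thesis using a2[of a c] ne det3_perm(3)[of x a c] by simp
    next
      case 4 then show ?thesis using a2[of a b] ne det3_perm(2)[of c a b] by auto
    qed
  next
    fix a b c d assume "a \<in> insert x G" "b \<in> insert x G" "c \<in> insert x G" "d \<in> insert x G" and ne: "distinct [a,b,c,d]"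
    then consider "a \<in> G" "b \<in> G" "c \<in> G" "d \<in> G" | "a = x" "b \<in> G" "c \<in> G" "d \<in> G" | "b = x" "a \<in> G" "c \<in> G" "d \<in> G"
       | "c = x" "a \<in> G" "b \<in> G" "d \<in> G" | "d = x" "a \<in> G" "b \<in> G" "c \<in> G"
      by auto
    then show "det3 (b - a) (c - a) (d - a) \<noteq> 0"
    proof cases
      case 1 then show ?thesis using gen ne unfolding generic_def by blast
    next
      case 2 then show ?thesis using a3[of b c d] ne by auto
    next
      case 3 then show ?thesis using a3[of a c d] ne by (auto simp: det3_diff_perm(1)[of x a c d])
    next
      case 4 then show ?thesis using a3[of b a d] ne by (auto simp: det3_diff_perm(2)[of b a x d])
    next
      case 5 then show ?thesis using a3[of b c a] ne by (auto simp: det3_diff_perm(3)[of b a c x])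
    qed
  qed
  moreover have "cross3 p q \<noteq> 0" if "p \<in> insert x G" "q \<in> insert x G" "p \<noteq> q" for p q
    using that cr cx[of p] cx[of q] cross_skew[of p x] by auto
  ultimately show ?thesis using x xG sph unfolding spread_def by (intro exI[of _ x]) auto
qed

text \<open>Points are moved one at a time. Those of \<open>G\<close> stay fixed, so that a chosen
  facet can survive.\<close>

lemma spread_perturb:
  assumes G: "finite G" "spread G" and d: "\<delta> > 0" and A: "finite A" "A \<inter> G = {}" "A \<subseteq> sphere 0 1"
  shows "\<exists>f. (\<forall>w\<in>G. f w = w) \<and> (\<forall>w\<in>G \<union> A. dist (f w) w < \<delta>) \<and> inj_on f (G \<union> A) \<and> spread (f ` (G \<union> A))"
  using A
proof (induction A)
  case empty
  then show ?case using G d by (intro exI[of _ "\<lambda>x. x"]) auto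
next
  case (insert w A)
  then obtain f where f: "\<forall>w\<in>G. f w = w" "\<forall>w\<in>G \<union> A. dist (f w) w < \<delta>" "inj_on f (G \<union> A)" "spread (f ` (G \<union> A))"
    by auto
  have "norm w = 1" "finite (f ` (G \<union> A))" using insert G by auto
  from spread_extend[OF this(2) f(4) this(1) d] obtain x
    where x: "dist x w < \<delta>" "x \<notin> f ` (G \<union> A)" "spread (insert x (f ` (G \<union> A)))" by blast
  define f' where "f' = f(w := x)"
  have wn: "w \<notin> G \<union> A" using insert by auto
  have e: "f' y = f y" if "y \<in> G \<union> A" for y using that wn by (auto simp: f'_def)
  have im: "f' ` (G \<union> A) = f ` (G \<union> A)" using e by (intro image_cong) auto
  have i: "f' ` (G \<union> insert w A) = insert x (f ` (G \<union> A))" using im by (auto simp: f'_def)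
  have "inj_on f' (insert w (G \<union> A))"
    unfolding inj_on_insert using f(3) x(2) im wn by (auto simp: inj_on_def e) (auto simp: f'_def)
  then have "inj_on f' (G \<union> insert w A)" by simp
  moreover have "\<forall>w\<in>G. f' w = w" using f(1) e by auto
  moreover have "\<forall>w\<in>G \<union> insert w A. dist (f' w) w < \<delta>" using f(2) e x(1) by (auto simp: f'_def)
  ultimately show ?case using x(3) i by metis
qed

text \<open>Suppose a plane with normal \<open>a\<close> cuts off \<open>(1 - \<epsilon>) x\<close>.
  The vertex \<open>w\<close> with least \<open>a \<bullet> w\<close> has
  \<open>a \<bullet> w \<le> - \<rho> * norm a\<close>, since the inner ball reaches that far.
  Moving it by less than \<open>\<epsilon> * \<rho>\<close> leaves \<open>a \<bullet> f w\<close> at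
  most \<open>(1 - \<epsilon>) * (a \<bullet> w)\<close>, so \<open>f w\<close> would be cut off
  too.\<close>

lemma scaled_hull_subset:
  fixes W :: "'a::euclidean_space set"
  assumes fin: "finite W" and ne: "W \<noteq> {}" and ball: "cball 0 \<rho> \<subseteq> convex hull W" "\<rho> > 0" and e: "0 < \<epsilon>" "\<epsilon> < 1"
    and f: "\<And>w. w \<in> W \<Longrightarrow> dist (f w) w < \<epsilon> * \<rho>"
  shows "(\<lambda>x. (1 - \<epsilon>) *\<^sub>R x) ` (convex hull W) \<subseteq> convex hull (f ` W)"
proof clarify
  fix x assume x: "x \<in> convex hull W"
  show "(1 - \<epsilon>) *\<^sub>R x \<in> convex hull (f ` W)"
  proof (rule ccontr)
    assume "\<not> ?thesis"
    moreover have "closed (convex hull (f ` W))"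
      by (intro compact_imp_closed finite_imp_compact_convex_hull) (use fin in auto)
    ultimately obtain a b where ab: "a \<bullet> ((1 - \<epsilon>) *\<^sub>R x) < b" "\<forall>k\<in>convex hull (f ` W). b < a \<bullet> k"
      using separating_hyperplane_closed_point[OF convex_convex_hull] by blast
    have a0: "a \<noteq> 0" using ab ne hull_inc[of _ "f ` W" convex] by force
    obtain w where w: "w \<in> W" "\<And>z. z \<in> W \<Longrightarrow> a \<bullet> w \<le> a \<bullet> z"
      using ex_min_if_finite[of "(\<lambda>z. a \<bullet> z) ` W"] fin ne by (metis (no_types, lifting) finite_imageI image_iff image_is_empty linorder_not_le)
    have conv: "a \<bullet> w \<le> a \<bullet> z" if "z \<in> convex hull W" for z
    proof -
      have "convex hull W \<subseteq> {z. a \<bullet> z \<ge> a \<bullet> w}"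
        by (rule hull_minimal) (use w in \<open>auto simp: convex_halfspace_ge\<close>)
      then show ?thesis using that by auto
    qed
    have "- (\<rho> / norm a) *\<^sub>R a \<in> cball 0 \<rho>" using a0 ball(2) by simp
    then have "a \<bullet> w \<le> a \<bullet> (- (\<rho> / norm a) *\<^sub>R a)" using ball(1) conv by blast
    also have "\<dots> = - \<rho> * norm a" using a0 by (simp add: dot_square_norm power2_eq_square)
    finally have 1: "a \<bullet> w \<le> - \<rho> * norm a" .
    have "f w \<in> convex hull (f ` W)" using w(1) by (simp add: hull_inc)
    then have "a \<bullet> ((1 - \<epsilon>) *\<^sub>R x) < a \<bullet> f w" using ab by (meson order.strict_trans)
    moreover have "a \<bullet> f w = a \<bullet> w + a \<bullet> (f w - w)" by (simp add: inner_diff_right)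
    moreover have "a \<bullet> (f w - w) \<le> norm a * (\<epsilon> * \<rho>)"
      using Cauchy_Schwarz_ineq2[of a "f w - w"] mult_left_mono[OF less_imp_le[OF f[OF w(1)]], of "norm a"]
      by (simp add: dist_norm)
    moreover have "(1 - \<epsilon>) * (a \<bullet> w) \<le> a \<bullet> ((1 - \<epsilon>) *\<^sub>R x)"
      using conv[OF x] e by (simp add: mult_left_mono)
    ultimately have "(1 - \<epsilon>) * (a \<bullet> w) < a \<bullet> w + norm a * (\<epsilon> * \<rho>)" by linarith
    then have "0 < \<epsilon> * (a \<bullet> w) + norm a * (\<epsilon> * \<rho>)" by (simp add: left_diff_distrib)
    moreover have "\<epsilon> * (a \<bullet> w) \<le> \<epsilon> * (- \<rho> * norm a)" using 1 e by (intro mult_left_mono) auto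
    moreover have "\<epsilon> * (- \<rho> * norm a) = - (norm a * (\<epsilon> * \<rho>))" by simp
    ultimately show False by linarith
  qed
qed

text \<open>One-sided continuity of volume: the perturbed hull contains the hull shrunk by
  \<open>1 - \<epsilon>\<close>. The shrunk inner ball also keeps the origin interior, the premise
  under which \<open>B\<close> is offered.\<close>

lemma volume_limit:
  fixes W :: "(real^3) set"
  assumes fin: "finite W" and int: "0 \<in> interior (convex hull W)"
    and B: "\<And>\<delta>. \<delta> > 0 \<Longrightarrow> \<exists>f. (\<forall>w\<in>W. dist (f w) w < \<delta>) \<and>
       (0 \<in> interior (convex hull (f ` W)) \<longrightarrow> measure lebesgue (convex hull (f ` W)) \<le> B)"
  shows "measure lebesgue (convex hull W) \<le> B"
proof -
  have ne: "W \<noteq> {}" using int by auto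
  obtain \<rho> where \<rho>: "\<rho> > 0" "cball 0 \<rho> \<subseteq> convex hull W" using int mem_interior_cball by blast
  have le: "(1 - \<epsilon>) ^ 3 * measure lebesgue (convex hull W) \<le> B" if e: "0 < \<epsilon>" "\<epsilon> < 1" for \<epsilon>
  proof -
    have "\<epsilon> * \<rho> > 0" using e \<rho> by simp
    then obtain f where f: "\<forall>w\<in>W. dist (f w) w < \<epsilon> * \<rho>"
       "0 \<in> interior (convex hull (f ` W)) \<longrightarrow> measure lebesgue (convex hull (f ` W)) \<le> B" using B by blast
    have sub: "(\<lambda>x. (1 - \<epsilon>) *\<^sub>R x) ` (convex hull W) \<subseteq> convex hull (f ` W)"
      by (rule scaled_hull_subset[OF fin ne \<rho>(2,1) e]) (use f in auto)
    have "(\<lambda>x. (1 - \<epsilon>) *\<^sub>R x) ` cball 0 \<rho> \<subseteq> convex hull (f ` W)" using sub \<rho>(2) by blast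
    moreover have "ball (0::real^3) ((1 - \<epsilon>) * \<rho>) \<subseteq> (\<lambda>x. (1 - \<epsilon>) *\<^sub>R x) ` cball 0 \<rho>"
    proof
      fix y :: "real^3" assume y: "y \<in> ball 0 ((1 - \<epsilon>) * \<rho>)"
      have "(1 / (1 - \<epsilon>)) *\<^sub>R y \<in> cball 0 \<rho>" using y e by (simp add: field_simps)
      moreover have "y = (1 - \<epsilon>) *\<^sub>R ((1 / (1 - \<epsilon>)) *\<^sub>R y)" using e by simp
      ultimately show "y \<in> (\<lambda>x. (1 - \<epsilon>) *\<^sub>R x) ` cball 0 \<rho>" by blast
    qed
    ultimately have "0 \<in> interior (convex hull (f ` W))"
      unfolding mem_interior using e \<rho> by (intro exI[of _ "(1 - \<epsilon>) * \<rho>"]) auto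
    then have vb: "measure lebesgue (convex hull (f ` W)) \<le> B" using f by blast
    have m: "convex hull W \<in> lmeasurable" "convex hull (f ` W) \<in> lmeasurable"
      by (intro lmeasurable_compact finite_imp_compact_convex_hull; use fin in simp)+
    have "measure lebesgue ((\<lambda>x. (1 - \<epsilon>) *\<^sub>R x) ` (convex hull W)) = (1 - \<epsilon>) ^ 3 * measure lebesgue (convex hull W)"
      using measure_lebesgue_affine[of "1 - \<epsilon>" 0 "convex hull W"] e by (simp add: image_image)
    moreover have "measure lebesgue ((\<lambda>x. (1 - \<epsilon>) *\<^sub>R x) ` (convex hull W)) \<le> measure lebesgue (convex hull (f ` W))"
    proof (rule measure_mono_fmeasurable[OF sub _ m(2)])
      have "compact ((\<lambda>x. (1 - \<epsilon>) *\<^sub>R x) ` (convex hull W))"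
        by (intro compact_scaling finite_imp_compact_convex_hull fin)
      then show "(\<lambda>x. (1 - \<epsilon>) *\<^sub>R x) ` (convex hull W) \<in> sets lebesgue" by (meson fmeasurableD lmeasurable_compact)
    qed
    ultimately show ?thesis using vb by linarith
  qed
  have "((\<lambda>\<epsilon>. (1 - \<epsilon>) ^ 3 * measure lebesgue (convex hull W)) \<longlongrightarrow> (1 - 0) ^ 3 * measure lebesgue (convex hull W)) (at_right (0::real))"
    by (intro tendsto_intros)
  moreover have "eventually (\<lambda>\<epsilon>. (1 - \<epsilon>) ^ 3 * measure lebesgue (convex hull W) \<le> B) (at_right (0::real))"
    unfolding eventually_at_right_field using le by (intro exI[of _ 1]) auto
  ultimately have "(1 - 0) ^ 3 * measure lebesgue (convex hull W) \<le> B"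
    by (rule tendsto_upperbound) simp
  then show ?thesis by simp
qed

theorem inscribed_volume_bound:
  fixes W :: "(real^3) set"
  assumes fin: "finite W" and sph: "W \<subseteq> sphere 0 1" and int: "0 \<in> interior (convex hull W)" and n: "card W \<ge> 3" and s: "1 \<le> s"
  shows "measure lebesgue (convex hull W) \<le> 4 * pi * slope s + (2 * real (card W) - 4) * offset s"
proof (rule volume_limit[OF fin int])
  fix \<delta> :: real assume d: "\<delta> > 0"
  \<comment> \<open>With the empty set as the fixed part, every point may move.\<close>
  have "spread {}" by (simp add: spread_def generic_def)
  from spread_perturb[OF _ this d fin] sph obtain f where
    f: "\<forall>w\<in>W. dist (f w) w < \<delta>" "inj_on f W" "spread (f ` W)" by auto
  have "measure lebesgue (convex hull (f ` W)) \<le> 4 * pi * slope s + (2 * real (card W) - 4) * offset s"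
    if "0 \<in> interior (convex hull (f ` W))"
  proof -
    interpret generic_polytope "f ` W"
      by unfold_locales (use f fin n that in \<open>auto simp: spread_def card_image\<close>)
    show ?thesis using volume_bound[OF s] f(2) by (simp add: card_image)
  qed
  then show "\<exists>f. (\<forall>w\<in>W. dist (f w) w < \<delta>) \<and> (0 \<in> interior (convex hull (f ` W)) \<longrightarrow>
      measure lebesgue (convex hull (f ` W)) \<le> 4 * pi * slope s + (2 * real (card W) - 4) * offset s)"
    using f by blast
qed

text \<open>The perturbation fixes \<open>a\<close>, \<open>b\<close>, \<open>c\<close>, so
  \<open>det3 a b c\<close> and the solid angle in the bound do not change with it.\<close>

theorem inscribed_volume_bound_face:
  fixes W :: "(real^3) set"
  assumes fin: "finite W" and sph: "W \<subseteq> sphere 0 1" and int: "0 \<in> interior (convex hull W)" and s: "1 \<le> s"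
    and abc: "{a,b,c} \<subseteq> W" and D: "det3 a b c > 0"
    and u: "u \<bullet> a = 1" "u \<bullet> b = 1" "u \<bullet> c = 1" "\<And>w. w \<in> W - {a,b,c} \<Longrightarrow> u \<bullet> w < 1"
  shows "measure lebesgue (convex hull W) \<le> 4 * pi * slope s + (2 * real (card W) - 5) * offset s
    + det3 a b c / 6 - slope s * (2 * carg (1 + b \<bullet> c + c \<bullet> a + a \<bullet> b) (det3 a b c))" (is "_ \<le> ?B")
proof (rule volume_limit[OF fin int])
  fix \<delta> :: real assume d: "\<delta> > 0"
  have ne: "a \<noteq> b" "b \<noteq> c" "a \<noteq> c" using D by (auto simp: det3_same)
  have sp: "spread {a,b,c}"
  proof -
    have p: "det3 b c a > 0" "det3 c a b > 0" "det3 b a c < 0" "det3 a c b < 0" "det3 c b a < 0"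
      using D by (simp_all add: det3_perm(1)[of b c a] det3_perm(2)[of c a b] det3_perm(3)[of b a c]
        det3_perm(4)[of a c b] det3_perm(5)[of c b a])
    have "cross3 b c \<noteq> 0" "cross3 c a \<noteq> 0" "cross3 a b \<noteq> 0" "cross3 c b \<noteq> 0" "cross3 a c \<noteq> 0" "cross3 b a \<noteq> 0"
      using D p by (auto simp: det3_def)
    moreover have "generic {a,b,c}" unfolding generic_def using D p by (auto simp: less_imp_neq)
    ultimately show ?thesis unfolding spread_def using abc sph by auto
  qed
  \<comment> \<open>So small that points strictly below the plane \<open>u = 1\<close> stay below
    it. Adding 1 to \<open>norm u\<close> keeps the divisor positive.\<close>
  define \<eta> where "\<eta> = Min (insert \<delta> ((\<lambda>w. (1 - u \<bullet> w) / (norm u + 1)) ` (W - {a,b,c})))"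
  have fin': "finite (insert \<delta> ((\<lambda>w. (1 - u \<bullet> w) / (norm u + 1)) ` (W - {a,b,c})))" using fin by simp
  have np: "norm u + 1 > 0" using norm_ge_zero[of u] by linarith
  have \<eta>: "\<eta> > 0" "\<eta> \<le> \<delta>" "\<And>w. w \<in> W - {a,b,c} \<Longrightarrow> \<eta> \<le> (1 - u \<bullet> w) / (norm u + 1)"
    unfolding \<eta>_def using fin' d u(4) np by (auto simp: Min_gr_iff intro!: divide_pos_pos)
  have A: "finite (W - {a,b,c})" "(W - {a,b,c}) \<inter> {a,b,c} = {}" "W - {a,b,c} \<subseteq> sphere 0 1"
    using fin sph by auto
  obtain f where f: "\<forall>w\<in>{a,b,c}. f w = w" "\<forall>w\<in>{a,b,c} \<union> (W - {a,b,c}). dist (f w) w < \<eta>"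
     "inj_on f ({a,b,c} \<union> (W - {a,b,c}))" "spread (f ` ({a,b,c} \<union> (W - {a,b,c})))"
    using spread_perturb[OF _ sp \<eta>(1) _ A(2,3)] fin by (metis A(1) finite.emptyI finite_insert)
  have W: "{a,b,c} \<union> (W - {a,b,c}) = W" using abc by auto
  note f = f[unfolded W]
  have face: "{a,b,c} \<in> gfaces (f ` W)"
  proof -
    have "f ` {a,b,c} = {a,b,c}" using f(1) by simp
    then have "{a,b,c} \<subseteq> f ` W" using image_mono[OF abc, of f] by simp
    moreover have "card {a,b,c} = 3" using ne by simp
    moreover have "u \<bullet> z < 1" if z: "z \<in> f ` W - {a,b,c}" for z
    proof -
      obtain w where w: "w \<in> W" "z = f w" using z by blast
      then have wn: "w \<in> W - {a,b,c}" using z f(1) by auto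
      have "u \<bullet> f w = u \<bullet> w + u \<bullet> (f w - w)" by (simp add: inner_diff_right)
      also have "u \<bullet> (f w - w) \<le> norm u * norm (f w - w)" by (rule norm_cauchy_schwarz)
      also have "\<dots> \<le> norm u * \<eta>" using f(2) w by (intro mult_left_mono) (auto simp: dist_norm intro: less_imp_le)
      also have "\<dots> < (norm u + 1) * \<eta>" using \<eta>(1) by (simp add: algebra_simps)
      also have "\<dots> \<le> 1 - u \<bullet> w" using \<eta>(3)[OF wn] np by (simp add: field_simps)
      finally show ?thesis using w by simp
    qed
    ultimately show ?thesis using u(1-3) unfolding gfaces_def by auto
  qed
  have "measure lebesgue (convex hull (f ` W)) \<le> ?B" if "0 \<in> interior (convex hull (f ` W))"
  proof -
    have "card {a,b,c} \<le> card W" by (rule card_mono[OF fin abc])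
    then have "card W \<ge> 3" using ne by simp
    then interpret generic_polytope "f ` W"
      by unfold_locales (use f fin that in \<open>auto simp: spread_def card_image\<close>)
    show ?thesis using volume_bound_face[OF s face D] f(3) by (simp add: card_image)
  qed
  then show "\<exists>f. (\<forall>w\<in>W. dist (f w) w < \<delta>) \<and> (0 \<in> interior (convex hull (f ` W)) \<longrightarrow>
      measure lebesgue (convex hull (f ` W)) \<le> ?B)"
    using f(2) \<eta>(2) by (meson order_less_le_trans)
qed

section \<open>Trivalent vertices\<close>

lemma sphere_extreme:
  fixes x :: "'a::euclidean_space"
  assumes "norm x = 1" "S \<subseteq> cball 0 1" "x \<in> S"
  shows "x extreme_point_of S"
  unfolding extreme_point_of_def
proof (intro conjI ballI notI)
  fix a b assume ab: "a \<in> S" "b \<in> S" "x \<in> open_segment a b"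
  then have "dist 0 x < dist 0 a \<or> dist 0 x < dist 0 b"
    using dist_decreases_open_segment[OF ab(3), of 0] by (simp add: dist_commute)
  moreover have "norm a \<le> 1" "norm b \<le> 1" using ab assms(2) by auto
  ultimately show False using assms(1) by auto
qed (rule assms(3))

text \<open>By strict convexity of the ball all chosen points are extreme, so the vertex count of a
  competitor is the number of points chosen.\<close>

lemma vertices_sphere_hull:
  fixes W :: "'a::euclidean_space set"
  assumes "W \<subseteq> sphere 0 1"
  shows "vertices (convex hull W) = W"
proof -
  have sub: "convex hull W \<subseteq> cball 0 1"
    by (rule hull_minimal) (use assms in auto)
  show ?thesis
  proof
    show "vertices (convex hull W) \<subseteq> W" unfolding vertices_def using extreme_points_of_convex_hull by blast
    show "W \<subseteq> vertices (convex hull W)"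
    proof
      fix w assume "w \<in> W"
      then have "norm w = 1" "w \<in> convex hull W" using assms by (auto simp: hull_inc)
      then show "w \<in> vertices (convex hull W)" unfolding vertices_def using sphere_extreme[OF _ sub] by simp
    qed
  qed
qed

lemma sphere_in_hull:
  assumes "S \<subseteq> sphere 0 1" "norm w = 1" "w \<in> convex hull S" shows "w \<in> (S :: 'a::euclidean_space set)"
proof -
  have "convex hull S \<subseteq> cball 0 1" by (rule hull_minimal) (use assms in auto)
  then show ?thesis using sphere_extreme[OF assms(2) _ assms(3)] extreme_point_of_convex_hull by blast
qed

definition ncone :: "'a::real_vector \<Rightarrow> 'a set \<Rightarrow> 'a set" where
  "ncone v S = {x. \<exists>c. (\<forall>s\<in>S. c s \<ge> 0) \<and> x = v + (\<Sum>s\<in>S. c s *\<^sub>R (s - v))}"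

lemma convex_ncone: "convex (ncone v S)"
proof (rule convexI)
  fix x y and p q :: real assume x: "x \<in> ncone v S" and y: "y \<in> ncone v S" and pq: "0 \<le> p" "0 \<le> q" "p + q = 1"
  obtain c where c: "\<forall>s\<in>S. c s \<ge> 0" "x = v + (\<Sum>s\<in>S. c s *\<^sub>R (s - v))" using x unfolding ncone_def by blast
  obtain d where d: "\<forall>s\<in>S. d s \<ge> 0" "y = v + (\<Sum>s\<in>S. d s *\<^sub>R (s - v))" using y unfolding ncone_def by blast
  have "p *\<^sub>R x + q *\<^sub>R y = (p + q) *\<^sub>R v + (\<Sum>s\<in>S. (p * c s + q * d s) *\<^sub>R (s - v))"
    unfolding c(2) d(2) by (simp add: scaleR_add_right scaleR_add_left scaleR_sum_right sum.distrib)
  then show "p *\<^sub>R x + q *\<^sub>R y \<in> ncone v S"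
    unfolding ncone_def using c(1) d(1) pq by (intro CollectI exI[of _ "\<lambda>s. p * c s + q * d s"]) auto
qed

text \<open>The segments from \<open>v\<close> to a minimal generating set of the cone of \<open>W\<close> at \<open>v\<close> are edges.\<close>
lemma edges_generate:
  fixes W :: "'a::euclidean_space set"
  assumes fin: "finite W" and sph: "W \<subseteq> sphere 0 1" and v: "v \<in> W"
  obtains S where "S \<subseteq> W - {v}" "W \<subseteq> ncone v S" "\<And>s. s \<in> S \<Longrightarrow> closed_segment v s edge_of (convex hull W)"
proof -
  let ?P = "\<lambda>S. S \<subseteq> W - {v} \<and> W \<subseteq> ncone v S"
  have "?P (W - {v})"
  proof (intro conjI subsetI)
    fix w assume w: "w \<in> W"
    show "w \<in> ncone v (W - {v})"
    proof (cases "w = v")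
      case True then show ?thesis unfolding ncone_def by (intro CollectI exI[of _ "\<lambda>_. 0"]) auto
    next
      case False
      have "(\<Sum>s\<in>W-{v}. (if s = w then 1 else 0) *\<^sub>R (s - v)) = (\<Sum>s\<in>W-{v}. if s = w then s - v else 0)"
        by (rule sum.cong) auto
      also have "\<dots> = w - v" using fin w False by simp
      finally show ?thesis unfolding ncone_def
        by (intro CollectI exI[of _ "\<lambda>s. if s = w then 1 else 0"]) auto
    qed
  qed auto
  from ex_has_least_nat[of ?P, OF this, of card] obtain S
    where S: "S \<subseteq> W - {v}" "W \<subseteq> ncone v S" and min: "\<And>T. T \<subseteq> W - {v} \<Longrightarrow> W \<subseteq> ncone v T \<Longrightarrow> card S \<le> card T"
    by auto
  have finS: "finite S" using S(1) fin finite_subset by blast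
  have vn: "norm v = 1" using v sph by auto
  have hullS: "convex hull W \<subseteq> ncone v S" by (rule hull_minimal) (use S(2) convex_ncone in auto)
  have hullb: "convex hull W \<subseteq> cball 0 1" by (rule hull_minimal) (use sph in auto)
  \<comment> \<open>The cone is pointed: every other point of the sphere lies strictly below the
    tangent plane at \<open>v\<close>.\<close>
  have pos: "(- v) \<bullet> (s - v) > 0" if "s \<in> S" for s
  proof -
    have sn: "norm s = 1" "s \<noteq> v" using that S(1) sph by auto
    have "v \<bullet> s \<noteq> 1"
    proof
      assume "v \<bullet> s = 1"
      then have "(v - s) \<bullet> (v - s) = 0" using sn vn by (simp add: inner_diff inner_commute norm_eq_1)
      then show False using sn(2) by simp
    qed
    moreover have "v \<bullet> s \<le> 1" using norm_cauchy_schwarz[of v s] sn vn by simp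
    ultimately show ?thesis using vn by (simp add: inner_diff_right norm_eq_1)
  qed
  have notin: "s \<notin> ncone v (S - {s})" if s: "s \<in> S" for s
  proof
    assume "s \<in> ncone v (S - {s})"
    then obtain d where d: "\<forall>t\<in>S-{s}. d t \<ge> 0" "s - v = (\<Sum>t\<in>S-{s}. d t *\<^sub>R (t - v))"
      unfolding ncone_def by (auto simp: algebra_simps)
    have "W \<subseteq> ncone v (S - {s})"
    proof
      fix w assume "w \<in> W"
      then obtain c where c: "\<forall>t\<in>S. c t \<ge> 0" "w = v + (\<Sum>t\<in>S. c t *\<^sub>R (t - v))" using S(2) unfolding ncone_def by blast
      have "w = v + (c s *\<^sub>R (s - v) + (\<Sum>t\<in>S-{s}. c t *\<^sub>R (t - v)))"
        unfolding c(2) using sum.remove[OF finS s, of "\<lambda>t. c t *\<^sub>R (t - v)"] by simp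
      also have "\<dots> = v + (\<Sum>t\<in>S-{s}. (c s * d t + c t) *\<^sub>R (t - v))"
        unfolding d(2) by (simp add: scaleR_sum_right scaleR_add_left sum.distrib)
      finally show "w \<in> ncone v (S - {s})"
        unfolding ncone_def using c(1) d(1) s by (intro CollectI exI[of _ "\<lambda>t. c s * d t + c t"]) auto
    qed
    then have "card S \<le> card (S - {s})" using min S(1) by blast
    then show False using finS s by (metis card_Diff1_less linorder_not_le)
  qed
  have "closed_segment v s edge_of (convex hull W)" if s: "s \<in> S" for s
  proof -
    have sn: "norm s = 1" "s \<noteq> v" "s \<in> W" using s S(1) sph by auto
    have vs: "v \<bullet> s < 1" using pos[OF s] vn by (simp add: inner_diff_right norm_eq_1)
    \<comment> \<open>The ray from \<open>v\<close> through \<open>s\<close> leaves the unit ball at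
      \<open>s\<close>, so the hull contains no more of it than the segment.\<close>
    have ray: "x \<in> closed_segment v s" if x: "x \<in> convex hull W" "x = v + k *\<^sub>R (s - v)" "k \<ge> 0" for x k
    proof -
      have "x \<bullet> x \<le> 1" using x(1) hullb by (auto simp: norm_le_square)
      moreover have "x \<bullet> x = 1 - 2 * (k * (1 - k)) * (1 - v \<bullet> s)"
        unfolding x(2) using vn sn(1) by (simp add: inner_add inner_diff inner_commute norm_eq_1 algebra_simps)
      ultimately have "k * (1 - k) * (1 - v \<bullet> s) \<ge> 0" by simp
      then have "k * (1 - k) \<ge> 0" using vs by (simp add: zero_le_mult_iff)
      then have "k \<le> 1" using x(3) by (cases "k = 0") (auto simp: zero_le_mult_iff)
      then show ?thesis unfolding closed_segment_def x(2) using x(3)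
        by (intro CollectI exI[of _ k]) (auto simp: algebra_simps)
    qed
    have "closed_segment v s face_of (convex hull W)"
      unfolding face_of_def
    proof (intro conjI ballI impI)
      show "closed_segment v s \<subseteq> convex hull W"
        using v sn(3) by (simp add: closed_segment_subset hull_inc)
      show "convex (closed_segment v s)" by (rule convex_closed_segment)
      fix x y z assume xy: "x \<in> convex hull W" "y \<in> convex hull W" and zF: "z \<in> closed_segment v s" and z: "z \<in> open_segment x y"
      obtain \<alpha> where \<alpha>: "\<forall>t\<in>S. \<alpha> t \<ge> 0" "x = v + (\<Sum>t\<in>S. \<alpha> t *\<^sub>R (t - v))" using xy(1) hullS unfolding ncone_def by blast
      obtain \<beta> where \<beta>: "\<forall>t\<in>S. \<beta> t \<ge> 0" "y = v + (\<Sum>t\<in>S. \<beta> t *\<^sub>R (t - v))" using xy(2) hullS unfolding ncone_def by blast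
      obtain \<tau> where \<tau>: "0 < \<tau>" "\<tau> < 1" "z = (1 - \<tau>) *\<^sub>R x + \<tau> *\<^sub>R y" using z by (auto simp: in_segment)
      obtain k where k: "0 \<le> k" "k \<le> 1" "z = (1 - k) *\<^sub>R v + k *\<^sub>R s" using zF by (auto simp: in_segment)
      define \<nu> where "\<nu> t = (1 - \<tau>) * \<alpha> t + \<tau> * \<beta> t" for t
      have \<nu>0: "\<nu> t \<ge> 0" if "t \<in> S" for t using that \<alpha>(1) \<beta>(1) \<tau> by (simp add: \<nu>_def)
      have zv: "z = v + (\<Sum>t\<in>S. \<nu> t *\<^sub>R (t - v))"
      proof -
        have "z = ((1 - \<tau>) + \<tau>) *\<^sub>R v + ((1 - \<tau>) *\<^sub>R (\<Sum>t\<in>S. \<alpha> t *\<^sub>R (t - v)) + \<tau> *\<^sub>R (\<Sum>t\<in>S. \<beta> t *\<^sub>R (t - v)))"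
          unfolding \<tau>(3) \<alpha>(2) \<beta>(2) by (simp only: scaleR_add_right scaleR_add_left add_ac)
        also have "(1 - \<tau>) *\<^sub>R (\<Sum>t\<in>S. \<alpha> t *\<^sub>R (t - v)) + \<tau> *\<^sub>R (\<Sum>t\<in>S. \<beta> t *\<^sub>R (t - v)) = (\<Sum>t\<in>S. \<nu> t *\<^sub>R (t - v))"
          unfolding \<nu>_def by (simp add: scaleR_sum_right scaleR_add_left sum.distrib)
        finally show ?thesis by simp
      qed
      have rem: "(\<Sum>t\<in>S. \<nu> t *\<^sub>R (t - v)) = \<nu> s *\<^sub>R (s - v) + (\<Sum>t\<in>S-{s}. \<nu> t *\<^sub>R (t - v))"
        by (rule sum.remove[OF finS s])
      have eq: "(\<Sum>t\<in>S-{s}. \<nu> t *\<^sub>R (t - v)) = (k - \<nu> s) *\<^sub>R (s - v)"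
      proof -
        have "z - v = k *\<^sub>R (s - v)" unfolding k(3) by (simp add: algebra_simps)
        then have "k *\<^sub>R (s - v) = \<nu> s *\<^sub>R (s - v) + (\<Sum>t\<in>S-{s}. \<nu> t *\<^sub>R (t - v))"
          using zv rem by (metis add_diff_cancel_left')
        then show ?thesis by (simp add: scaleR_diff_left)
      qed
      \<comment> \<open>If \<open>\<nu> s < k\<close>, then \<open>s\<close> would be generated by
        the other points; otherwise the functional \<open>- v\<close>, positive on all generators,
        forces the coefficients to vanish.\<close>
      have z0: "\<nu> t = 0" if t: "t \<in> S - {s}" for t
      proof (cases "\<nu> s < k")
        case True
        have "s = v + (1 / (k - \<nu> s)) *\<^sub>R ((k - \<nu> s) *\<^sub>R (s - v))" using True by simp
        also have "\<dots> = v + (\<Sum>t\<in>S-{s}. (\<nu> t / (k - \<nu> s)) *\<^sub>R (t - v))"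
          unfolding eq[symmetric] by (simp add: scaleR_sum_right)
        finally have "s \<in> ncone v (S - {s})"
          unfolding ncone_def using True \<nu>0 by (intro CollectI exI[of _ "\<lambda>t. \<nu> t / (k - \<nu> s)"]) auto
        then show ?thesis using notin[OF s] by simp
      next
        case False
        have "(\<Sum>t\<in>S-{s}. \<nu> t * ((- v) \<bullet> (t - v))) = (k - \<nu> s) * ((- v) \<bullet> (s - v))"
          using arg_cong[OF eq, of "\<lambda>x. (- v) \<bullet> x"] by (simp add: inner_sum_right)
        also have "\<dots> \<le> 0" using False pos[OF s] by (intro mult_nonpos_nonneg) auto
        finally have le: "(\<Sum>t\<in>S-{s}. \<nu> t * ((- v) \<bullet> (t - v))) \<le> 0" .
        have nn: "\<nu> t * ((- v) \<bullet> (t - v)) \<ge> 0" if "t \<in> S - {s}" for t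
          using \<nu>0 pos[of t] that by (intro mult_nonneg_nonneg) auto
        have "(\<Sum>t\<in>S-{s}. \<nu> t * ((- v) \<bullet> (t - v))) = 0" using le nn by (meson order_antisym sum_nonneg)
        then have "\<forall>t\<in>S-{s}. \<nu> t * ((- v) \<bullet> (t - v)) = 0"
          by (subst (asm) sum_nonneg_eq_0_iff) (use finS nn in auto)
        then have "\<nu> t * ((- v) \<bullet> (t - v)) = 0" using t by blast
        then show ?thesis using pos[of t] t by auto
      qed
      have zz: "\<alpha> t = 0 \<and> \<beta> t = 0" if t: "t \<in> S - {s}" for t
      proof -
        have "(1 - \<tau>) * \<alpha> t \<ge> 0" "\<tau> * \<beta> t \<ge> 0" using t \<alpha>(1) \<beta>(1) \<tau> by auto
        moreover have "(1 - \<tau>) * \<alpha> t + \<tau> * \<beta> t = 0" using z0[OF t] by (simp add: \<nu>_def)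
        ultimately have "(1 - \<tau>) * \<alpha> t = 0" "\<tau> * \<beta> t = 0" by linarith+
        then show ?thesis using \<tau> by simp
      qed
      have "x = v + \<alpha> s *\<^sub>R (s - v)" "y = v + \<beta> s *\<^sub>R (s - v)"
        unfolding \<alpha>(2) \<beta>(2) sum.remove[OF finS s] using zz by simp_all
      then show "x \<in> closed_segment v s" "y \<in> closed_segment v s" using ray xy \<alpha>(1) \<beta>(1) s by blast+
    qed
    moreover have "aff_dim (closed_segment v s) = 1"
      using sn(2) by (simp add: segment_convex_hull aff_dim_convex_hull aff_dim_2)
    ultimately show ?thesis by (simp add: edge_of_def)
  qed
  then show thesis using that S by blast
qed

lemma det3_eq_0_normal:
  assumes "det3 p q r = 0" shows "\<exists>u. u \<noteq> 0 \<and> u \<bullet> p = 0 \<and> u \<bullet> q = 0 \<and> u \<bullet> r = 0"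
proof -
  have "det (vector [p,q,r] :: real^3^3) = 0" using assms by (simp add: det3_def dot_cross_det)
  then obtain x where x: "x \<noteq> 0" "(vector [p,q,r] :: real^3^3) *v x = 0"
    using invertible_det_nz invertible_left_inverse matrix_left_invertible_ker by metis
  have "p \<bullet> x = 0" "q \<bullet> x = 0" "r \<bullet> x = 0"
    using x(2) by (simp_all add: vec3_eq matrix_vector_mul_component)
  then show ?thesis using x(1) by (auto simp: inner_commute)
qed

definition tcone :: "real^3 \<Rightarrow> real^3 \<Rightarrow> real^3 \<Rightarrow> real^3 \<Rightarrow> (real^3) set" where
  "tcone v a b c = {x. \<exists>\<alpha> \<beta> \<gamma>. \<alpha> \<ge> 0 \<and> \<beta> \<ge> 0 \<and> \<gamma> \<ge> 0 \<and>
     x = v + \<alpha> *\<^sub>R (a - v) + \<beta> *\<^sub>R (b - v) + \<gamma> *\<^sub>R (c - v)}"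

lemma tcone_swap: "tcone v a b c \<subseteq> tcone v b a c"
proof
  fix x assume "x \<in> tcone v a b c"
  then obtain \<alpha> \<beta> \<gamma> where "\<alpha> \<ge> 0" "\<beta> \<ge> 0" "\<gamma> \<ge> 0" "x = v + \<alpha> *\<^sub>R (a - v) + \<beta> *\<^sub>R (b - v) + \<gamma> *\<^sub>R (c - v)"
    unfolding tcone_def by blast
  then show "x \<in> tcone v b a c" unfolding tcone_def
    by (intro CollectI exI[of _ \<beta>] exI[of _ \<alpha>] exI[of _ \<gamma>]) (auto simp: add_ac)
qed

text \<open>Distinct generators give distinct edges at \<open>v\<close>, so there are at most three.
  Positive volume keeps their directions from lying in a plane, so there are three and the
  determinant is nonzero; exchanging \<open>a\<close> and \<open>b\<close> adjusts its sign.\<close>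

lemma trivalent_cone:
  fixes W :: "(real^3) set"
  assumes fin: "finite W" and sph: "W \<subseteq> sphere 0 1" and v: "v \<in> W"
    and deg: "vertex_degree (convex hull W) v = 3" and vol: "measure lebesgue (convex hull W) > 0"
  shows "\<exists>a b c. {a,b,c} \<subseteq> W - {v} \<and> det3 (a - v) (b - v) (c - v) < 0 \<and> convex hull W \<subseteq> tcone v a b c"
proof -
  obtain S where S: "S \<subseteq> W - {v}" "W \<subseteq> ncone v S" and edge: "\<And>s. s \<in> S \<Longrightarrow> closed_segment v s edge_of (convex hull W)"
    using edges_generate[OF fin sph v] by blast
  have finS: "finite S" using S(1) fin finite_subset by blast
  have hullS: "convex hull W \<subseteq> ncone v S" by (rule hull_minimal) (use S(2) convex_ncone in auto)
  have "card S \<le> 3"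
  proof -
    have "inj_on (closed_segment v) S" by (auto simp: inj_on_def closed_segment_eq doubleton_eq_iff)
    moreover have "closed_segment v ` S \<subseteq> {e. e edge_of (convex hull W) \<and> v \<in> e}" using edge by auto
    \<comment> \<open>An infinite set has \<open>card\<close> 0, so degree 3 already makes the set
      of edges finite.\<close>
    moreover have "finite {e. e edge_of (convex hull W) \<and> v \<in> e}"
      using deg unfolding vertex_degree_def by (metis card.infinite zero_neq_numeral)
    ultimately have "card S \<le> card {e. e edge_of (convex hull W) \<and> v \<in> e}" by (rule card_inj_on_le)
    then show ?thesis using deg by (simp add: vertex_degree_def)
  qed
  have nodeg: "\<not> (u \<noteq> 0 \<and> (\<forall>s\<in>S. u \<bullet> (s - v) = 0))" for u
  proof
    assume u: "u \<noteq> 0 \<and> (\<forall>s\<in>S. u \<bullet> (s - v) = 0)"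
    have "convex hull W \<subseteq> {x. u \<bullet> x = u \<bullet> v}"
      using hullS u unfolding ncone_def by (auto simp: inner_add_right inner_sum_right)
    then have "negligible (convex hull W)" using negligible_subset[OF negligible_hyperplane] u by blast
    then show False using vol by (simp add: negligible_imp_measure0)
  qed
  have "S \<noteq> {}" using nodeg[of v] v sph by auto
  \<comment> \<open>Repetitions are still allowed here; the determinant excludes them
    afterwards.\<close>
  have "\<exists>a b c. S = {a,b,c}"
  proof -
    have "card S \<noteq> 0" using \<open>S \<noteq> {}\<close> finS by simp
    then have "card S = 1 \<or> card S = 2 \<or> card S = 3" using \<open>card S \<le> 3\<close> by linarith
    then show ?thesis by (auto simp: card_1_singleton_iff card_2_iff card_3_iff)
  qed
  then obtain a b c where abc: "S = {a,b,c}" by blast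
  have D: "det3 (a - v) (b - v) (c - v) \<noteq> 0"
    using det3_eq_0_normal[of "a - v" "b - v" "c - v"] nodeg abc by auto
  then have ne: "a \<noteq> b" "b \<noteq> c" "a \<noteq> c" by (auto simp: det3_same)
  have abcW: "{a,b,c} \<subseteq> W - {v}" using S(1) abc by simp
  have cone: "convex hull W \<subseteq> tcone v a b c"
  proof
    fix x assume "x \<in> convex hull W"
    then obtain k where "\<forall>s\<in>{a,b,c}. k s \<ge> 0" "x = v + (\<Sum>s\<in>{a,b,c}. k s *\<^sub>R (s - v))"
      using hullS unfolding abc ncone_def by blast
    then show "x \<in> tcone v a b c" unfolding tcone_def
      unfolding sum3[OF ne] by (intro CollectI exI[of _ "k a"] exI[of _ "k b"] exI[of _ "k c"]) (auto simp: add.assoc)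
  qed
  show ?thesis
  proof (cases "det3 (a - v) (b - v) (c - v) < 0")
    case True
    then show ?thesis using abcW cone by (intro exI[of _ a] exI[of _ b] exI[of _ c] conjI)
  next
    case False
    then have "det3 (b - v) (a - v) (c - v) < 0" using D det3_perm(3)[of "b - v" "a - v" "c - v"] by simp
    moreover have "{b,a,c} \<subseteq> W - {v}" using abcW by blast
    moreover have "convex hull W \<subseteq> tcone v b a c" using cone tcone_swap by (rule subset_trans)
    ultimately show ?thesis by (intro exI[of _ b] exI[of _ a] exI[of _ c] conjI)
  qed
qed

section \<open>Gluing tetrahedra onto convex hulls\<close>

lemma measure_glue:
  fixes A B C :: "'a::euclidean_space set"
  assumes m: "A \<in> lmeasurable" "B \<in> lmeasurable" "C \<in> lmeasurable" and sub: "A \<subseteq> C" "B \<subseteq> C"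
    and n: "n \<noteq> 0" "A \<subseteq> {x. n \<bullet> x \<le> k}" "B \<subseteq> {x. n \<bullet> x \<ge> k}"
  shows "measure lebesgue A + measure lebesgue B \<le> measure lebesgue C"
proof -
  have "A \<inter> B \<subseteq> {x. n \<bullet> x = k}" using n by force
  then have "negligible (A \<inter> B)" using negligible_subset[OF negligible_hyperplane] n(1) by blast
  then have "measure lebesgue (A \<union> B) = measure lebesgue A + measure lebesgue B"
    using measure_Un3[OF m(1,2)] by (simp add: negligible_imp_measure0)
  moreover have "measure lebesgue (A \<union> B) \<le> measure lebesgue C"
    by (rule measure_mono_fmeasurable) (use m sub in \<open>auto simp: fmeasurableD\<close>)
  ultimately show ?thesis by linarith
qed

lemma hull_lmeasurable: "finite S \<Longrightarrow> convex hull S \<in> lmeasurable" for S :: "'a::euclidean_space set"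
  by (intro lmeasurable_compact finite_imp_compact_convex_hull)

lemma hull_le: "S \<subseteq> {x. n \<bullet> x \<le> k} \<Longrightarrow> convex hull S \<subseteq> {x. n \<bullet> x \<le> (k::real)}"
  by (rule hull_minimal) (auto simp: convex_halfspace_le)

lemma hull_ge: "S \<subseteq> {x. n \<bullet> x \<ge> k} \<Longrightarrow> convex hull S \<subseteq> {x. n \<bullet> x \<ge> (k::real)}"
  by (rule hull_minimal) (auto simp: convex_halfspace_ge)

lemma tnormal_side: "tnormal a b c \<bullet> x = det3 a b c - det3 (a - x) (b - x) (c - x)"
  using tnormal_inner(4)[of a x b c] by simp

text \<open>The sign of \<open>det3 (a - x) (b - x) (c - x)\<close> tells the side of the plane
  \<open>abc\<close> on which \<open>x\<close> lies. \<open>S\<close> and \<open>v\<close> are on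
  different sides, so the two hulls overlap in a null set.\<close>

lemma glue_tetrahedron:
  assumes fin: "finite S" and abc: "a \<in> S" "b \<in> S" "c \<in> S"
    and S: "\<And>x. x \<in> S \<Longrightarrow> det3 (a - x) (b - x) (c - x) \<ge> 0" and v: "det3 (a - v) (b - v) (c - v) < 0"
  shows "measure lebesgue (convex hull S) + measure lebesgue (convex hull {v,a,b,c})
     \<le> measure lebesgue (convex hull (insert v S))"
proof (rule measure_glue)
  show "tnormal a b c \<noteq> 0"
    using v tnormal_side[of a b c v] tnormal_inner(1)[of a b c] by auto
  show "convex hull S \<subseteq> {x. tnormal a b c \<bullet> x \<le> det3 a b c}"
    by (rule hull_le) (use S in \<open>auto simp: tnormal_side\<close>)
  show "convex hull {v,a,b,c} \<subseteq> {x. tnormal a b c \<bullet> x \<ge> det3 a b c}"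
    by (rule hull_ge) (use v in \<open>auto simp: tnormal_side det3_linear\<close>)
  show "convex hull S \<subseteq> convex hull (insert v S)" "convex hull {v,a,b,c} \<subseteq> convex hull (insert v S)"
    using abc by (auto intro!: hull_mono)
qed (use fin in \<open>auto intro!: hull_lmeasurable\<close>)

text \<open>A cap over a quadrilateral facet \<open>abcd\<close>: the apex adds two tetrahedra,
  separated from each other by the plane through \<open>a\<close>, \<open>c\<close>,
  \<open>v\<close> and from \<open>S\<close> by the plane of the facet.\<close>

lemma glue_pyramid:
  assumes fin: "finite S" and abc: "a \<in> S" "b \<in> S" "c \<in> S" "d \<in> S"
    and S: "\<And>x. x \<in> S \<Longrightarrow> det3 (a - x) (b - x) (c - x) \<ge> 0" and d: "det3 (a - d) (b - d) (c - d) = 0"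
    and v: "det3 (a - v) (b - v) (c - v) < 0" "det3 (a - v) (c - v) (d - v) < 0"
  shows "measure lebesgue (convex hull S) + (measure lebesgue (convex hull {v,a,b,c}) + measure lebesgue (convex hull {v,a,c,d}))
     \<le> measure lebesgue (convex hull (insert v S))"
proof -
  let ?T1 = "convex hull {v,a,b,c}" and ?T2 = "convex hull {v,a,c,d}"
  have m: "?T1 \<in> lmeasurable" "?T2 \<in> lmeasurable" by (auto intro!: hull_lmeasurable)
  have n2: "det3 (a - b) (c - b) (v - b) = det3 (a - v) (b - v) (c - v)"
    "det3 (a - d) (c - d) (v - d) = - det3 (a - v) (c - v) (d - v)"
    by (simp_all add: det3_expand algebra_simps)
  have "measure lebesgue ?T2 + measure lebesgue ?T1 \<le> measure lebesgue (?T1 \<union> ?T2)"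
  proof (rule measure_glue)
    show "tnormal a c v \<noteq> 0"
      using v n2 tnormal_side[of a c v b] tnormal_inner(1)[of a c v] by auto
    show "?T2 \<subseteq> {x. tnormal a c v \<bullet> x \<le> det3 a c v}"
      by (rule hull_le) (use v n2 in \<open>auto simp: tnormal_side det3_linear\<close>)
    show "?T1 \<subseteq> {x. tnormal a c v \<bullet> x \<ge> det3 a c v}"
      by (rule hull_ge) (use v n2 in \<open>auto simp: tnormal_side det3_linear\<close>)
  qed (use m in auto)
  moreover have "measure lebesgue (convex hull S) + measure lebesgue (?T1 \<union> ?T2) \<le> measure lebesgue (convex hull (insert v S))"
  proof (rule measure_glue)
    show "tnormal a b c \<noteq> 0"
      using v tnormal_side[of a b c v] tnormal_inner(1)[of a b c] by auto
    show "convex hull S \<subseteq> {x. tnormal a b c \<bullet> x \<le> det3 a b c}"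
      by (rule hull_le) (use S in \<open>auto simp: tnormal_side\<close>)
    have "?T1 \<subseteq> {x. tnormal a b c \<bullet> x \<ge> det3 a b c}"
      by (rule hull_ge) (use v in \<open>auto simp: tnormal_side det3_linear\<close>)
    moreover have "?T2 \<subseteq> {x. tnormal a b c \<bullet> x \<ge> det3 a b c}"
      by (rule hull_ge) (use v d in \<open>auto simp: tnormal_side det3_linear\<close>)
    ultimately show "?T1 \<union> ?T2 \<subseteq> {x. tnormal a b c \<bullet> x \<ge> det3 a b c}" by blast
    have "?T1 \<subseteq> convex hull (insert v S)" "?T2 \<subseteq> convex hull (insert v S)"
      by (rule hull_mono; use abc in auto)+
    then show "?T1 \<union> ?T2 \<subseteq> convex hull (insert v S)" by blast
    show "convex hull S \<subseteq> convex hull (insert v S)" by (rule hull_mono) auto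
  qed (use fin m in \<open>auto intro!: hull_lmeasurable\<close>)
  ultimately show ?thesis by linarith
qed

section \<open>A polytope of large volume\<close>

text \<open>With the scale \<open>58 = 2 * 29\<close> and \<open>sqrt 3\<close> split off,
  membership in the sphere is an integer identity and determinants are rational multiples of
  \<open>sqrt 3\<close>.\<close>

definition pt :: "real \<Rightarrow> real \<Rightarrow> real \<Rightarrow> real^3" where
  "pt x y z = (1 / 58) *\<^sub>R vector [x, sqrt 3 * y, z]"

lemma pt_component: "pt x y z $ 1 = x / 58" "pt x y z $ 2 = sqrt 3 * y / 58" "pt x y z $ 3 = z / 58"
  by (simp_all add: pt_def vector_def)

lemma pt_diff: "pt x y z - pt x' y' z' = pt (x - x') (y - y') (z - z')"
  by (simp add: vec3_eq pt_component diff_divide_distrib right_diff_distrib)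

lemma pt_eq: "pt x y z = pt x' y' z' \<longleftrightarrow> x = x' \<and> y = y' \<and> z = z'"
  by (auto simp: vec3_eq pt_component)

lemma det3_pt: "det3 (pt a b c) (pt d e f) (pt g h i)
    = sqrt 3 / 195112 * (a * (e * i - f * h) + b * (f * g - d * i) + c * (d * h - e * g))"
  by (simp add: det3_expand pt_component field_simps)

lemma norm_pt: "x\<^sup>2 + 3 * y\<^sup>2 + z\<^sup>2 = 3364 \<Longrightarrow> norm (pt x y z) = 1"
  by (simp add: norm_eq_1 inner3 pt_component power2_eq_square field_simps)

lemma measure_tetrahedron_pt:
  "measure lebesgue (convex hull {pt x y z, pt a b c, pt d e f, pt g h i})
     = sqrt 3 / 195112 * \<bar>(a-x) * ((e-y) * (i-z) - (f-z) * (h-y)) + (b-y) * ((f-z) * (g-x) - (d-x) * (i-z))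
         + (c-z) * ((d-x) * (h-y) - (e-y) * (g-x))\<bar> / 6"
  unfolding measure_tetrahedron pt_diff det3_pt by (simp add: abs_mult)

lemma good_polytope:
  "\<exists>P\<in>inscribed_polytopes 9. example_volume \<le> measure lebesgue P"
proof -
  \<comment> \<open>Bottom triangle, top triangle and the poles of the three rectangles;
    \<open>42^2 + 40^2 = 58^2\<close>.\<close>
  define A1 A2 A3 B1 B2 B3 C1 C2 C3 where
    "A1 = pt 42 0 (-40)" and "A2 = pt (-21) 21 (-40)" and "A3 = pt (-21) (-21) (-40)" and
    "B1 = pt 42 0 40" and "B2 = pt (-21) 21 40" and "B3 = pt (-21) (-21) 40" and
    "C1 = pt (-58) 0 0" and "C2 = pt 29 (-29) 0" and "C3 = pt 29 29 0"
  note defs = this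
  let ?m = "\<lambda>S. measure lebesgue (convex hull S)"
  let ?W = "{C3,C2,C1,B3,B2,A1,A2,A3,B1}"
  \<comment> \<open>The prism is built from three tetrahedra, then each rectangle receives a cap of
    two.\<close>
  have 1: "?m {A1,A2,A3,B1} = sqrt 3 / 195112 * 211680 / 6"
    unfolding defs measure_tetrahedron_pt by simp
  have 2: "?m {A1,A2,A3,B1} + ?m {B2,A2,A3,B1} \<le> ?m {B2,A1,A2,A3,B1}"
    by (rule glue_tetrahedron) (auto simp: defs pt_diff det3_pt det3_linear)
  have 3: "?m {B2,A1,A2,A3,B1} + ?m {B3,A3,B1,B2} \<le> ?m {B3,B2,A1,A2,A3,B1}"
    by (rule glue_tetrahedron) (auto simp: defs pt_diff det3_pt det3_linear)
  have 4: "?m {B3,B2,A1,A2,A3,B1} + (?m {C1,A2,A3,B3} + ?m {C1,A2,B3,B2}) \<le> ?m {C1,B3,B2,A1,A2,A3,B1}"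
    by (rule glue_pyramid) (auto simp: defs pt_diff det3_pt det3_linear)
  have 5: "?m {C1,B3,B2,A1,A2,A3,B1} + (?m {C2,A3,A1,B1} + ?m {C2,A3,B1,B3}) \<le> ?m {C2,C1,B3,B2,A1,A2,A3,B1}"
    by (rule glue_pyramid) (auto simp: defs pt_diff det3_pt det3_linear)
  have 6: "?m {C2,C1,B3,B2,A1,A2,A3,B1} + (?m {C3,A1,A2,B2} + ?m {C3,A1,B2,B1}) \<le> ?m ?W"
    by (rule glue_pyramid) (auto simp: defs pt_diff det3_pt det3_linear)
  have 7: "?m {B2,A2,A3,B1} = sqrt 3 / 195112 * 211680 / 6" "?m {B3,A3,B1,B2} = sqrt 3 / 195112 * 211680 / 6"
    "?m {C1,A2,A3,B3} = sqrt 3 / 195112 * 124320 / 6" "?m {C1,A2,B3,B2} = sqrt 3 / 195112 * 124320 / 6"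
    "?m {C2,A3,A1,B1} = sqrt 3 / 195112 * 124320 / 6" "?m {C2,A3,B1,B3} = sqrt 3 / 195112 * 124320 / 6"
    "?m {C3,A1,A2,B2} = sqrt 3 / 195112 * 124320 / 6" "?m {C3,A1,B2,B1} = sqrt 3 / 195112 * 124320 / 6"
    unfolding defs measure_tetrahedron_pt by simp_all
  have "example_volume \<le> ?m ?W"
    using 1 2 3 4 5 6 unfolding 7 example_volume_def by simp
  moreover have "convex hull ?W \<in> inscribed_polytopes 9"
  proof -
    have "?W \<subseteq> sphere 0 1" by (auto simp: defs norm_pt)
    then have "vertices (convex hull ?W) = ?W" by (rule vertices_sphere_hull)
    moreover have "card ?W = 9" by (simp add: defs pt_eq)
    moreover have "polytope (convex hull ?W)" by (rule polytope_convex_hull) simp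
    ultimately show ?thesis using \<open>?W \<subseteq> sphere 0 1\<close> by (simp add: inscribed_polytopes_def inscribed_in_def)
  qed
  ultimately show ?thesis by blast
qed

section \<open>Acute triangles and the one-sided case\<close>

text \<open>For a triangle with circumcentre 0 the sum of the vertices is the orthocentre, which
  stays within the circumscribed ball when the triangle contains its circumcentre. With
  \<open>k1\<close> the largest weight, the triangle inequality gives
  \<open>k1 \<le> k2 + k3\<close>, and \<open>k1\<close> times the sum is
  \<open>(k1 - k2) e2 + (k1 - k3) e3\<close>.\<close>

lemma norm_sum_balanced_aux:
  fixes e1 e2 e3 :: "'a::real_normed_vector"
  assumes n: "norm e1 = \<rho>" "norm e2 = \<rho>" "norm e3 = \<rho>" and k: "0 < k1" "k2 \<le> k1" "k3 \<le> k1" "0 \<le> k2" "0 \<le> k3"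
    and z: "k1 *\<^sub>R e1 + k2 *\<^sub>R e2 + k3 *\<^sub>R e3 = 0"
  shows "norm (e1 + e2 + e3) \<le> \<rho>"
proof -
  have e1: "k1 *\<^sub>R e1 = - (k2 *\<^sub>R e2 + k3 *\<^sub>R e3)" using z unfolding add.assoc eq_neg_iff_add_eq_0 .
  have "k1 * \<rho> = norm (k2 *\<^sub>R e2 + k3 *\<^sub>R e3)"
    using arg_cong[OF e1, of norm] n k unfolding norm_minus_cancel by simp
  also have "\<dots> \<le> k2 * \<rho> + k3 * \<rho>"
    using norm_triangle_ineq[of "k2 *\<^sub>R e2" "k3 *\<^sub>R e3"] n k by simp
  finally have 1: "k1 * \<rho> \<le> k2 * \<rho> + k3 * \<rho>" .
  have "k1 *\<^sub>R (e1 + e2 + e3) = (k1 - k2) *\<^sub>R e2 + (k1 - k3) *\<^sub>R e3"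
    unfolding scaleR_add_right e1 by (simp add: algebra_simps)
  then have "k1 * norm (e1 + e2 + e3) = norm ((k1 - k2) *\<^sub>R e2 + (k1 - k3) *\<^sub>R e3)"
    using k by (metis abs_of_pos norm_scaleR)
  also have "\<dots> \<le> (k1 - k2) * \<rho> + (k1 - k3) * \<rho>"
    using norm_triangle_ineq[of "(k1 - k2) *\<^sub>R e2" "(k1 - k3) *\<^sub>R e3"] n k by simp
  also have "\<dots> \<le> k1 * \<rho>" using 1 by (simp add: algebra_simps)
  finally show ?thesis using k by simp
qed

lemma norm_sum_balanced:
  fixes e1 e2 e3 :: "'a::real_normed_vector"
  assumes n: "norm e1 = \<rho>" "norm e2 = \<rho>" "norm e3 = \<rho>" and k: "0 \<le> k1" "0 \<le> k2" "0 \<le> k3" "k1 + k2 + k3 > 0"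
    and z: "k1 *\<^sub>R e1 + k2 *\<^sub>R e2 + k3 *\<^sub>R e3 = 0"
  shows "norm (e1 + e2 + e3) \<le> \<rho>"
proof -
  consider "k2 \<le> k1" "k3 \<le> k1" | "k1 \<le> k2" "k3 \<le> k2" | "k1 \<le> k3" "k2 \<le> k3" by linarith
  then show ?thesis
  proof cases
    case 1
    then show ?thesis using norm_sum_balanced_aux[OF n, of k1 k2 k3] k z by auto
  next
    case 2
    have "k2 *\<^sub>R e2 + k1 *\<^sub>R e1 + k3 *\<^sub>R e3 = 0" using z by (simp add: add_ac)
    then have "norm (e2 + e1 + e3) \<le> \<rho>" using norm_sum_balanced_aux[OF n(2,1,3), of k2 k1 k3] k 2 by auto
    then show ?thesis by (simp add: add_ac)
  next
    case 3
    have "k3 *\<^sub>R e3 + k1 *\<^sub>R e1 + k2 *\<^sub>R e2 = 0" using z by (simp add: add_ac)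
    then have "norm (e3 + e1 + e2) \<le> \<rho>" using norm_sum_balanced_aux[OF n(3,1,2), of k3 k1 k2] k 3 by auto
    then show ?thesis by (simp add: add_ac)
  qed
qed

text \<open>Orthogonally to \<open>v\<close> the three points have equal length and are balanced by
  the weights, so the squared norm of their sum there is at most \<open>1 - h^2\<close>. The
  components along \<open>v\<close> contribute \<open>9 h^2\<close>.\<close>

lemma acute_triangle:
  fixes a b c v :: "real^3"
  assumes n: "norm a = 1" "norm b = 1" "norm c = 1" "norm v = 1"
    and h: "v \<bullet> a = h" "v \<bullet> b = h" "v \<bullet> c = h"
    and k: "0 \<le> k1" "0 \<le> k2" "0 \<le> k3" and vk: "v = k1 *\<^sub>R a + k2 *\<^sub>R b + k3 *\<^sub>R c"
  shows "(norm (a + b + c))\<^sup>2 \<le> 1 + 8 * h\<^sup>2"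
proof -
  have vv: "v \<bullet> v = 1" using n by (simp add: norm_eq_1)
  have hk: "h * (k1 + k2 + k3) = 1"
    using arg_cong[OF vk, of "\<lambda>x. v \<bullet> x"] h vv by (simp add: inner_add_right algebra_simps)
  then have ks: "k1 + k2 + k3 > 0" using k by (metis add_nonneg_nonneg less_eq_real_def mult_zero_right zero_neq_one)
  have nE: "norm (x - h *\<^sub>R v) = sqrt (1 - h\<^sup>2)" if "norm x = 1" "v \<bullet> x = h" for x
  proof -
    have "(x - h *\<^sub>R v) \<bullet> (x - h *\<^sub>R v) = 1 - h\<^sup>2"
      using that vv by (simp add: inner_diff inner_commute norm_eq_1 power2_eq_square)
    then show ?thesis by (simp add: norm_eq_sqrt_inner)
  qed
  define E where "E = (a - h *\<^sub>R v) + (b - h *\<^sub>R v) + (c - h *\<^sub>R v)"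
  have "norm E \<le> sqrt (1 - h\<^sup>2)"
    unfolding E_def
  proof (rule norm_sum_balanced[OF nE[OF n(1) h(1)] nE[OF n(2) h(2)] nE[OF n(3) h(3)] k ks])
    have "k1 *\<^sub>R (a - h *\<^sub>R v) + k2 *\<^sub>R (b - h *\<^sub>R v) + k3 *\<^sub>R (c - h *\<^sub>R v)
       = (k1 *\<^sub>R a + k2 *\<^sub>R b + k3 *\<^sub>R c) - (h * (k1 + k2 + k3)) *\<^sub>R v"
      by (simp add: algebra_simps)
    then show "k1 *\<^sub>R (a - h *\<^sub>R v) + k2 *\<^sub>R (b - h *\<^sub>R v) + k3 *\<^sub>R (c - h *\<^sub>R v) = 0"
      unfolding hk vk[symmetric] by simp
  qed
  moreover have "\<bar>h\<bar> \<le> 1" using Cauchy_Schwarz_ineq2[of v a] n h by simp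
  then have "1 - h\<^sup>2 \<ge> 0" using abs_square_le_1[of h] by simp
  ultimately have "(norm E)\<^sup>2 \<le> 1 - h\<^sup>2"
    by (metis norm_ge_zero power_mono real_sqrt_pow2)
  moreover have "a + b + c = E + (3 * h) *\<^sub>R v" by (simp add: E_def algebra_simps flip: scaleR_add_left)
  moreover have "v \<bullet> E = 0" unfolding E_def inner_add_right inner_diff_right inner_scaleR_right h vv by simp
  ultimately show ?thesis
    unfolding power2_norm_eq_inner using vv
    by (simp add: inner_add inner_commute power2_eq_square)
qed

lemma negligible_empty_interior:
  fixes S :: "'a::euclidean_space set"
  assumes "convex S" "interior S = {}" shows "negligible S"
  using assms negligible_convex_interior by blast

text \<open>A plane through the centre has \<open>W\<close> on one side and \<open>-W\<close> on the
  other, so the hull of both holds the volume twice. It has at most 16 vertices, hence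
  \<open>28 = 2 * 16 - 4\<close>.\<close>

lemma one_sided_volume_bound:
  fixes W :: "(real^3) set"
  assumes fin: "finite W" and sph: "W \<subseteq> sphere 0 1" and n: "card W = 8" and out: "0 \<notin> interior (convex hull W)" and s: "1 \<le> s"
  shows "2 * measure lebesgue (convex hull W) \<le> 4 * pi * slope s + 28 * offset s"
proof (cases "interior (convex hull W) = {}")
  case True
  have "measure lebesgue (convex hull W) = 0"
    by (rule negligible_imp_measure0[OF negligible_empty_interior[OF convex_convex_hull True]])
  moreover have "slope s \<ge> 0" using s by (simp add: slope_def)
  ultimately show ?thesis using offset_nonneg[OF s] by simp
next
  case False
  obtain u where u: "u \<noteq> 0" "\<forall>x\<in>interior (convex hull W). 0 \<le> u \<bullet> x"
    using separating_hyperplane_set_0[OF convex_interior[OF convex_convex_hull] out] by blast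
  have u2: "convex hull W \<subseteq> {x. u \<bullet> x \<ge> 0}"
  proof -
    have "closure (interior (convex hull W)) \<subseteq> {x. u \<bullet> x \<ge> 0}"
      by (rule closure_minimal) (use u in \<open>auto simp: closed_halfspace_ge\<close>)
    moreover have "convex hull W \<subseteq> closure (interior (convex hull W))"
      using convex_closure_interior[OF convex_convex_hull False] closure_subset by blast
    ultimately show ?thesis by blast
  qed
  define V where "V = W \<union> uminus ` W"
  have finV: "finite V" and sphV: "V \<subseteq> sphere 0 1" using fin sph by (auto simp: V_def)
  have cV: "card V \<le> 16" "3 \<le> card V"
  proof -
    have "card V \<le> card W + card (uminus ` W)" unfolding V_def by (rule card_Un_le)
    also have "card (uminus ` W) \<le> card W" by (rule card_image_le[OF fin])
    finally show "card V \<le> 16" using n by simp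
    have "card W \<le> card V" by (rule card_mono[OF finV]) (simp add: V_def)
    then show "3 \<le> card V" using n by simp
  qed
  have neg: "convex hull (uminus ` W) = uminus ` (convex hull W)"
    by (rule convex_hull_linear_image[symmetric]) (simp add: linear_uminus)
  have mneg: "measure lebesgue (uminus ` (convex hull W)) = measure lebesgue (convex hull W)"
    by (rule measure_orthogonal_image[OF _ hull_lmeasurable[OF fin]]) (simp add: orthogonal_transformation linear_uminus)
  have "measure lebesgue (convex hull (uminus ` W)) + measure lebesgue (convex hull W) \<le> measure lebesgue (convex hull V)"
  proof (rule measure_glue[OF _ _ _ _ _ u(1)])
    show "convex hull (uminus ` W) \<subseteq> {x. u \<bullet> x \<le> 0}" unfolding neg using u2 by auto
    show "convex hull (uminus ` W) \<subseteq> convex hull V" "convex hull W \<subseteq> convex hull V"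
      by (auto simp: V_def intro!: hull_mono)
  qed (use u2 fin finV in \<open>auto intro!: hull_lmeasurable\<close>)
  then have "2 * measure lebesgue (convex hull W) \<le> measure lebesgue (convex hull V)" unfolding neg mneg by simp
  \<comment> \<open>The hull of \<open>V\<close> is symmetric, so 0 is the midpoint of two interior
    points.\<close>
  moreover have "0 \<in> interior (convex hull V)"
  proof -
    obtain x where x: "x \<in> interior (convex hull W)" using False by blast
    have sub: "interior (convex hull W) \<subseteq> interior (convex hull V)"
      by (intro interior_mono hull_mono) (simp add: V_def)
    have V': "uminus ` V = V" by (auto simp: V_def image_Un image_image)
    have "uminus ` (convex hull V) = convex hull V"
      using convex_hull_linear_image[of uminus V] V' by (simp add: linear_uminus)
    then have "interior (convex hull V) = uminus ` interior (convex hull V)"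
      using interior_negations[of "convex hull V"] by simp
    then have "- x \<in> interior (convex hull V)" using x sub by (metis image_eqI subsetD)
    then have "(1/2) *\<^sub>R x + (1/2) *\<^sub>R (- x) \<in> interior (convex hull V)"
      using x sub convexD[OF convex_interior[OF convex_convex_hull, of V], of x "- x" "1/2" "1/2"] by auto
    then show ?thesis by simp
  qed
  then have "measure lebesgue (convex hull V) \<le> 4 * pi * slope s + (2 * real (card V) - 4) * offset s"
    by (rule inscribed_volume_bound[OF finV sphV _ cV(2) s])
  \<comment> \<open>Antipodal pairs in \<open>W\<close> can make \<open>V\<close> smaller than 16;
    \<open>offset s \<ge> 0\<close> absorbs this.\<close>
  moreover have "(2 * real (card V) - 4) * offset s \<le> 28 * offset s"
    by (rule mult_right_mono) (use cV offset_nonneg[OF s] in auto)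
  ultimately show ?thesis by linarith
qed

text \<open>In the cone at \<open>v\<close> the coefficient sum tells the side of the plane
  \<open>abc\<close>. A further point of \<open>W\<close> cannot have sum at most 1, since the
  tetrahedron meets the sphere only in its vertices. For the decomposition, a point beyond
  \<open>abc\<close> lies on a segment from \<open>v\<close> to some \<open>q\<close> in the hull of
  \<open>W - {v}\<close>, and this segment has crossed the triangle before.\<close>

lemma trivalent_decomposition:
  fixes W :: "(real^3) set"
  assumes fin: "finite W" and sph: "W \<subseteq> sphere 0 1" and v: "v \<in> W" and abc: "{a,b,c} \<subseteq> W - {v}"
    and D': "det3 (a - v) (b - v) (c - v) < 0"
    and cone: "convex hull W \<subseteq> tcone v a b c"
  shows "\<And>w. w \<in> W - {v,a,b,c} \<Longrightarrow> tnormal a b c \<bullet> w < det3 a b c"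
    and "convex hull W \<subseteq> convex hull (W - {v}) \<union> convex hull {v,a,b,c}"
proof -
  define N where "N = tnormal a b c"
  define D where "D = det3 a b c"
  have Nx: "N \<bullet> (v + \<alpha> *\<^sub>R (a - v) + \<beta> *\<^sub>R (b - v) + \<gamma> *\<^sub>R (c - v)) = D + (\<alpha> + \<beta> + \<gamma> - 1) * det3 (a - v) (b - v) (c - v)" for \<alpha> \<beta> \<gamma>
    unfolding tnormal_inner(4) N_def D_def inner_add_right inner_diff_right inner_scaleR_right tnormal_inner(1-3)
    by (simp add: algebra_simps)
  have tet: "v + \<alpha> *\<^sub>R (a - v) + \<beta> *\<^sub>R (b - v) + \<gamma> *\<^sub>R (c - v) \<in> convex hull {v,a,b,c}"
    if "0 \<le> \<alpha>" "0 \<le> \<beta>" "0 \<le> \<gamma>" "\<alpha> + \<beta> + \<gamma> \<le> 1" for \<alpha> \<beta> \<gamma>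
  proof -
    have i: "v \<in> convex hull {v,a,b,c}" "a \<in> convex hull {v,a,b,c}" "b \<in> convex hull {v,a,b,c}" "c \<in> convex hull {v,a,b,c}"
      by (auto intro: hull_inc)
    define k where "k = (\<lambda>j::nat. if j = 0 then 1 - (\<alpha> + \<beta> + \<gamma>) else if j = 1 then \<alpha> else if j = 2 then \<beta> else \<gamma>)"
    define p where "p = (\<lambda>j::nat. if j = 0 then v else if j = 1 then a else if j = 2 then b else c)"
    have "(\<Sum>j\<in>{0,1,2,3}. k j *\<^sub>R p j) \<in> convex hull {v,a,b,c}"
      by (rule convex_sum[OF _ convex_convex_hull]) (use that i in \<open>auto simp: k_def p_def\<close>)
    moreover have "(\<Sum>j\<in>{0,1,2,3}. k j *\<^sub>R p j) = v + \<alpha> *\<^sub>R (a - v) + \<beta> *\<^sub>R (b - v) + \<gamma> *\<^sub>R (c - v)"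
      by (simp add: k_def p_def algebra_simps)
    ultimately show ?thesis by simp
  qed
  show strict: "tnormal a b c \<bullet> w < det3 a b c" if w: "w \<in> W - {v,a,b,c}" for w
  proof -
    obtain \<alpha> \<beta> \<gamma> where k: "0 \<le> \<alpha>" "0 \<le> \<beta>" "0 \<le> \<gamma>" "w = v + \<alpha> *\<^sub>R (a - v) + \<beta> *\<^sub>R (b - v) + \<gamma> *\<^sub>R (c - v)"
      using cone hull_inc[of w W convex] w unfolding tcone_def by blast
    have "\<alpha> + \<beta> + \<gamma> > 1"
    proof (rule ccontr)
      assume "\<not> ?thesis"
      then have "w \<in> convex hull {v,a,b,c}" unfolding k(4) using k(1-3) by (intro tet) auto
      then have "w \<in> {v,a,b,c}" by (rule sphere_in_hull[rotated 2]) (use w abc v sph in auto)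
      then show False using w by blast
    qed
    then have "(\<alpha> + \<beta> + \<gamma> - 1) * det3 (a - v) (b - v) (c - v) < 0" using D' by (simp add: mult_pos_neg)
    then show ?thesis using Nx[of \<alpha> \<beta> \<gamma>] unfolding N_def D_def k(4)[symmetric] by linarith
  qed
  show "convex hull W \<subseteq> convex hull (W - {v}) \<union> convex hull {v,a,b,c}"
  proof
    fix x assume x: "x \<in> convex hull W"
    obtain \<alpha> \<beta> \<gamma> where k: "0 \<le> \<alpha>" "0 \<le> \<beta>" "0 \<le> \<gamma>" "x = v + \<alpha> *\<^sub>R (a - v) + \<beta> *\<^sub>R (b - v) + \<gamma> *\<^sub>R (c - v)"
      using cone x unfolding tcone_def by blast
    define \<sigma> where "\<sigma> = \<alpha> + \<beta> + \<gamma>"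
    show "x \<in> convex hull (W - {v}) \<union> convex hull {v,a,b,c}"
    proof (cases "\<sigma> \<le> 1")
      case True
      then show ?thesis using tet[OF k(1-3)] k(4) by (simp add: \<sigma>_def)
    next
      case False
      have "W = insert v (W - {v})" using v by blast
      then have "x \<in> convex hull (insert v (W - {v}))" using x by simp
      moreover have "W - {v} \<noteq> {}" using abc by blast
      ultimately obtain r q where rq: "0 \<le> r" "r \<le> 1" "q \<in> convex hull (W - {v})" "x = (1 - r) *\<^sub>R v + r *\<^sub>R q"
        unfolding convex_hull_insert_alt by (auto split: if_splits)
      \<comment> \<open>The point where the segment from \<open>v\<close> to \<open>x\<close>
        crosses the triangle \<open>abc\<close>.\<close>
      define z where "z = v + (1 / \<sigma>) *\<^sub>R (x - v)"
      have s0: "\<sigma> > 1" using False by simp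
      have "z \<in> convex hull {a,b,c}"
      proof -
        have "z = (\<alpha> / \<sigma>) *\<^sub>R a + (\<beta> / \<sigma>) *\<^sub>R b + (\<gamma> / \<sigma>) *\<^sub>R c + (1 - (\<alpha> / \<sigma> + \<beta> / \<sigma> + \<gamma> / \<sigma>)) *\<^sub>R v"
          unfolding z_def k(4) by (simp add: algebra_simps)
        moreover have "\<alpha> / \<sigma> + \<beta> / \<sigma> + \<gamma> / \<sigma> = 1" using s0 by (simp add: \<sigma>_def flip: add_divide_distrib)
        ultimately have "z = (\<alpha> / \<sigma>) *\<^sub>R a + (\<beta> / \<sigma>) *\<^sub>R b + (\<gamma> / \<sigma>) *\<^sub>R c" by simp
        then show ?thesis unfolding convex_hull_3
          using k(1-3) s0 \<open>\<alpha> / \<sigma> + \<beta> / \<sigma> + \<gamma> / \<sigma> = 1\<close> by (intro CollectI exI conjI) auto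
      qed
      then have z: "z \<in> convex hull (W - {v})" using hull_mono[OF abc] by blast
      \<comment> \<open>On the segment from \<open>v\<close> to \<open>q\<close> the points
        \<open>z\<close> and \<open>x\<close> have parameters \<open>r / \<sigma>\<close> and
        \<open>r\<close>; \<open>t\<close> is the parameter of \<open>x\<close> between
        \<open>z\<close> and \<open>q\<close>.\<close>
      define t where "t = (r - r / \<sigma>) / (1 - r / \<sigma>)"
      have rs: "r / \<sigma> < 1" "r / \<sigma> \<le> r"
        using rq s0 divide_left_mono[of 1 \<sigma> r] by (auto simp: divide_less_eq)
      have t: "0 \<le> t" unfolding t_def by (rule divide_nonneg_nonneg) (use rs in auto)
      have "t \<le> 1 \<longleftrightarrow> r - r / \<sigma> \<le> 1 - r / \<sigma>"
        unfolding t_def by (rule divide_le_eq_1_pos) (use rs in linarith)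
      then have t1: "t \<le> 1" using rq by linarith
      have tr: "(1 - t) * (r / \<sigma>) + t = r"
      proof -
        have cancel: "x / y * y = x" if "y \<noteq> 0" for x y :: real using that by simp
        have "1 - r / \<sigma> \<noteq> 0" using rs by linarith
        then have "t * (1 - r / \<sigma>) = r - r / \<sigma>" unfolding t_def by (rule cancel)
        moreover have "(1 - t) * (r / \<sigma>) + t = t * (1 - r / \<sigma>) + r / \<sigma>"
          by (simp only: left_diff_distrib right_diff_distrib mult_1_left mult_1_right)
        ultimately show ?thesis by linarith
      qed
      have xv: "x = v + r *\<^sub>R (q - v)" using rq(4) by (simp add: algebra_simps)
      have "(1 - t) *\<^sub>R z + t *\<^sub>R q = v + ((1 - t) * (r / \<sigma>) + t) *\<^sub>R (q - v)"
        unfolding z_def xv by (simp add: algebra_simps)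
      then have "(1 - t) *\<^sub>R z + t *\<^sub>R q = x" unfolding tr xv .
      moreover have "(1 - t) *\<^sub>R z + t *\<^sub>R q \<in> convex hull (W - {v})"
        using convexD_alt[OF convex_convex_hull z rq(3) t t1] .
      ultimately show ?thesis by simp
    qed
  qed
qed

theorem lemma3p7:
  fixes Q :: "(real ^ 3) set"
  assumes "Q \<in> inscribed_polytopes 9"
    and "\<And>P. P \<in> inscribed_polytopes 9 \<Longrightarrow> measure lebesgue P \<le> measure lebesgue Q"
  shows "\<not> (\<exists>v. trivalent_vertex Q v)"
proof
  assume "\<exists>v. trivalent_vertex Q v"
  then obtain v where v: "v \<in> vertices Q" "vertex_degree Q v = 3" unfolding trivalent_vertex_def by blast
  define W where "W = vertices Q"
  have W: "polytope Q" "card W = 9" "W \<subseteq> sphere 0 1"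
    using assms(1) by (auto simp: inscribed_polytopes_def inscribed_in_def W_def)
  have fin: "finite W" using W(2) by (metis card.infinite zero_neq_numeral)
  have Q: "Q = convex hull W"
    unfolding W_def vertices_def using W(1) Krein_Milman_Minkowski[of Q] polytope_imp_compact polytope_imp_convex by blast
  have big: "example_volume \<le> measure lebesgue Q" using good_polytope assms(2) by force
  have vW: "v \<in> W" using v W_def by simp
  have pos: "measure lebesgue (convex hull W) > 0" using big example_volume_ge Q by simp
  obtain a b c where abc: "{a,b,c} \<subseteq> W - {v}" and D': "det3 (a - v) (b - v) (c - v) < 0"
    and cone: "convex hull W \<subseteq> tcone v a b c"
    using trivalent_cone[OF fin W(3) vW v(2)[unfolded Q] pos] by blast
  define D where "D = det3 a b c"
  define N where "N = tnormal a b c"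
  define m where "m = norm N"
  define W' where "W' = W - {v}"
  have fin': "finite W'" and sph': "W' \<subseteq> sphere 0 1" and card': "card W' = 8"
    using fin W vW by (auto simp: W'_def)
  have n: "norm a = 1" "norm b = 1" "norm c = 1" "norm v = 1" using abc vW W(3) by auto
  have strict: "\<And>w. w \<in> W - {v,a,b,c} \<Longrightarrow> N \<bullet> w < D"
    and dec: "convex hull W \<subseteq> convex hull W' \<union> convex hull {v,a,b,c}"
    using trivalent_decomposition[OF fin W(3) vW abc D' cone] unfolding N_def D_def W'_def by blast+
  have Nabc: "N \<bullet> a = D" "N \<bullet> b = D" "N \<bullet> c = D" unfolding N_def D_def by (rule tnormal_inner)+
  have Nv: "det3 (a - v) (b - v) (c - v) = D - N \<bullet> v" unfolding N_def D_def by (rule tnormal_inner(4))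
  have leN: "N \<bullet> w \<le> D" if "w \<in> W'" for w
    using strict[of w] that Nabc unfolding W'_def by (cases "w \<in> {a,b,c}") (auto intro: less_imp_le)
  have Qle: "measure lebesgue Q \<le> measure lebesgue (convex hull W') + measure lebesgue (convex hull {v,a,b,c})"
  proof -
    have l: "convex hull W \<in> lmeasurable" "convex hull W' \<in> lmeasurable" "convex hull {v,a,b,c} \<in> lmeasurable"
      using fin fin' by (auto intro!: hull_lmeasurable)
    have "measure lebesgue Q \<le> measure lebesgue (convex hull W' \<union> convex hull {v,a,b,c})"
      unfolding Q by (rule measure_mono_fmeasurable[OF dec]) (use l in \<open>auto simp: fmeasurableD\<close>)
    also have "\<dots> \<le> measure lebesgue (convex hull W') + measure lebesgue (convex hull {v,a,b,c})"
      by (rule measure_Un_le) (use l in \<open>auto simp: fmeasurableD\<close>)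
    finally show ?thesis .
  qed
  show False
  proof (cases "0 \<in> interior (convex hull W')")
    case False
    \<comment> \<open>In this case the crude bound by a regular tetrahedron is enough for the part
      at \<open>v\<close>.\<close>
    have half: "2 * measure lebesgue (convex hull W') \<le> 4 * pi * slope (3/2) + 28 * offset (3/2)"
      by (rule one_sided_volume_bound[OF fin' sph' card' False]) simp
    have contra: False if "2 * A \<le> X" "q \<le> A + T" "B \<le> q" "X / 2 + S < B" "T \<le> S" for A X q T B S :: real
      using that by linarith
    show False by (rule contra[OF half Qle big bound_outside_lt_example tetrahedron_volume_le[OF n]])
  next
    case True
    have hullN: "convex hull W' \<subseteq> {x. N \<bullet> x \<le> D}" by (rule hull_le) (use leN in auto)
    have N0: "N \<noteq> 0" using D' Nv Nabc(1) by auto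
    then have m0: "m > 0" by (simp add: m_def)
    have D0: "D > 0"
    proof -
      have "interior (convex hull W') \<subseteq> interior {x. N \<bullet> x \<le> D}" by (rule interior_mono[OF hullN])
      then show ?thesis using True N0 by (auto simp: interior_halfspace_le)
    qed
    define u where "u = (1 / D) *\<^sub>R N"
    let ?K = "2 * carg (1 + b \<bullet> c + c \<bullet> a + a \<bullet> b) D"
    have abc': "{a,b,c} \<subseteq> W'" using abc by (simp add: W'_def)
    have Q': "measure lebesgue (convex hull W') \<le> 4 * pi * slope (5/4) + (2 * real (card W') - 5) * offset (5/4)
        + D / 6 - slope (5/4) * ?K"
      unfolding D_def
    proof (rule inscribed_volume_bound_face[OF fin' sph' True _ abc'])
      show "u \<bullet> a = 1" "u \<bullet> b = 1" "u \<bullet> c = 1" using Nabc D0 by (simp_all add: u_def)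
      show "u \<bullet> w < 1" if "w \<in> W' - {a,b,c}" for w
        using strict[of w] that D0 by (auto simp: u_def W'_def)
    qed (use D0 in \<open>auto simp: D_def\<close>)
    \<comment> \<open>The pole of \<open>abc\<close>, the point of the sphere farthest beyond its
      plane and so the best place for the ninth vertex.\<close>
    define p where "p = (1 / m) *\<^sub>R N"
    have pn: "norm p = 1" using m0 by (simp add: p_def m_def)
    have Np: "N \<bullet> p = m" using m0 by (simp add: p_def m_def dot_square_norm power2_eq_square)
    have NvD: "N \<bullet> v > D" using D' Nv by linarith
    have Nvm: "N \<bullet> v \<le> m" using norm_cauchy_schwarz[of N v] n(4) by (simp add: m_def)
    \<comment> \<open>The pole is at least as far beyond the plane \<open>abc\<close> as
      \<open>v\<close>, so it is a new point and the competitor has nine vertices.\<close>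
    have pW: "p \<notin> W'" using leN[of p] Np NvD Nvm by auto
    have dp: "det3 (a - p) (b - p) (c - p) = D - m" using Np unfolding N_def D_def tnormal_inner(4) by simp
    have tp: "measure lebesgue (convex hull {p,a,b,c}) = (m - D) / 6"
      unfolding measure_tetrahedron dp using NvD Nvm by simp
    have "convex hull (insert p W') \<in> inscribed_polytopes 9"
    proof -
      have "insert p W' \<subseteq> sphere 0 1" using sph' pn by auto
      then have "vertices (convex hull (insert p W')) = insert p W'" by (rule vertices_sphere_hull)
      moreover have "card (insert p W') = 9" using fin' card' pW by simp
      moreover have "polytope (convex hull (insert p W'))" by (rule polytope_convex_hull) (use fin' in simp)
      ultimately show ?thesis using \<open>insert p W' \<subseteq> sphere 0 1\<close> by (simp add: inscribed_polytopes_def inscribed_in_def)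
    qed
    then have comp: "measure lebesgue (convex hull (insert p W')) \<le> measure lebesgue Q" by (rule assms(2))
    have glue: "measure lebesgue (convex hull W') + measure lebesgue (convex hull {p,a,b,c})
        \<le> measure lebesgue (convex hull (insert p W'))"
    proof (rule glue_tetrahedron[OF fin'])
      show "det3 (a - x) (b - x) (c - x) \<ge> 0" if "x \<in> W'" for x
        using leN[OF that] unfolding N_def D_def tnormal_inner(4) by simp
    qed (use abc' dp NvD Nvm in auto)
    have tv: "measure lebesgue (convex hull {v,a,b,c}) = (N \<bullet> v - D) / 6"
      unfolding measure_tetrahedron Nv using NvD by simp
    have opt: "M \<le> L" if "P \<le> q" "A + T \<le> P" "q \<le> A + U" "T = (M - d) / 6" "U = (L - d) / 6"
      for A P q T U M L d :: real using that by (simp add: field_simps)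
    \<comment> \<open>Maximality against the pole gives one inequality, Cauchy-Schwarz the other;
      equality makes \<open>v\<close> the pole.\<close>
    have "m \<le> N \<bullet> v" by (rule opt[OF comp glue Qle tp tv])
    then have "N \<bullet> v = m" using Nvm by (rule antisym[rotated])
    then have "N \<bullet> v = norm N * norm v" using n(4) by (simp add: m_def)
    then have "norm N *\<^sub>R v = norm v *\<^sub>R N" using norm_cauchy_schwarz_eq by blast
    then have mv: "m *\<^sub>R v = N" using n(4) by (simp add: m_def)
    define h where "h = D / m"
    have vh: "v \<bullet> x = h" if "N \<bullet> x = D" for x
    proof -
      have "m * (v \<bullet> x) = D" using that mv by (metis inner_scaleR_left)
      then show ?thesis using m0 by (simp add: h_def field_simps)
    qed
    \<comment> \<open>The centre lies in the cone at \<open>v\<close>, and \<open>v\<close> is on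
      the axis of \<open>abc\<close>, so the axis meets the triangle: \<open>v\<close> is a
      nonnegative combination of \<open>a\<close>, \<open>b\<close>, \<open>c\<close>, which is
      acuteness in the form used.\<close>
    have "0 \<in> convex hull W"
      using True interior_subset hull_mono[of W' W convex] by (auto simp: W'_def)
    then obtain \<alpha> \<beta> \<gamma> where k: "0 \<le> \<alpha>" "0 \<le> \<beta>" "0 \<le> \<gamma>" "0 = v + \<alpha> *\<^sub>R (a - v) + \<beta> *\<^sub>R (b - v) + \<gamma> *\<^sub>R (c - v)"
      using cone unfolding tcone_def by blast
    define \<sigma> where "\<sigma> = \<alpha> + \<beta> + \<gamma> - 1"
    have vs: "\<sigma> *\<^sub>R v = \<alpha> *\<^sub>R a + \<beta> *\<^sub>R b + \<gamma> *\<^sub>R c" using k(4) by (simp add: \<sigma>_def algebra_simps)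
    \<comment> \<open>Applying \<open>N\<close> to \<open>vs\<close> gives
      \<open>\<sigma> * (N \<bullet> v - D) = D\<close>, with both \<open>D\<close> and the bracket
      positive.\<close>
    have s0: "\<sigma> > 0"
    proof -
      have "\<sigma> * (N \<bullet> v) = (\<sigma> + 1) * D"
        using arg_cong[OF vs, of "\<lambda>x. N \<bullet> x"] Nabc by (simp add: inner_add_right \<sigma>_def algebra_simps)
      then have "\<sigma> * (N \<bullet> v - D) = D" by (simp add: algebra_simps)
      then show ?thesis using D0 NvD by (metis diff_gt_0_iff_gt zero_less_mult_pos2)
    qed
    have "(norm (a + b + c))\<^sup>2 \<le> 1 + 8 * h\<^sup>2"
    proof (rule acute_triangle[OF n vh[OF Nabc(1)] vh[OF Nabc(2)] vh[OF Nabc(3)]])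
      have "v = (1 / \<sigma>) *\<^sub>R (\<sigma> *\<^sub>R v)" using s0 by simp
      then show "v = (\<alpha> / \<sigma>) *\<^sub>R a + (\<beta> / \<sigma>) *\<^sub>R b + (\<gamma> / \<sigma>) *\<^sub>R c" unfolding vs by (simp add: scaleR_add_right)
    qed (use k s0 in auto)
    then have cap: "m / 6 \<le> slope (5/4) * ?K + cap_const (slope (5/4))"
      using cap_bound[OF n(1-3), of "slope (5/4)"] D0 unfolding h_def D_def m_def N_def
      by (simp add: slope_def power4_eq_xxxx)
    have tv': "measure lebesgue (convex hull {v,a,b,c}) = (m - D) / 6" using tv unfolding \<open>N \<bullet> v = m\<close> .
    have eleven: "2 * real (card W') - 5 = 11" using card' by simp
    \<comment> \<open>The cone volume \<open>D / 6\<close> and the tetrahedron volume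
      \<open>(m - D) / 6\<close> add up to \<open>m / 6\<close>, which \<open>cap\<close> bounds;
      the solid angle of \<open>abc\<close> then cancels.\<close>
    have contra: False if "A \<le> S + R + d / 6 - K" "q \<le> A + T" "T = (M - d) / 6" "M / 6 \<le> K + C" "B \<le> q" "S + R + C < B"
      for A S R d K q T M C B :: real using that by (simp add: field_simps)
    show False by (rule contra[OF Q'[unfolded eleven] Qle tv' cap big bound_inside_lt_example])
  qed
qed

end
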